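(* For every integer $k$ with $0\le k\le 11$, there is a set $\mathcal{L}$ of local chains of deficit $k$ and an involution $\mathcal{S}\mapsto\mathcal{S}^*$ on $\mathcal{L}$ such that: (a) for every $\mu\in\mathrm{Par}(k)$, $\mathrm{tail}(\mu)$ belongs to $\mathcal{L}$; (b) for any two distinct chains in $\mathcal{L}$, either the two chains are disjoint or the right part of one chain equals the left part of the other chain; (c) every $\gamma\in\mathrm{Def}(k)$ belongs to exactly one or two local chains in $\mathcal{L}$; in the former case $\gamma$ belongs to the middle part of the chain, and in the latter case $\gamma$ belongs to the right part of one chain and the left part of the other; (d) for all $\mathcal{S}\in\mathcal{L}$, the local chains $\mathcal{S}$ and $\mathcal{S}^*$ are locally opposite; (e) for all $\mathcal{S},\mathcal{T}\in\mathcal{L}$, if $\mathcal{S}\cap\mathcal{T}\neq\emptyset$ then $\mathcal{S}^*\cap\mathcal{T}^*\neq\emptyset$; (f) for all $\mathcal{S}\in\mathcal{L}$, $\mathrm{left}(\mathcal{S})\cup\mathrm{mid}(\mathcal{S})$ is a union of $\nu$-segments (the empty union being allowed).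
   Context: **Partitions and statistics.** An integer partition $\gamma=(\gamma_1\ge\cdots\ge\gamma_s>0)$ (possibly empty) has length $\ell(\gamma)=s$, size $|\gamma|=\sum\gamma_i$, $\gamma_i=0$ for $i>s$; zero parts may be appended without changing the partition. Its diagram is the set of cells $(i,j)$ with $1\le i\le \ell(\gamma)$, $1\le j\le\gamma_i$; $\gamma'$ is the conjugate. For a cell $c=(i,j)$, $\mathrm{arm}(c)=\gamma_i-j$ and $\mathrm{leg}(c)=\gamma'_j-i$. $\mathrm{dinv}(\gamma)$ is the number of cells $c$ with $\mathrm{arm}(c)-\mathrm{leg}(c)\in\{0,1\}$; $\mathrm{defc}(\gamma)=|\gamma|-\mathrm{dinv}(\gamma)$. $\min_\Delta(\gamma)$ is the least positive integer $n$ such that $\gamma_i\le n-i$ for $1\le i\le\ell(\gamma)$ (i.e. the diagram fits inside that of $(n-1,n-2,\ldots,1)$). $\mathrm{Par}(k)$ is the set of partitions of size $k$, and $\mathrm{Def}(k)$ is the set of partitions with $\mathrm{defc}=k$. **The map $\nu$.** $\nu$ is defined on partitions $\gamma$ with $\gamma_1\le\ell(\gamma)+2$ by $\nu(\gamma)=(\ell(\gamma)+1,\gamma_1-1,\ldots,\gamma_{\ell(\gamma)}-1)$. It is injective, raises dinv by 1 and preserves defc. The $\nu$-segment generated by $\gamma$ is the set of all $\nu^m(\gamma)$, over integers $m$ (positive, zero or negative) for which $\nu^m(\gamma)$ is defined. **Tails.** For a nonempty partition $\mu$ with $n_i$ parts equal to $i$, put $N=\mu_1+\ell(\mu)+1$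 and let $v=(v_1,\ldots,v_N)=(0,0,1^{n_1},0,1^{n_2},0,\ldots,0,1^{n_{\mu_1}})$ ($1^{r}$ denotes $r$ copies of $1$). Then $\mathrm{TI}(\mu)=(N-1-v_N,\,N-2-v_{N-1},\ldots,1-v_2,\,0-v_1)$; for $\mu$ empty, $N=1$ and $\mathrm{TI}(\mu)$ is the empty partition. It is known that $\nu^m(\mathrm{TI}(\mu))$ is defined for all $m\ge0$, that $\mathrm{defc}(\mathrm{TI}(\mu))=|\mu|$, $\min_\Delta(\mathrm{TI}(\mu))=\mu_1+\ell(\mu)+1$, and $\mathrm{dinv}(\mathrm{TI}(\mu))=\binom{\mu_1+\ell(\mu)+1}{2}-\ell(\mu)-|\mu|$. Set $\mathrm{tail}(\mu)=\{\nu^m(\mathrm{TI}(\mu)):m\ge0\}$. **Staircases.** The infinite $(a,m,h)$-staircase is the function $F:\mathbb{Z}_{\ge a}\to\mathbb{Z}$ whose values $F(a),F(a+1),\ldots$ are $m+1$ copies of $h$, then $h$ copies of $h+1$, then $h+1$ copies of $h+2$, then $h+2$ copies of $h+3$, and so on. A finite $(a,m,h)$-staircase is the restriction of $F$ to some $\{a,\ldots,b\}$. **Local chains of deficit $k$** are of the following kinds. *Ordinary:* a sequence $\mathcal{S}=(\gamma(i):a\le i\le a'+m')$ of partitions with $\mathrm{defc}(\gamma(i))=k$ and $\mathrm{dinv}(\gamma(i))=i$, for which there are nonnegative integers $a,a',m,m',h,h'$ with $a+m+1<a'$ such that $F(i)=\min_\Delta(\gamma(i))$ satisfies: $F(a'-1)>F(a')=\cdots=F(a'+m')=h'$,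 and $F$ restricted to $\{a,\ldots,a'-1\}$ is an $(a,m,h)$-staircase. These integers are uniquely determined, denoted $a_{\mathcal S},a'_{\mathcal S},m_{\mathcal S},m'_{\mathcal S},h_{\mathcal S},h'_{\mathcal S}$. Put $\mathrm{left}(\mathcal S)=\{\gamma(j):a\le j\le a+m\}$, $\mathrm{mid}(\mathcal S)=\{\gamma(j):a+m<j<a'\}$, $\mathrm{right}(\mathcal S)=\{\gamma(j):a'\le j\le a'+m'\}$. *Exceptional:* (1) a singleton $\{\gamma\}$ with $\mathrm{defc}(\gamma)=k$; its left and middle parts are empty and its right part is $\{\gamma\}$. (2) $\mathrm{tail}(\mu)$ with $\mu\in\mathrm{Par}(k)$; its left part is $\{\mathrm{TI}(\mu)\}$, its middle part is $\mathrm{tail}(\mu)\setminus\{\mathrm{TI}(\mu)\}$, its right part is empty. **Locally opposite.** Two ordinary local chains $\mathcal S,\mathcal T$ of deficit $k$ are locally opposite iff $m_{\mathcal T}=m'_{\mathcal S}$, $m'_{\mathcal T}=m_{\mathcal S}$, $h_{\mathcal T}=h'_{\mathcal S}$, $h'_{\mathcal T}=h_{\mathcal S}$, $a_{\mathcal S}+m_{\mathcal S}+k+a'_{\mathcal T}=\binom{h_{\mathcal S}}2$ and $a'_{\mathcal S}+m'_{\mathcal S}+k+a_{\mathcal T}=\binom{h'_{\mathcal S}}2$. Two exceptional local chains of deficit $k$ are locally opposite iff one is $\mathrm{tail}(\mu)$ and the other is $\{\gamma\}$ with $\mathrm{dinv}(\gamma)=\ell(\mu)$ and $\min_\Delta(\gamma)=\min_\Delta(\mathrm{TI}(\mu))$.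 An ordinary and an exceptional chain are never locally opposite. *)

theory Defs
  imports Complex_Main
begin

section \<open>Partitions and statistics\<close>

text \<open>A partition is the weakly decreasing list of its positive parts; trailing zero parts are
  removed, so that each partition has exactly one representation. Parts, rows and columns are
  numbered from 1.\<close>

type_synonym partition = "nat list"

definition is_partition :: "partition \<Rightarrow> bool" where
  "is_partition g \<longleftrightarrow> sorted_wrt (\<ge>) g \<and> (\<forall>x\<in>set g. 0 < x)"

definition part :: "partition \<Rightarrow> nat \<Rightarrow> nat" where
  "part g i = (if 1 \<le> i \<and> i \<le> length g then g ! (i - 1) else 0)"

definition conj_part :: "partition \<Rightarrow> nat \<Rightarrow> nat" where
  "conj_part g j = card {i \<in> {1..length g}. j \<le> part g i}"

definition diagram :: "partition \<Rightarrow> (nat \<times> nat) set" where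
  "diagram g = (SIGMA i:{1..length g}. {1..part g i})"

definition arm :: "partition \<Rightarrow> nat \<times> nat \<Rightarrow> int" where
  "arm g c = int (part g (fst c)) - int (snd c)"

definition leg :: "partition \<Rightarrow> nat \<times> nat \<Rightarrow> int" where
  "leg g c = int (conj_part g (snd c)) - int (fst c)"

definition dinv :: "partition \<Rightarrow> nat" where
  "dinv g = card {c \<in> diagram g. arm g c - leg g c \<in> {0, 1}}"

text \<open>No truncation occurs here, since \<open>dinv g\<close> counts some of the \<open>sum_list g\<close> cells.\<close>

definition defc :: "partition \<Rightarrow> nat" where
  "defc g = sum_list g - dinv g"

definition min_Delta :: "partition \<Rightarrow> nat" where
  "min_Delta g = (LEAST n. 0 < n \<and> (\<forall>i\<in>{1..length g}. int (part g i) \<le> int n - int i))"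

definition Par :: "nat \<Rightarrow> partition set" where
  "Par k = {g. is_partition g \<and> sum_list g = k}"

definition Def :: "nat \<Rightarrow> partition set" where
  "Def k = {g. is_partition g \<and> defc g = k}"


section \<open>The map nu, its segments, and tails\<close>

definition drop_zeros :: "nat list \<Rightarrow> partition" where
  "drop_zeros xs = filter (\<lambda>x. 0 < x) xs"

text \<open>\<open>nu\<close> is a partial map: its values are meaningful only on \<open>nu_dom\<close>.\<close>

definition nu_dom :: "partition set" where
  "nu_dom = {g. is_partition g \<and> part g 1 \<le> length g + 2}"

definition nu :: "partition \<Rightarrow> partition" where
  "nu g = drop_zeros ((length g + 1) # map (\<lambda>x. x - 1) g)"

definition nu_rel :: "(partition \<times> partition) set" where
  "nu_rel = {(g, nu g) |g. g \<in> nu_dom}"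

text \<open>The two disjuncts are the nonnegative and the nonpositive powers of \<open>nu\<close> that are
  defined at \<open>g\<close>.\<close>

definition nu_segment :: "partition \<Rightarrow> partition set" where
  "nu_segment g = {d. (g, d) \<in> nu_rel\<^sup>* \<or> (d, g) \<in> nu_rel\<^sup>*}"

text \<open>The word \<open>(0, 0, 1^{n_1}, 0, 1^{n_2}, \<dots>)\<close>; the empty partition gives the word \<open>(0)\<close>, so
  \<open>N = 1\<close> and \<open>TI [] = []\<close>.\<close>

definition TI_word :: "partition \<Rightarrow> nat list" where
  "TI_word mu = 0 # concat (map (\<lambda>i. 0 # replicate (count_list mu i) 1) [1..<part mu 1 + 1])"

text \<open>With \<open>i\<close> counted from 0, \<open>v ! i\<close> is the entry numbered \<open>i + 1\<close> in the usual notation. The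
  subtraction never truncates, because the first two entries of the word are 0.\<close>

definition TI :: "partition \<Rightarrow> partition" where
  "TI mu = (let v = TI_word mu in drop_zeros (rev (map (\<lambda>i. i - v ! i) [0..<length v])))"

definition tail :: "partition \<Rightarrow> partition set" where
  "tail mu = {(nu ^^ r) (TI mu) |r. True}"


section \<open>Local chains\<close>

text \<open>The value at \<open>i \<ge> a\<close> of the infinite \<open>(a, m, h)\<close>-staircase. The \<open>m + 1\<close> copies of \<open>h\<close> end
  at position \<open>a + m\<close>; for \<open>j \<ge> 1\<close> there are \<open>h + j - 1\<close> copies of \<open>h + j\<close>, which therefore end at
  position \<open>a + m + (\<Sum>t<j. h + t)\<close>.\<close>

definition staircase :: "nat \<Rightarrow> nat \<Rightarrow> nat \<Rightarrow> nat \<Rightarrow> nat" where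
  "staircase a m h i = h + (LEAST j. i \<le> a + m + (\<Sum>t<j. h + t))"

text \<open>Local chains are represented by their sets of partitions. For an ordinary chain the
  indexing is recovered from the set, since the partition with index \<open>i\<close> has \<open>dinv\<close> equal to \<open>i\<close>.
  An ordinary chain is finite with at least three elements, hence is never a singleton or a
  tail. The arguments after the set are \<open>a, a', m, m', h, h'\<close>.\<close>

definition ordinary_chain ::
  "nat \<Rightarrow> partition set \<Rightarrow> nat \<Rightarrow> nat \<Rightarrow> nat \<Rightarrow> nat \<Rightarrow> nat \<Rightarrow> nat \<Rightarrow> bool" where
  "ordinary_chain k S a a' m m' h h' \<longleftrightarrow>
     a + m + 1 < a' \<and>
     (\<exists>g. S = g ` {a..a' + m'} \<and>
       (\<forall>i\<in>{a..a' + m'}. is_partition (g i) \<and> defc (g i) = k \<and> dinv (g i) = i) \<and>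
       min_Delta (g (a' - 1)) > min_Delta (g a') \<and>
       (\<forall>i\<in>{a'..a' + m'}. min_Delta (g i) = h') \<and>
       (\<forall>i\<in>{a..a' - 1}. min_Delta (g i) = staircase a m h i))"

lemma staircase_eq: "staircase a m h i = h \<longleftrightarrow> i \<le> a + m"
proof -
  have "j \<le> (\<Sum>t<Suc j. h + t)" for j
    by (induction j) auto
  then have "i \<le> a + m + (\<Sum>t<Suc i. h + t)"
    by (meson le_trans le_add2)
  then have L: "i \<le> a + m + (\<Sum>t<(LEAST j. i \<le> a + m + (\<Sum>t<j. h + t)). h + t)"
    by (rule LeastI)
  show ?thesis
  proof
    assume "staircase a m h i = h"
    then have "(LEAST j. i \<le> a + m + (\<Sum>t<j. h + t)) = 0"
      unfolding staircase_def by simp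
    with L show "i \<le> a + m" by simp
  next
    assume "i \<le> a + m"
    then have "(LEAST j. i \<le> a + m + (\<Sum>t<j. h + t)) = 0"
      by (intro Least_equality) auto
    then show "staircase a m h i = h"
      unfolding staircase_def by simp
  qed
qed

text \<open>The six integers are determined by the chain, so quantifying over them existentially, as
  the definitions after this lemma do, is the same as naming them.\<close>

lemma ordinary_chain_unique:
  assumes "ordinary_chain k S a a' m m' h h'" and "ordinary_chain l S b b' n n' e e'"
  shows "a = b \<and> a' = b' \<and> m = n \<and> m' = n' \<and> h = e \<and> h' = e'"
proof -
  from assms(1) obtain g where am: "a + m + 1 < a'" and S: "S = g ` {a..a' + m'}"
    and d: "\<forall>i\<in>{a..a' + m'}. dinv (g i) = i"
    and desc: "min_Delta (g (a' - 1)) > min_Delta (g a')"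
    and hr: "\<forall>i\<in>{a'..a' + m'}. min_Delta (g i) = h'"
    and st: "\<forall>i\<in>{a..a' - 1}. min_Delta (g i) = staircase a m h i"
    unfolding ordinary_chain_def by blast
  from assms(2) obtain f where bn: "b + n + 1 < b'" and S': "S = f ` {b..b' + n'}"
    and d': "\<forall>i\<in>{b..b' + n'}. dinv (f i) = i"
    and desc': "min_Delta (f (b' - 1)) > min_Delta (f b')"
    and hr': "\<forall>i\<in>{b'..b' + n'}. min_Delta (f i) = e'"
    and st': "\<forall>i\<in>{b..b' - 1}. min_Delta (f i) = staircase b n e i"
    unfolding ordinary_chain_def by blast
  have "dinv ` S = {a..a' + m'}" using S d by (force simp: image_image)
  moreover have "dinv ` S = {b..b' + n'}" using S' d' by (force simp: image_image)
  ultimately have "{a..a' + m'} = {b..b' + n'}" by (rule subst)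
  moreover have "a \<le> a' + m'" using am by simp
  ultimately have ab: "a = b" and e: "a' + m' = b' + n'"
    by (metis Icc_eq_Icc)+
  have fg: "f i = g i" if i: "i \<in> {a..a' + m'}" for i
  proof -
    have ib: "i \<in> {b..b' + n'}" using i ab e by simp
    then have "f i \<in> g ` {a..a' + m'}" using S S' by blast
    then obtain j where "j \<in> {a..a' + m'}" "f i = g j" by blast
    then show ?thesis using d d' ib by metis
  qed
  have ab': "a' = b'"
  proof (rule ccontr)
    assume "a' \<noteq> b'"
    then consider "a' < b'" | "b' < a'" by linarith
    then show False
    proof cases
      case 1
      then have "b' - 1 \<in> {a'..a' + m'}" "b' \<in> {a'..a' + m'}" using e by auto
      then show False using hr desc' fg am by force
    next
      case 2
      then have "a' - 1 \<in> {b'..b' + n'}" "a' \<in> {b'..b' + n'}" using e by auto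
      moreover have "a' - 1 \<in> {a..a' + m'}" "a' \<in> {a..a' + m'}" using am by auto
      ultimately show False using hr' desc fg by (metis less_irrefl)
    qed
  qed
  have mm: "m' = n'" using e ab' by simp
  have F: "staircase a m h i = staircase a n e i" if "i \<in> {a..a' - 1}" for i
  proof -
    have "i \<in> {a..a' + m'}" using that by auto
    then show ?thesis using st st' fg that ab ab' by metis
  qed
  have he: "h = e"
    using F[of a] staircase_eq[of a m h a] staircase_eq[of a n e a] am by auto
  have "i \<le> a + m \<longleftrightarrow> i \<le> a + n" if "i \<in> {a..a' - 1}" for i
    using F[OF that] staircase_eq[of a m h i] staircase_eq[of a n e i] he by auto
  from this[of "a + m + 1"] this[of "a + n + 1"] have "m = n"
    using am bn ab ab' by simp linarith
  moreover have "h' = e'" using hr hr' fg[of a'] ab' am by force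
  ultimately show ?thesis using ab ab' mm he by simp
qed

definition is_ordinary :: "nat \<Rightarrow> partition set \<Rightarrow> bool" where
  "is_ordinary k S \<longleftrightarrow> (\<exists>a a' m m' h h'. ordinary_chain k S a a' m m' h h')"

definition is_exceptional :: "nat \<Rightarrow> partition set \<Rightarrow> bool" where
  "is_exceptional k S \<longleftrightarrow> (\<exists>g\<in>Def k. S = {g}) \<or> (\<exists>mu\<in>Par k. S = tail mu)"

definition local_chain :: "nat \<Rightarrow> partition set \<Rightarrow> bool" where
  "local_chain k S \<longleftrightarrow> is_ordinary k S \<or> is_exceptional k S"

definition left_part :: "nat \<Rightarrow> partition set \<Rightarrow> partition set" where
  "left_part k S = {g \<in> S.
     (\<exists>a a' m m' h h'. ordinary_chain k S a a' m m' h h' \<and> a \<le> dinv g \<and> dinv g \<le> a + m) \<or>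
     (\<exists>mu\<in>Par k. S = tail mu \<and> g = TI mu)}"

definition mid_part :: "nat \<Rightarrow> partition set \<Rightarrow> partition set" where
  "mid_part k S = {g \<in> S.
     (\<exists>a a' m m' h h'. ordinary_chain k S a a' m m' h h' \<and> a + m < dinv g \<and> dinv g < a') \<or>
     (\<exists>mu\<in>Par k. S = tail mu \<and> g \<noteq> TI mu)}"

definition right_part :: "nat \<Rightarrow> partition set \<Rightarrow> partition set" where
  "right_part k S = {g \<in> S.
     (\<exists>a a' m m' h h'. ordinary_chain k S a a' m m' h h' \<and> a' \<le> dinv g \<and> dinv g \<le> a' + m') \<or>
     (g \<in> Def k \<and> S = {g})}"


section \<open>Locally opposite chains\<close>

definition opposite_ordinary :: "nat \<Rightarrow> partition set \<Rightarrow> partition set \<Rightarrow> bool" where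
  "opposite_ordinary k S T \<longleftrightarrow>
     (\<exists>aS aS' mS mS' hS hS' aT aT' mT mT' hT hT'.
        ordinary_chain k S aS aS' mS mS' hS hS' \<and>
        ordinary_chain k T aT aT' mT mT' hT hT' \<and>
        mT = mS' \<and> mT' = mS \<and> hT = hS' \<and> hT' = hS \<and>
        aS + mS + k + aT' = hS choose 2 \<and>
        aS' + mS' + k + aT = hS' choose 2)"

definition opposite_tail_singleton :: "nat \<Rightarrow> partition set \<Rightarrow> partition set \<Rightarrow> bool" where
  "opposite_tail_singleton k S T \<longleftrightarrow>
     (\<exists>mu\<in>Par k. \<exists>g\<in>Def k. S = tail mu \<and> T = {g} \<and>
        dinv g = length mu \<and> min_Delta g = min_Delta (TI mu))"

definition locally_opposite :: "nat \<Rightarrow> partition set \<Rightarrow> partition set \<Rightarrow> bool" where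
  "locally_opposite k S T \<longleftrightarrow>
     opposite_ordinary k S T \<or> opposite_tail_singleton k S T \<or> opposite_tail_singleton k T S"

end

theory Submission
  imports Defs "HOL-Library.List_Lexorder"
begin

text \<open>The map \<open>nu\<close> raises \<open>dinv\<close> by one and preserves \<open>defc\<close> (\<open>dinv_nu\<close>, \<open>defc_nu\<close>), so \<open>Def k\<close> is the
  disjoint union of \<open>nu\<close>-segments, each generated by its only member outside the image of \<open>nu\<close>.
  These \<open>nu\<close>-initial partitions are the empty one and those whose first part is smaller than
  their length. Only finitely many of them have deficit \<open>k\<close>: putting longer rows on top of a
  partition never lowers the deficit, and a row that is not longer than the number of rows below
  it costs at least the number of rows below it that are long in this sense
  (\<open>defc_short_row\<close>). The top row of an initial partition is of this kind, and so the search
  \<open>initials\<close> stops and finds all of them (\<open>initials_complete\<close>). The segments of the partitions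
  \<open>TI mu\<close> are infinite, because \<open>nu\<close> preserves a class of partitions close to a staircase
  (\<open>unbounded_step\<close>); for small \<open>k\<close> all the others turn out to be finite.

  For each \<open>k \<le> 11\<close> a table arranges the segments in sequences of runs \<open>R\<^sub>0, \<dots>, R\<^sub>s\<close>, one
  sequence for each \<open>mu \<in> Par k\<close>. A run is a union of segments along which \<open>dinv\<close> is consecutive
  and \<open>min_Delta\<close> climbs a staircase; from one run to the next \<open>dinv\<close> continues and \<open>min_Delta\<close>
  drops; the last run is the tail of \<open>mu\<close>. With \<open>B\<^sub>i\<close> for the partitions on the lowest level
  of \<open>R\<^sub>i\<close>, and \<open>B\<^sub>0\<close> being a singleton, the local chains are
  \<open>B\<^sub>0, R\<^sub>0 \<union> B\<^sub>1, \<dots>, R\<^sub>s\<^sub>-\<^sub>1 \<union> B\<^sub>s, R\<^sub>s\<close>. They overlap exactly in the blocks, which gives the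
  statements on intersections and multiplicities. The table also names a partition opposite to
  \<open>mu\<close> such that the data of its blocks, read backwards, are opposite to those of \<open>mu\<close>; the
  involution reverses the two sequences of chains onto each other. The locale \<open>chain_system\<close>
  contains this argument. Its assumptions follow from finitely many checks on the table,
  \<open>certificate\<close> and \<open>complete\<close>, which are carried out by rewriting with the defining
  equations.\<close>


section \<open>Counting dinv row by row\<close>

text \<open>The contribution to \<open>dinv\<close> of a row of length \<open>E\<close> placed
  on top of \<open>g\<close>. With \<open>i\<close> counted from 1 and empty rows included, it
  is the number of rows \<open>i\<close> with \<open>i + part g i \<in> {E - 1, E}\<close>;
  stepping past a row shifts the level \<open>E\<close> by one, and the two levels still to be
  met below the last row give \<open>min E 2\<close>. Truncated subtraction is harmless because
  parts are positive.\<close>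

fun row_dinv :: "nat \<Rightarrow> nat list \<Rightarrow> nat" where
  "row_dinv E [] = min E 2"
| "row_dinv E (r # rs) = of_bool (E - r \<in> {1, 2}) + row_dinv (E - 1) rs"

lemma row_dinv_Cons:
  "row_dinv E (r # g) = (if Suc r = E \<or> Suc (Suc r) = E then 1 else 0) + row_dinv (E - 1) g"
  by auto

declare row_dinv.simps(2) [simp del] row_dinv_Cons [simp]

lemma is_partition_Nil [simp]: "is_partition []"
  by (simp add: is_partition_def)

lemma is_partition_Cons:
  "is_partition (r # g) \<longleftrightarrow> 0 < r \<and> is_partition g \<and> (\<forall>x\<in>set g. x \<le> r)"
  by (auto simp: is_partition_def)

lemma is_partition_Cons_hd:
  "is_partition (r # g) \<longleftrightarrow> 0 < r \<and> is_partition g \<and> (g \<noteq> [] \<longrightarrow> hd g \<le> r)"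
  by (cases g) (auto simp: is_partition_Cons)

lemma part_Cons_Suc: "1 \<le> i \<Longrightarrow> part (r # g) (Suc i) = part g i"
  by (auto simp: part_def nth_Cons')

lemma part_Cons_1: "part (r # g) (Suc 0) = r"
  by (auto simp: part_def)

lemma conj_part_filter: "conj_part g j = length (filter ((\<le>) j) g)"
proof -
  have "{i \<in> {1..length g}. j \<le> part g i} = Suc ` {i. i < length g \<and> j \<le> g ! i}" (is "?A = ?B")
  proof
    show "?A \<subseteq> ?B"
    proof
      fix i assume "i \<in> ?A"
      then have "i = Suc (i - 1)" "i - 1 < length g" "j \<le> g ! (i - 1)"
        by (auto simp: part_def)
      then show "i \<in> ?B" by blast
    qed
  qed (auto simp: part_def)
  then show ?thesis
    by (simp add: conj_part_def length_filter_conv_card card_image)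
qed

lemma conj_part_Cons: "conj_part (r # g) j = (if j \<le> r then 1 else 0) + conj_part g j"
  by (simp add: conj_part_filter)

lemma conj_part_eq_0: "\<forall>x\<in>set g. x \<le> r \<Longrightarrow> r < j \<Longrightarrow> conj_part g j = 0"
  by (auto simp: conj_part_filter filter_empty_conv)

lemma row_dinv_0 [simp]: "row_dinv 0 g = 0"
  by (induction g) auto

lemma card_two_levels: "card {j::nat. 1 \<le> j \<and> (j = E \<or> Suc j = E)} = min E 2"
proof -
  have "{j::nat. 1 \<le> j \<and> (j = E \<or> Suc j = E)} = (if E = 0 then {} else if E = 1 then {1} else {E, E - 1})"
    by auto
  then show ?thesis by (auto simp: card_insert_if min_def)
qed

text \<open>The definition of \<open>dinv\<close> counts columns at two given values of \<open>j
  + conj_part g j\<close>, whereas \<open>row_dinv\<close> counts rows at the same values of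
  \<open>i + part g i\<close>. Both counts agree: the boundary path of the diagram comes from
  infinity and goes to infinity along the axes, so it crosses each antidiagonal equally often in
  either direction, once per row one way and once per column the other way.\<close>

lemma row_dinv_eq_card:
  assumes "is_partition g"
  shows "row_dinv E g = card {j. 1 \<le> j \<and> (j + conj_part g j = E \<or> Suc (j + conj_part g j) = E)}"
  using assms
proof (induction g arbitrary: E)
  case Nil
  then show ?case by (simp add: conj_part_filter card_two_levels[simplified])
next
  case (Cons r g)
  then have r: "0 < r" and g: "is_partition g" and le: "\<forall>x\<in>set g. x \<le> r"
    by (auto simp: is_partition_Cons)
  show ?case
  proof (cases E)
    case 0
    then show ?thesis by simp
  next
    case (Suc F)
    \<comment> \<open>Columns within the first row move by one level, those beyond it are empty.\<close>
    define L where "L = {j. 1 \<le> j \<and> j \<le> r \<and> (j + conj_part g j = F \<or> Suc (j + conj_part g j) = F)}"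
    have fin: "finite L" by (rule finite_subset[of _ "{1..r}"]) (auto simp: L_def)
    have c: "conj_part g j = 0" if "r < j" for j
      using conj_part_eq_0[OF le that] .
    have 1: "{j. 1 \<le> j \<and> (j + conj_part (r # g) j = E \<or> Suc (j + conj_part (r # g) j) = E)}
        = L \<union> {j. r < j \<and> (j = F \<or> j = Suc F)}" (is "?P = ?Q")
    proof (intro set_eqI)
      fix j show "j \<in> ?P \<longleftrightarrow> j \<in> ?Q"
        using r c[of j] by (cases "j \<le> r") (auto simp: L_def conj_part_Cons Suc)
    qed
    have 2: "{j. 1 \<le> j \<and> (j + conj_part g j = F \<or> Suc (j + conj_part g j) = F)}
        = L \<union> {j. r < j \<and> (j = F \<or> Suc j = F)}" (is "?P = ?Q")
    proof (intro set_eqI)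
      fix j show "j \<in> ?P \<longleftrightarrow> j \<in> ?Q"
        using r c[of j] by (cases "j \<le> r") (auto simp: L_def)
    qed
    have 3: "card {j. r < j \<and> (j = F \<or> j = Suc F)}
        = card {j. r < j \<and> (j = F \<or> Suc j = F)} + (if r = F \<or> Suc r = F then 1 else 0)"
    proof -
      have a: "{j. r < j \<and> (j = F \<or> j = Suc F)} = (if r < F then {F, Suc F} else if r = F then {Suc F} else {})"
        by auto
      have b: "{j. r < j \<and> (j = F \<or> Suc j = F)} = (if Suc r < F then {F, F - 1} else if Suc r = F then {F} else {})"
        by auto
      show ?thesis unfolding a b by auto
    qed
    have f: "finite {j. r < j \<and> (j = F \<or> j = Suc F)}" "finite {j. r < j \<and> (j = F \<or> Suc j = F)}"
      by (rule finite_subset[of _ "{..Suc F}"]; auto)+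
    have d: "L \<inter> {j. r < j \<and> (j = F \<or> j = Suc F)} = {}" "L \<inter> {j. r < j \<and> (j = F \<or> Suc j = F)} = {}"
      by (auto simp: L_def)
    show ?thesis
      unfolding 1 using Cons.IH[OF g, of F] unfolding 2
      by (simp add: card_Un_disjoint fin f d 3 Suc)
  qed
qed

lemma row_dinv_le: "is_partition g \<Longrightarrow> row_dinv E g \<le> E"
proof -
  assume "is_partition g"
  then have "row_dinv E g = card {j. 1 \<le> j \<and> (j + conj_part g j = E \<or> Suc (j + conj_part g j) = E)}"
    by (rule row_dinv_eq_card)
  also have "\<dots> \<le> card {1..E}" by (rule card_mono) auto
  finally show ?thesis by simp
qed

lemma diagram_Cons:
  "diagram (r # g) = Pair 1 ` {1..r} \<union> (\<lambda>(i, j). (Suc i, j)) ` diagram g" (is "?A = ?B")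
proof
  show "?A \<subseteq> ?B"
  proof
    fix c assume "c \<in> ?A"
    then obtain i j where c: "c = (i, j)" "1 \<le> i" "i \<le> Suc (length g)" "1 \<le> j" "j \<le> part (r # g) i"
      by (auto simp: diagram_def)
    show "c \<in> ?B"
    proof (cases "i = 1")
      case True
      then show ?thesis using c by (auto simp: part_Cons_1)
    next
      case False
      then obtain i' where i: "i = Suc i'" "1 \<le> i'" using c by (cases i) auto
      then have "(i', j) \<in> diagram g" using c by (auto simp: diagram_def part_Cons_Suc)
      then show ?thesis using c i by force
    qed
  qed
  show "?B \<subseteq> ?A"
    by (auto simp: diagram_def part_Cons_Suc part_Cons_1)
qed

lemma finite_diagram [simp]: "finite (diagram g)"
  by (simp add: diagram_def)

lemma dinv_Nil [simp]: "dinv [] = 0"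
  by (simp add: dinv_def diagram_def)

text \<open>Arms and legs of the other cells do not see a new first row, so only its own cells
  count.\<close>

lemma dinv_Cons:
  assumes "is_partition (r # g)"
  shows "dinv (r # g) = dinv g + row_dinv r g"
proof -
  have g: "is_partition g" and le: "\<forall>x\<in>set g. x \<le> r"
    using assms by (auto simp: is_partition_Cons)
  let ?T = "{c \<in> diagram g. arm g c - leg g c \<in> {0, 1}}"
  let ?R = "{j. 1 \<le> j \<and> (j + conj_part g j = r \<or> Suc (j + conj_part g j) = r)}"
  let ?s = "\<lambda>(i::nat, j::nat). (Suc i, j)"
  have first: "arm (r # g) (1, j) - leg (r # g) (1, j) \<in> {0, 1}
      \<longleftrightarrow> j + conj_part g j = r \<or> Suc (j + conj_part g j) = r" if "j \<in> {1..r}" for j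
    using that by (auto simp: arm_def leg_def part_Cons_1 conj_part_Cons)
  have other: "arm (r # g) (?s c) - leg (r # g) (?s c) = arm g c - leg g c" if c: "c \<in> diagram g" for c
  proof -
    obtain i j where ij: "c = (i, j)" "1 \<le> i" "i \<le> length g" "j \<le> part g i"
      using c by (auto simp: diagram_def)
    have "part g i \<in> set g" using ij by (auto simp: part_def)
    then have "j \<le> r" using le ij by fastforce
    then show ?thesis using ij by (simp add: arm_def leg_def part_Cons_Suc conj_part_Cons)
  qed
  have "{c \<in> diagram (r # g). arm (r # g) c - leg (r # g) c \<in> {0, 1}} = Pair 1 ` ?R \<union> ?s ` ?T" (is "?A = ?B")
  proof
    show "?A \<subseteq> ?B"
    proof
      fix c assume c: "c \<in> ?A"
      then consider j where "c = (1, j)" "j \<in> {1..r}" | d where "c = ?s d" "d \<in> diagram g"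
        by (auto simp: diagram_Cons)
      then show "c \<in> ?B"
      proof cases
        case 1 then show ?thesis using c first[of j] by auto
      next
        case 2 then have "d \<in> ?T" using c other[of d] by auto
        then show ?thesis using 2 by blast
      qed
    qed
    show "?B \<subseteq> ?A"
    proof
      fix c assume "c \<in> ?B"
      then consider j where "c = (1, j)" "j \<in> ?R" | d where "c = ?s d" "d \<in> ?T"
        by blast
      then show "c \<in> ?A"
      proof cases
        case 1
        then have "j \<in> {1..r}" by auto
        then show ?thesis using 1 first[of j] by (auto simp: diagram_Cons)
      next
        case 2 then show ?thesis using other[of d] by (auto simp: diagram_Cons)
      qed
    qed
  qed
  moreover have "card (Pair (1::nat) ` ?R \<union> ?s ` ?T) = card ?R + card ?T"
  proof (subst card_Un_disjoint)
    show "finite (Pair (1::nat) ` ?R)"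
      by (rule finite_imageI, rule finite_subset[of _ "{1..r}"]) auto
    show "Pair (1::nat) ` ?R \<inter> ?s ` ?T = {}"
      by (auto simp: diagram_def)
    show "card (Pair (1::nat) ` ?R) + card (?s ` ?T) = card ?R + card ?T"
      by (subst (1 2) card_image) (auto simp: inj_on_def)
  qed simp
  ultimately show ?thesis
    using row_dinv_eq_card[OF g, of r] by (simp add: dinv_def)
qed

lemma dinv_le_size: "is_partition g \<Longrightarrow> dinv g \<le> sum_list g"
proof (induction g)
  case (Cons r g)
  then have g: "is_partition g" by (simp add: is_partition_Cons)
  show ?case using Cons.IH[OF g] row_dinv_le[OF g, of r] dinv_Cons[OF Cons.prems] by simp
qed simp

lemma size_eq: "is_partition g \<Longrightarrow> sum_list g = dinv g + defc g"
  using dinv_le_size by (simp add: defc_def)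

lemma defc_Nil [simp]: "defc [] = 0"
  by (simp add: defc_def)

lemma defc_Cons:
  assumes "is_partition (r # g)"
  shows "defc (r # g) = defc g + (r - row_dinv r g)"
proof -
  have g: "is_partition g" using assms by (simp add: is_partition_Cons)
  show ?thesis using dinv_Cons[OF assms] row_dinv_le[OF g, of r] dinv_le_size[OF g]
    by (simp add: defc_def)
qed

section \<open>The map nu raises dinv by one\<close>

lemma row_dinv_zeros: "\<forall>x\<in>set xs. x = 0 \<Longrightarrow> row_dinv E xs = min E 2"
  by (induction xs arbitrary: E) auto

lemma drop_zeros_simps [simp]:
  "drop_zeros [] = []" "drop_zeros (x # xs) = (if 0 < x then x # drop_zeros xs else drop_zeros xs)"
  by (auto simp: drop_zeros_def)

lemma row_dinv_drop_zeros:
  "sorted_wrt (\<ge>) xs \<Longrightarrow> row_dinv E (drop_zeros xs) = row_dinv E xs"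
proof (induction xs arbitrary: E)
  case (Cons x xs)
  show ?case
  proof (cases "0 < x")
    case True
    then show ?thesis using Cons by simp
  next
    case False
    then have z: "\<forall>y\<in>set (x # xs). y = 0" using Cons.prems by auto
    then have "drop_zeros (x # xs) = []" by (auto simp: drop_zeros_def filter_empty_conv)
    then show ?thesis using row_dinv_zeros[OF z] by simp
  qed
qed simp

abbreviation pred_all :: "nat list \<Rightarrow> nat list" where
  "pred_all g \<equiv> map (\<lambda>x. x - 1) g"

lemma sorted_pred_all: "sorted_wrt (\<ge>) g \<Longrightarrow> sorted_wrt (\<ge>) (pred_all g)"
  by (induction g) (auto intro: diff_le_mono)

lemma is_partition_pred: "is_partition g \<Longrightarrow> is_partition (drop_zeros (pred_all g))"
  using sorted_pred_all[of g]
  by (auto simp: is_partition_def drop_zeros_def intro: sorted_wrt_filter)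

text \<open>Removing the first column lowers every nonempty row by one, but none of the empty
  ones.\<close>

lemma row_dinv_pred:
  "\<forall>x\<in>set g. 0 < x \<Longrightarrow> row_dinv (Suc E) g =
    row_dinv E (pred_all g) + (if E = length g \<or> E = Suc (length g) then 1 else 0)"
proof (induction g arbitrary: E)
  case Nil
  then show ?case by auto
next
  case (Cons r g)
  then show ?case by (cases E) auto
qed

text \<open>The removed first column is accounted for by the rows at the levels of \<open>length
  g + 1\<close> and \<open>length g + 2\<close>. The added 2 counts the first two empty rows,
  which lie at these levels.\<close>

lemma dinv_remove_column:
  assumes "is_partition g"
  shows "dinv g + 2 = dinv (drop_zeros (pred_all g)) + row_dinv (length g + 2) g"
  using assms
proof (induction g)
  case (Cons r g)
  then have r: "0 < r" and g: "is_partition g" and le: "\<forall>x\<in>set g. x \<le> r"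
    by (auto simp: is_partition_Cons)
  have pos: "\<forall>x\<in>set g. 0 < x" and sorted: "sorted_wrt (\<ge>) g"
    using g by (auto simp: is_partition_def)
  have "dinv (drop_zeros (pred_all (r # g))) = dinv (drop_zeros (pred_all g)) + row_dinv (r - 1) (pred_all g)"
  proof (cases "r = 1")
    case False
    have "is_partition (drop_zeros (pred_all (r # g)))"
      using Cons.prems by (rule is_partition_pred)
    then have "is_partition ((r - 1) # drop_zeros (pred_all g))" using False r by simp
    from dinv_Cons[OF this] show ?thesis
      using False r row_dinv_drop_zeros[OF sorted_pred_all[OF sorted]] by simp
  qed simp
  moreover have "row_dinv r g = row_dinv (r - 1) (pred_all g) +
      (if r = Suc (length g) \<or> r = Suc (Suc (length g)) then 1 else 0)"
    using row_dinv_pred[OF pos, of "r - 1"] r by (auto split: if_splits)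
  ultimately show ?case
    using Cons.IH[OF g] dinv_Cons[OF Cons.prems] by auto
qed simp

lemma nu_eq: "nu g = Suc (length g) # drop_zeros (pred_all g)"
  by (simp add: nu_def)

lemma hd_bound: "is_partition g \<Longrightarrow> x \<in> set g \<Longrightarrow> x \<le> part g 1"
  by (cases g) (auto simp: is_partition_Cons part_def)

lemma is_partition_nu: "g \<in> nu_dom \<Longrightarrow> is_partition (nu g)"
proof -
  assume "g \<in> nu_dom"
  then have g: "is_partition g" and "part g 1 \<le> length g + 2" by (auto simp: nu_dom_def)
  then have "\<forall>x\<in>set (pred_all g). x \<le> Suc (length g)"
    using hd_bound[OF g] by fastforce
  then show ?thesis
    using is_partition_pred[OF g] by (auto simp: nu_eq is_partition_Cons drop_zeros_def)
qed

text \<open>\<open>nu\<close> removes the first column and puts a row of length \<open>length g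
  + 1\<close> on top. This row contributes what the column did, and one more cell for the first
  empty row.\<close>

lemma dinv_nu:
  assumes "g \<in> nu_dom"
  shows "dinv (nu g) = Suc (dinv g)"
proof -
  have g: "is_partition g" using assms by (auto simp: nu_dom_def)
  then have pos: "\<forall>x\<in>set g. 0 < x" and sorted: "sorted_wrt (\<ge>) g"
    by (auto simp: is_partition_def)
  have "is_partition (Suc (length g) # drop_zeros (pred_all g))"
    using is_partition_nu[OF assms] by (simp add: nu_eq)
  from dinv_Cons[OF this] show ?thesis
    using row_dinv_drop_zeros[OF sorted_pred_all[OF sorted]] row_dinv_pred[OF pos, of "Suc (length g)"]
      dinv_remove_column[OF g] by (simp add: nu_eq)
qed

lemma sum_list_pred_all:
  "\<forall>x\<in>set g. 0 < x \<Longrightarrow> sum_list (drop_zeros (pred_all g)) + length g = sum_list g"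
  by (induction g) auto

lemma sum_list_nu: "is_partition g \<Longrightarrow> sum_list (nu g) = Suc (sum_list g)"
  using sum_list_pred_all[of g] by (simp add: nu_eq is_partition_def)

lemma defc_nu: "g \<in> nu_dom \<Longrightarrow> defc (nu g) = defc g"
  using dinv_nu[of g] sum_list_nu[of g] by (auto simp: defc_def nu_dom_def)

text \<open>This makes \<open>nu\<close> injective, since the first part of \<open>nu g\<close>
  shows the length of \<open>g\<close>.\<close>

lemma map_Suc_drop_zeros:
  "is_partition g \<Longrightarrow> g = map Suc (drop_zeros (pred_all g)) @ replicate (length g - length (drop_zeros (pred_all g))) 1"
proof (induction g)
  case (Cons r g)
  show ?case
  proof (cases "r = 1")
    case True
    then have "\<forall>x\<in>set (r # g). x = 1" using Cons.prems by (force simp: is_partition_Cons is_partition_def)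
    then have "drop_zeros (pred_all (r # g)) = []" "r # g = replicate (length (r # g)) 1"
      by (auto simp: drop_zeros_def filter_empty_conv intro!: replicate_eqI)
    then show ?thesis by simp
  next
    case False
    then show ?thesis using Cons by (auto simp: is_partition_Cons)
  qed
qed simp

lemma nu_inj:
  assumes "g \<in> nu_dom" "d \<in> nu_dom" "nu g = nu d"
  shows "g = d"
  using assms map_Suc_drop_zeros[of g] map_Suc_drop_zeros[of d]
  by (auto simp: nu_dom_def nu_eq)

text \<open>The partitions outside the image of \<open>nu\<close>.\<close>

definition nu_initial :: "partition \<Rightarrow> bool" where
  "nu_initial g \<longleftrightarrow> g = [] \<or> hd g < length g"

lemma drop_zeros_pos: "\<forall>x\<in>set xs. 0 < x \<Longrightarrow> drop_zeros xs = xs"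
  by (auto simp: drop_zeros_def)

lemma nu_preimage:
  assumes "is_partition g" "\<not> nu_initial g"
  obtains d where "d \<in> nu_dom" "nu d = g"
proof -
  obtain r h where g: "g = r # h" and r: "length h < r"
    using assms(2) by (cases g) (auto simp: nu_initial_def)
  define d where "d = map Suc h @ replicate (r - 1 - length h) 1"
  have h: "is_partition h" "\<forall>x\<in>set h. x \<le> r" using assms(1) g by (auto simp: is_partition_Cons)
  have l: "length d = r - 1" using r by (simp add: d_def)
  have "sorted_wrt (\<ge>) (replicate n (1::nat))" for n
    by (induction n) auto
  then have "is_partition d"
    using h by (auto simp: is_partition_def d_def sorted_wrt_append sorted_wrt_map)
  moreover have "part d 1 \<le> length d + 2"
    using h r l by (cases h) (auto simp: part_def d_def nth_append)
  moreover have "drop_zeros (pred_all d) = h"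
    using h drop_zeros_pos[of h] by (auto simp: d_def drop_zeros_def is_partition_def comp_def)
  ultimately show ?thesis using that[of d] l r g by (auto simp: nu_dom_def nu_eq)
qed

lemma nu_not_initial:
  assumes "d \<in> nu_dom" shows "\<not> nu_initial (nu d)"
  using assms by (auto simp: nu_initial_def nu_eq drop_zeros_def not_less le_SucI intro: le_trans[OF length_filter_le])


section \<open>Initial partitions of a given deficit\<close>

text \<open>All \<open>nu\<close>-initial partitions that arise from \<open>g\<close> by adding
  rows on top and whose deficit exceeds that of \<open>g\<close> by \<open>c\<close>, where
  \<open>z\<close> is the number of long rows of \<open>g\<close> in the sense of
  \<open>long_rows\<close> below. A short row costs at least \<open>z\<close>, and so does the
  short row on top of everything that has to follow a long one. The guards express this; they
  exclude nothing and make \<open>c + (c - z)\<close> decrease.\<close>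

function initials :: "nat \<Rightarrow> nat \<Rightarrow> nat list \<Rightarrow> nat list list" where
  "initials c z g = (if c = 0 then (if nu_initial g then [g] else []) else
     concat (map (\<lambda>G. let d = G - row_dinv G g in
        if d \<le> c then
           if G \<le> length g then (if z \<le> d \<and> 0 < d then initials (c - d) z (G # g) else [])
           else (if Suc z \<le> c - d then initials (c - d) (Suc z) (G # g) else [])
         else []) [(if g = [] then 1 else hd g)..<length g + (c - z) + 2]))"
  by pat_completeness auto
termination
  by (relation "measure (\<lambda>(c,z,g). c + (c - z))") auto

declare initials.simps [simp del]

text \<open>A row is long if it exceeds the number of rows below it; the bottom row is long, and
  the top row of an initial partition is not.\<close>

fun long_rows :: "nat list \<Rightarrow> nat" where
  "long_rows [] = 0"
| "long_rows (r # g) = (if length g < r then 1 else 0) + long_rows g"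

lemma part_1_le: "is_partition (r # g) \<Longrightarrow> part g 1 \<le> r"
  by (cases g) (auto simp: is_partition_Cons part_def)

text \<open>Give each row the value \<open>t - r\<close>, where \<open>t\<close> counts the rows
  from it downwards and \<open>r\<close> is its length, so that the long rows are those of value
  at most 0. From a row to the next higher one the value rises by at most one, hence every
  positive value up to that of the top row occurs. Now \<open>row_dinv\<close> counts rows of
  the two values \<open>b\<close> and \<open>b + 1\<close> for \<open>b = length g + 1 -
  E\<close>. Neither the long rows nor the rows of the values \<open>1, \<dots>, b - 1\<close>
  are among them, which leaves at most \<open>E\<close> if all these values occur; the other
  bound covers a top row of lower value.\<close>

lemma row_dinv_long_rows:
  "is_partition g \<Longrightarrow> E \<le> length g \<Longrightarrow> row_dinv E g + long_rows g \<le> max E (min (part g 1) (length g))"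
proof (induction g arbitrary: E)
  case (Cons r g)
  then have r: "0 < r" and g: "is_partition g" and le: "part g 1 \<le> r"
    using part_1_le by (auto simp: is_partition_Cons)
  have E: "E - 1 \<le> length g" using Cons.prems by simp
  show ?case
    using Cons.IH[OF g E] r le Cons.prems(2) by (auto simp: part_Cons_1)
qed simp

lemma row_dinv_le_length: "row_dinv E g \<le> length g + 2"
proof (induction g arbitrary: E)
  case (Cons r g)
  then show ?case using Cons.IH[of "E - 1"] by (auto intro: le_SucI)
qed simp

lemma long_rows_pos: "is_partition g \<Longrightarrow> g \<noteq> [] \<Longrightarrow> 0 < long_rows g"
proof (induction g)
  case (Cons r g)
  then show ?case by (cases g) (auto simp: is_partition_Cons)
qed simp

text \<open>A short row costs at least the number of long rows below it. As the top row of an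
  initial partition is short, the long rows are bounded by the deficit, and so are the short
  ones, each of which costs at least one.\<close>

lemma defc_short_row:
  assumes "is_partition (r # g)" "r \<le> length g"
  shows "defc g + long_rows g \<le> defc (r # g)" "0 < long_rows g"
proof -
  have r: "0 < r" and g: "is_partition g" and le: "part g 1 \<le> r"
    using assms part_1_le by (auto simp: is_partition_Cons)
  show "defc g + long_rows g \<le> defc (r # g)"
    using row_dinv_long_rows[OF g assms(2)] le assms(2) defc_Cons[OF assms(1)] by simp
  show "0 < long_rows g" using long_rows_pos[OF g] assms(2) r by force
qed

lemma is_partition_append: "is_partition (xs @ g) \<Longrightarrow> is_partition g"
  by (induction xs) (auto simp: is_partition_Cons)

lemma defc_append: "is_partition (xs @ g) \<Longrightarrow> defc g \<le> defc (xs @ g)"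
proof (induction xs)
  case (Cons x xs)
  then have "is_partition (xs @ g)" by (simp add: is_partition_Cons)
  then show ?case using Cons defc_Cons[of x "xs @ g"] by simp
qed simp

lemma long_rows_append: "long_rows g \<le> long_rows (xs @ g)"
  by (induction xs) auto

lemma initials_complete_aux:
  assumes "is_partition (xs @ g)" "nu_initial (xs @ g)" "defc (xs @ g) = defc g + c"
  shows "xs @ g \<in> set (initials c (long_rows g) g)"
  using assms
proof (induction xs arbitrary: g c rule: rev_induct)
  case Nil
  then show ?case by (simp add: initials.simps)
next
  case (snoc G xs)
  let ?p = "xs @ G # g"
  have p: "is_partition ?p" and init: "nu_initial ?p" and def: "defc ?p = defc g + c"
    using snoc.prems by simp_all
  have Gg: "is_partition (G # g)" using is_partition_append[OF p] .
  \<comment> \<open>The top row is short; its cost pays for all long rows, including \<open>G\<close> if that is long.\<close>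
  obtain r t where rt: "?p = r # t" by (cases ?p) auto
  have r: "r \<le> length t" using init rt by (auto simp: nu_initial_def)
  define d where "d = G - row_dinv G g"
  have dG: "defc (G # g) = defc g + d" using defc_Cons[OF Gg] by (simp add: d_def)
  have top: "defc t + long_rows t \<le> defc ?p" "0 < long_rows t"
    using defc_short_row[of r t] p rt r by simp_all
  have t: "is_partition t" using p rt by (simp add: is_partition_Cons)
  have c: "0 < c" and zc: "length g < G \<Longrightarrow> Suc (long_rows g) \<le> c - d"
  proof -
    consider "xs = []" "r = G" "t = g" | ys where "xs = r # ys" "t = ys @ G # g"
      using rt by (cases xs) auto
    then have "defc g \<le> defc t \<and> (length g < G \<longrightarrow> Suc (long_rows g) \<le> c - d)"
    proof cases
      case 1 then show ?thesis using r by simp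
    next
      case 2
      have "defc (G # g) \<le> defc t" using defc_append t 2 by blast
      moreover have "long_rows (G # g) \<le> long_rows t" using long_rows_append 2 by blast
      ultimately show ?thesis using dG top def by auto
    qed
    then show "0 < c" "length g < G \<Longrightarrow> Suc (long_rows g) \<le> c - d" using top def by auto
  qed
  have dc: "d \<le> c" using dG defc_append[OF p] def by simp
  have short: "long_rows g \<le> d \<and> 0 < d" if "G \<le> length g"
    using defc_short_row[OF Gg that] dG by simp
  have range: "G \<in> set [(if g = [] then 1 else hd g)..<length g + (c - long_rows g) + 2]"
  proof -
    have "(if g = [] then 1 else hd g) \<le> G" using Gg by (auto simp: is_partition_Cons_hd)
    moreover have "G < length g + (c - long_rows g) + 2"
    proof (cases "G \<le> length g")
      case False
      then have "Suc (long_rows g) \<le> c - d" using zc by simp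
      moreover have "G \<le> d + (length g + 2)" using row_dinv_le_length[of G g] by (simp add: d_def)
      ultimately show ?thesis by simp
    qed simp
    ultimately show ?thesis unfolding set_upt atLeastLessThan_iff by blast
  qed
  have IH: "?p \<in> set (initials (c - d) (long_rows (G # g)) (G # g))"
    using snoc.IH[of "G # g" "c - d"] p init def dG dc by simp
  let ?f = "\<lambda>G. let d = G - row_dinv G g in
        if d \<le> c then
           if G \<le> length g then (if long_rows g \<le> d \<and> 0 < d then initials (c - d) (long_rows g) (G # g) else [])
           else (if Suc (long_rows g) \<le> c - d then initials (c - d) (Suc (long_rows g)) (G # g) else [])
         else []"
  have "?p \<in> set (?f G)"
  proof (cases "G \<le> length g")
    case True
    then show ?thesis using dc short IH by (simp add: Let_def d_def[symmetric])
  next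
    case False
    then show ?thesis using dc zc IH by (simp add: Let_def d_def[symmetric])
  qed
  then have "?p \<in> set (concat (map ?f [(if g = [] then 1 else hd g)..<length g + (c - long_rows g) + 2]))"
    unfolding set_concat set_map using range by blast
  moreover have "initials c (long_rows g) g =
      concat (map ?f [(if g = [] then 1 else hd g)..<length g + (c - long_rows g) + 2])"
    using c by (subst initials.simps) (simp only: if_False less_not_refl2)
  ultimately have "?p \<in> set (initials c (long_rows g) g)" by (simp only:)
  then show ?case by (simp only: append_assoc append_Cons append_Nil)
qed

lemma initials_complete:
  "is_partition g \<Longrightarrow> nu_initial g \<Longrightarrow> g \<in> set (initials (defc g) 0 [])"
  using initials_complete_aux[of g "[]" "defc g"] by simp

lemma initials_sound:
  "g \<in> set (initials c z h) \<Longrightarrow> is_partition h \<Longrightarrow>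
    is_partition g \<and> nu_initial g \<and> defc g = defc h + c"
proof (induction c z h rule: initials.induct)
  case (1 c z h)
  show ?case
  proof (cases "c = 0")
    case True
    then show ?thesis using "1.prems" by (auto simp: initials.simps split: if_splits)
  next
    case False
    then obtain G where G: "G \<in> set [(if h = [] then 1 else hd h)..<length h + (c - z) + 2]"
      and mem: "g \<in> set (let d = G - row_dinv G h in
        if d \<le> c then
           if G \<le> length h then (if z \<le> d \<and> 0 < d then initials (c - d) z (G # h) else [])
           else (if Suc z \<le> c - d then initials (c - d) (Suc z) (G # h) else [])
         else [])"
      using "1.prems"(1) by (subst (asm) initials.simps) auto
    have h0: "h \<noteq> [] \<longrightarrow> 0 < hd h" using "1.prems"(2) by (cases h) (auto simp: is_partition_Cons)
    have part: "is_partition (G # h)"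
      using G "1.prems"(2) h0 by (auto simp: is_partition_Cons_hd split: if_splits)
    define d where "d = G - row_dinv G h"
    have "d \<le> c" using mem by (auto simp: d_def Let_def split: if_splits)
    moreover have "is_partition g \<and> nu_initial g \<and> defc g = defc (G # h) + (c - d)"
    proof (cases "G \<le> length h")
      case True
      then show ?thesis
        using mem "1.IH"(1)[OF False G d_def] part by (auto simp: d_def Let_def split: if_splits)
    next
      case F: False
      then show ?thesis
        using mem "1.IH"(2)[OF False G d_def] part by (auto simp: d_def Let_def split: if_splits)
    qed
    ultimately show ?thesis using defc_Cons[OF part] by (simp add: d_def)
  qed
qed

section \<open>Segments\<close>

lemma nu_segment_initial:
  assumes "nu_initial g"
  shows "nu_segment g = {d. (g, d) \<in> nu_rel\<^sup>*}"
proof -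
  have "d = g" if "(d, g) \<in> nu_rel\<^sup>*" for d
    using that
  proof (cases rule: rtranclE)
    case (step y)
    then show ?thesis using assms nu_not_initial by (auto simp: nu_rel_def)
  qed simp
  then show ?thesis by (auto simp: nu_segment_def)
qed

lemma nu_rtrancl_partition:
  "(g, d) \<in> nu_rel\<^sup>* \<Longrightarrow> is_partition g \<Longrightarrow> is_partition d \<and> defc d = defc g \<and> sum_list g \<le> sum_list d"
proof (induction rule: rtrancl_induct)
  case (step y z)
  then have "y \<in> nu_dom" "z = nu y" by (auto simp: nu_rel_def)
  then show ?case using step is_partition_nu defc_nu sum_list_nu[of y] by simp
qed simp

lemma nu_segment_Def:
  "nu_initial g \<Longrightarrow> g \<in> Def k \<Longrightarrow> nu_segment g \<subseteq> Def k"
  using nu_rtrancl_partition by (auto simp: nu_segment_initial Def_def)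

lemma nu_segment_refl: "g \<in> nu_segment g"
  by (simp add: nu_segment_def)

text \<open>Going back along \<open>nu\<close> lowers the size, so it ends at an initial
  partition.\<close>

lemma in_some_segment:
  assumes "is_partition d"
  shows "\<exists>g. is_partition g \<and> nu_initial g \<and> defc g = defc d \<and> d \<in> nu_segment g"
  using assms
proof (induction "sum_list d" arbitrary: d rule: less_induct)
  case less
  show ?case
  proof (cases "nu_initial d")
    case True
    then show ?thesis using less.prems nu_segment_refl by blast
  next
    case False
    then obtain e where e: "e \<in> nu_dom" "nu e = d" using nu_preimage less.prems by metis
    then have ep: "is_partition e" by (simp add: nu_dom_def)
    obtain g where g: "is_partition g" "nu_initial g" "defc g = defc e" "e \<in> nu_segment g"
      using less.hyps[of e] sum_list_nu[OF ep] e ep by auto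
    have "(e, d) \<in> nu_rel" using e by (auto simp: nu_rel_def)
    then have "d \<in> nu_segment g"
      using g(4) nu_segment_initial[OF g(2)] by (auto intro: rtrancl_into_rtrancl)
    then show ?thesis using g defc_nu[OF e(1)] e(2) by auto
  qed
qed

lemma nu_segment_disjoint:
  assumes "nu_initial g" "nu_initial h" "d \<in> nu_segment g" "d \<in> nu_segment h"
  shows "g = h"
proof -
  have "(g, d) \<in> nu_rel\<^sup>*" "(h, d) \<in> nu_rel\<^sup>*"
    using assms by (auto simp: nu_segment_initial)
  then show ?thesis
  proof (induction rule: rtrancl_induct)
    case base
    then have "g \<in> nu_segment h" using assms by (simp add: nu_segment_initial)
    show ?case using base
    proof (cases rule: rtranclE)
      case (step y)
      then show ?thesis using assms nu_not_initial by (auto simp: nu_rel_def)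
    qed simp
  next
    case (step y z)
    from step.prems show ?case
    proof (cases rule: rtranclE)
      case base
      then show ?thesis using step.hyps assms nu_not_initial by (auto simp: nu_rel_def)
    next
      case (step w)
      then have "w = y" using \<open>(y, z) \<in> nu_rel\<close> nu_inj by (auto simp: nu_rel_def)
      then show ?thesis using step \<open>(h, y) \<in> nu_rel\<^sup>* \<Longrightarrow> g = h\<close> by simp
    qed
  qed
qed

text \<open>The first argument bounds the number of steps; an orbit that has stopped earlier, at
  a partition outside the domain of \<open>nu\<close>, is recognised by
  \<open>ends\<close>.\<close>

fun orbit :: "nat \<Rightarrow> partition \<Rightarrow> partition list" where
  "orbit 0 g = []"
| "orbit (Suc n) g = g # (if part g 1 \<le> length g + 2 then orbit n (nu g) else [])"

definition ends :: "partition list \<Rightarrow> bool" where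
  "ends X \<longleftrightarrow> length (last X) + 2 < part (last X) 1"

lemma orbit_segment:
  assumes "is_partition g" "ends (orbit (Suc n) g)"
  shows "set (orbit (Suc n) g) = {d. (g, d) \<in> nu_rel\<^sup>*}"
  using assms
proof (induction n arbitrary: g)
  case 0
  then have "g \<notin> nu_dom" by (auto simp: ends_def nu_dom_def)
  then have "{d. (g, d) \<in> nu_rel\<^sup>*} = {g}"
    by (auto simp: nu_rel_def elim: converse_rtranclE)
  moreover have "orbit (Suc 0) g = [g]" by simp
  ultimately show ?case by simp
next
  case (Suc n)
  show ?case
  proof (cases "part g 1 \<le> length g + 2")
    case True
    then have g: "g \<in> nu_dom" using Suc.prems by (simp add: nu_dom_def)
    have eq: "orbit (Suc (Suc n)) g = g # orbit (Suc n) (nu g)" using True by simp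
    have "ends (orbit (Suc n) (nu g))"
      using Suc.prems(2) unfolding eq ends_def by simp
    then have IH: "set (orbit (Suc n) (nu g)) = {d. (nu g, d) \<in> nu_rel\<^sup>*}"
      using Suc.IH is_partition_nu[OF g] by simp
    have "(g, nu g) \<in> nu_rel" using g by (auto simp: nu_rel_def)
    then have "{d. (g, d) \<in> nu_rel\<^sup>*} = insert g {d. (nu g, d) \<in> nu_rel\<^sup>*}"
      by (auto simp: nu_rel_def elim: converse_rtranclE intro: converse_rtrancl_into_rtrancl)
    then show ?thesis using IH by (simp add: eq del: orbit.simps)
  next
    case False
    then have "g \<notin> nu_dom" by (auto simp: nu_dom_def)
    then have "{d. (g, d) \<in> nu_rel\<^sup>*} = {g}"
      by (auto simp: nu_rel_def elim: converse_rtranclE)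
    then show ?thesis using False by simp
  qed
qed

section \<open>Tails are infinite\<close>

text \<open>A class of partitions within one cell of a staircase that \<open>nu\<close> maps to
  itself: the first \<open>s\<close> rows follow the staircase of size \<open>m\<close>, the
  others the one of size \<open>m - 1\<close>, each row up to one missing cell. Applying
  \<open>nu\<close> moves every row down by one place and thereby raises \<open>s\<close>; when
  \<open>s\<close> reaches \<open>m - 1\<close> the same partition is described by \<open>m +
  1\<close> and \<open>s = 0\<close>.\<close>

definition unbounded :: "partition \<Rightarrow> bool" where
  "unbounded g \<longleftrightarrow> is_partition g \<and> (\<exists>m s. s < m \<and> part g m = 0 \<and>
     (\<forall>i. 1 \<le> i \<and> i \<le> s \<longrightarrow> part g i = m + 1 - i \<or> part g i = m - i) \<and>
     (\<forall>i. s < i \<and> i < m \<longrightarrow> part g i = m - i \<or> part g i = m - 1 - i))"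

lemma part_nu:
  assumes "is_partition g"
  shows "part (nu g) 1 = Suc (length g)" "1 \<le> i \<Longrightarrow> part (nu g) (Suc i) = part g i - 1"
proof -
  show "part (nu g) 1 = Suc (length g)" by (simp add: nu_eq part_def)
  have "part (drop_zeros (pred_all g)) i = part g i - 1" if "1 \<le> i" for i
    using assms that
  proof (induction g arbitrary: i)
    case (Cons r g)
    show ?case
    proof (cases "r = 1")
      case True
      then have 1: "\<forall>x\<in>set (r # g). x = 1" using Cons.prems by (force simp: is_partition_Cons is_partition_def)
      then have "drop_zeros (pred_all (r # g)) = []"
        by (auto simp: drop_zeros_def filter_empty_conv)
      moreover have "part (r # g) i \<le> 1"
      proof (cases "i \<le> length (r # g)")
        case True
        then have "part (r # g) i \<in> set (r # g)"
          using Cons.prems(2) nth_mem[of "i - 1" "r # g"] by (simp add: part_def)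
        then show ?thesis using 1 by fastforce
      qed (simp add: part_def)
      ultimately show ?thesis by (simp add: part_def)
    next
      case False
      then have e: "drop_zeros (pred_all (r # g)) = (r - 1) # drop_zeros (pred_all g)"
        using Cons.prems by (auto simp: is_partition_Cons)
      show ?thesis
      proof (cases "i = 1")
        case True
        then show ?thesis by (subst e) (simp add: part_Cons_1)
      next
        case False
        then obtain j where "i = Suc j" "1 \<le> j" using Cons.prems by (cases i) auto
        then show ?thesis using Cons.IH[of j] Cons.prems
          by (subst e) (simp add: part_Cons_Suc is_partition_Cons)
      qed
    qed
  qed (simp add: part_def)
  then show "part (nu g) (Suc i) = part g i - 1" if "1 \<le> i"
    using that by (simp add: nu_eq part_Cons_Suc)
qed

lemma part_pos_iff: "is_partition g \<Longrightarrow> 1 \<le> i \<Longrightarrow> 0 < part g i \<longleftrightarrow> i \<le> length g"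
  by (auto simp: part_def is_partition_def)

lemma unbounded_step:
  assumes "unbounded g"
  shows "g \<in> nu_dom \<and> unbounded (nu g)"
proof -
  from assms obtain m s where g: "is_partition g" and sm: "s < m" and m: "part g m = 0"
    and upper: "\<And>i. 1 \<le> i \<Longrightarrow> i \<le> s \<Longrightarrow> part g i = m + 1 - i \<or> part g i = m - i"
    and lower: "\<And>i. s < i \<Longrightarrow> i < m \<Longrightarrow> part g i = m - i \<or> part g i = m - 1 - i"
    unfolding unbounded_def by blast
  \<comment> \<open>It may be assumed that the upper staircase leaves room for one more row.\<close>
  have "\<exists>m s. Suc s < m \<and> part g m = 0 \<and>
     (\<forall>i. 1 \<le> i \<and> i \<le> s \<longrightarrow> part g i = m + 1 - i \<or> part g i = m - i) \<and>
     (\<forall>i. s < i \<and> i < m \<longrightarrow> part g i = m - i \<or> part g i = m - 1 - i)"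
  proof (cases "Suc s < m")
    case True
    then show ?thesis using m upper lower by blast
  next
    case False
    then have ms: "m = Suc s" using sm by simp
    have len: "length g < m" using m sm part_pos_iff[OF g, of m] by force
    have "part g (Suc m) = 0" using len by (simp add: part_def)
    moreover have "part g i = Suc m - i \<or> part g i = Suc m - 1 - i" if "0 < i" "i < Suc m" for i
      using upper[of i] that m ms by (cases "i = m") auto
    ultimately show ?thesis using sm by (intro exI[of _ "Suc m"] exI[of _ 0]) auto
  qed
  then obtain m s where sm: "Suc s < m" and m: "part g m = 0"
    and upper: "\<And>i. 1 \<le> i \<Longrightarrow> i \<le> s \<Longrightarrow> part g i = m + 1 - i \<or> part g i = m - i"
    and lower: "\<And>i. s < i \<Longrightarrow> i < m \<Longrightarrow> part g i = m - i \<or> part g i = m - 1 - i"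
    by blast
  have len1: "length g < m" using m sm part_pos_iff[OF g, of m] by force
  have len2: "m \<le> length g + 2"
  proof (cases "m - 2 = 0")
    case False
    then have "1 \<le> m - 2" by simp
    then have "0 < part g (m - 2)"
      using upper[of "m - 2"] lower[of "m - 2"] sm by (cases "m - 2 \<le> s") auto
    then show ?thesis using part_pos_iff[OF g, of "m - 2"] False by simp
  qed simp
  have first: "part g 1 \<le> m"
    using upper[of 1] lower[of 1] sm by (cases "1 \<le> s") auto
  then have dom: "g \<in> nu_dom" using len2 g by (simp add: nu_dom_def)
  have "part (nu g) m = 0"
  proof -
    have "s < m - 1" "m - 1 < m" using sm by auto
    then have "part g (m - 1) \<le> 1" using lower[of "m - 1"] by auto
    then show ?thesis using part_nu(2)[OF g, of "m - 1"] sm by simp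
  qed
  moreover have "part (nu g) i = m + 1 - i \<or> part (nu g) i = m - i" if "1 \<le> i" "i \<le> Suc s" for i
  proof (cases "i = 1")
    case True
    then show ?thesis using part_nu(1)[OF g] len1 len2 by auto
  next
    case False
    then have "part (nu g) i = part g (i - 1) - 1" using part_nu(2)[OF g, of "i - 1"] that by simp
    moreover have "1 \<le> i - 1" "i - 1 \<le> s" using that False by auto
    ultimately show ?thesis using upper[of "i - 1"] by auto
  qed
  moreover have "part (nu g) i = m - i \<or> part (nu g) i = m - 1 - i" if "Suc s < i" "i < m" for i
  proof -
    have "1 \<le> i - 1" "s < i - 1" "i - 1 < m" using that by auto
    then show ?thesis using part_nu(2)[OF g, of "i - 1"] lower[of "i - 1"] that by auto
  qed
  ultimately have "unbounded (nu g)"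
    unfolding unbounded_def using is_partition_nu[OF dom] sm by blast
  then show ?thesis using dom by blast
qed

lemma unbounded_funpow:
  assumes "unbounded g"
  shows "unbounded ((nu ^^ r) g) \<and> sum_list ((nu ^^ r) g) = sum_list g + r"
proof (induction r)
  case (Suc r)
  then show ?case using unbounded_step[of "(nu ^^ r) g"] sum_list_nu[of "(nu ^^ r) g"]
    by (simp add: nu_dom_def)
qed (use assms in simp)

lemma unbounded_segment:
  assumes "unbounded g"
  shows "{d. (g, d) \<in> nu_rel\<^sup>*} = {(nu ^^ r) g |r. True}"
proof
  show "{d. (g, d) \<in> nu_rel\<^sup>*} \<subseteq> {(nu ^^ r) g |r. True}"
  proof clarify
    fix d assume "(g, d) \<in> nu_rel\<^sup>*"
    then show "\<exists>r. d = (nu ^^ r) g \<and> True"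
    proof (induction rule: rtrancl_induct)
      case base
      show ?case by (intro exI[of _ 0]) simp
    next
      case (step y z)
      then obtain r where "y = (nu ^^ r) g" by blast
      then have "z = (nu ^^ Suc r) g" using step by (auto simp: nu_rel_def)
      then show ?case by blast
    qed
  qed
  have "(g, (nu ^^ r) g) \<in> nu_rel\<^sup>*" for r
  proof (induction r)
    case (Suc r)
    have "((nu ^^ r) g, nu ((nu ^^ r) g)) \<in> nu_rel"
      using unbounded_step[OF conjunct1[OF unbounded_funpow[OF assms, of r]]] by (auto simp: nu_rel_def)
    then show ?case using Suc by (auto intro: rtrancl_into_rtrancl)
  qed simp
  then show "{(nu ^^ r) g |r. True} \<subseteq> {d. (g, d) \<in> nu_rel\<^sup>*}" by blast
qed


section \<open>Staircases and ordinary chains\<close>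

text \<open>\<open>min_Delta\<close> in recursive form: the maximum of 1 and all \<open>part g i
  + i\<close>.\<close>

fun min_level :: "partition \<Rightarrow> nat" where
  "min_level [] = 1"
| "min_level (r # g) = Suc (max r (min_level g))"

lemma min_level_le_iff:
  "is_partition g \<Longrightarrow> 0 < n \<and> (\<forall>i\<in>{1..length g}. int (part g i) \<le> int n - int i) \<longleftrightarrow> min_level g \<le> n"
proof (induction g arbitrary: n)
  case (Cons r g)
  then have r: "0 < r" and g: "is_partition g" by (auto simp: is_partition_Cons)
  have rows: "{1..length (r # g)} = insert 1 (Suc ` {1..length g})"
    by (auto simp: image_iff Suc_le_eq)
  have "(\<forall>i\<in>{1..length (r # g)}. int (part (r # g) i) \<le> int n - int i) \<longleftrightarrow>
    r + 1 \<le> n \<and> (\<forall>i\<in>{1..length g}. int (part g i) \<le> int (n - 1) - int i)"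
    unfolding rows by (simp only: ball_simps) (auto simp: part_Cons_1 part_Cons_Suc)
  then show ?case using Cons.IH[OF g, of "n - 1"] r by auto
qed auto

lemma min_Delta_eq: "is_partition g \<Longrightarrow> min_Delta g = min_level g"
  unfolding min_Delta_def by (subst min_level_le_iff) (auto intro: Least_equality)

lemma min_level_pos: "0 < min_level g"
  by (cases g) auto

text \<open>The values of an \<open>(a, m, h)\<close>-staircase, read from the left. When the
  \<open>m + 1\<close> copies of \<open>h\<close> are used up, what follows begins with
  \<open>h\<close> copies of \<open>h + 1\<close> and is an \<open>(a + m + 1, h - 1, h +
  1)\<close>-staircase.\<close>

fun is_stair :: "nat \<Rightarrow> nat \<Rightarrow> nat list \<Rightarrow> bool" where
  "is_stair m h [] = True"
| "is_stair m h (x # xs) = (x = h \<and>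
     (case m of 0 \<Rightarrow> is_stair (h - 1) (Suc h) xs | Suc n \<Rightarrow> is_stair n h xs))"

lemma staircase_climb:
  assumes "a < i" "0 < h"
  shows "staircase a 0 h i = staircase (Suc a) (h - 1) (Suc h) i"
proof -
  have "j \<le> (\<Sum>t<Suc j. h + t)" for j by (induction j) auto
  then have "i \<le> a + 0 + (\<Sum>t<Suc i. h + t)" by (meson le_trans le_add2)
  moreover have "\<not> i \<le> a + 0 + (\<Sum>t<0. h + t)" using assms by simp
  ultimately have "(LEAST j. i \<le> a + 0 + (\<Sum>t<j. h + t)) = Suc (LEAST j. i \<le> a + 0 + (\<Sum>t<Suc j. h + t))"
    by (rule Least_Suc)
  moreover have "a + 0 + (\<Sum>t<Suc j. h + t) = Suc a + (h - 1) + (\<Sum>t<j. Suc h + t)" for j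
    using assms(2) by (subst sum.lessThan_Suc_shift) simp
  ultimately have "(LEAST j. i \<le> a + 0 + (\<Sum>t<j. h + t))
      = Suc (LEAST j. i \<le> Suc a + (h - 1) + (\<Sum>t<j. Suc h + t))"
    by (simp only:)
  then show ?thesis unfolding staircase_def by linarith
qed

lemma is_stair_staircase:
  "is_stair m h F \<Longrightarrow> 0 < h \<Longrightarrow> t < length F \<Longrightarrow> F ! t = staircase a m h (a + t)"
proof (induction F arbitrary: a m h t)
  case (Cons x F)
  show ?case
  proof (cases t)
    case 0
    then show ?thesis using Cons.prems staircase_eq[of a m h a] by simp
  next
    case (Suc u)
    show ?thesis
    proof (cases m)
      case 0
      then have "F ! u = staircase (Suc a) (h - 1) (Suc h) (Suc a + u)"
        using Cons.IH[of "h - 1" "Suc h" u "Suc a"] Cons.prems Suc by simp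
      then show ?thesis using staircase_climb[of a "a + t" h] Cons.prems Suc 0 by simp
    next
      case (Suc n)
      then have "F ! u = staircase (Suc a) n h (Suc a + u)"
        using Cons.IH[of n h u "Suc a"] Cons.prems \<open>t = Suc u\<close> by simp
      then show ?thesis using \<open>t = Suc u\<close> Suc by (simp add: staircase_def)
    qed
  qed
qed simp

definition grows :: "partition \<Rightarrow> partition \<Rightarrow> bool" where
  "grows x y \<longleftrightarrow> sum_list y = Suc (sum_list x)"

lemma grows_nth: "successively grows Z \<Longrightarrow> t < length Z \<Longrightarrow> sum_list (Z ! t) = sum_list (hd Z) + t"
proof (induction Z arbitrary: t)
  case (Cons x Z)
  then show ?case by (cases t) (auto simp: successively_Cons grows_def)
qed simp

definition left_block :: "partition list \<Rightarrow> partition list" where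
  "left_block X = take (length (takeWhile (\<lambda>h. h = min_level (hd X)) (map min_level X))) X"

text \<open>Two successive runs \<open>X\<close> and \<open>Y\<close> give an ordinary chain,
  namely \<open>X\<close> followed by the left block of \<open>Y\<close>, if \<open>X\<close>
  climbs a staircase beyond its left block and \<open>Y\<close> starts lower than
  \<open>X\<close> ends.\<close>

definition link :: "partition list \<Rightarrow> partition list \<Rightarrow> bool" where
  "link X Y \<longleftrightarrow> (let m = length (left_block X) in
     m < length X \<and> min_level (hd Y) < min_level (last X) \<and>
     is_stair (m - 1) (min_level (hd X)) (map min_level X))"

lemma left_block_level: "g \<in> set (left_block X) \<Longrightarrow> min_level g = min_level (hd X)"
proof -
  assume "g \<in> set (left_block X)"
  moreover have "left_block X = takeWhile (\<lambda>g. min_level g = min_level (hd X)) X"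
    by (simp add: left_block_def takeWhile_map takeWhile_eq_take[symmetric] comp_def)
  ultimately show ?thesis by (auto dest: set_takeWhileD)
qed

lemma left_block_Nil_iff: "left_block X = [] \<longleftrightarrow> X = []"
  by (cases X) (auto simp: left_block_def)

lemma hd_left_block: "X \<noteq> [] \<Longrightarrow> hd (left_block X) = hd X"
  by (cases X) (auto simp: left_block_def)

text \<open>Within one deficit, size and \<open>dinv\<close> differ by a constant, so lists of
  partitions growing by one cell are indexed by \<open>dinv\<close>.\<close>

lemma ordinary_chain_of_lists:
  assumes grow: "successively grows (X @ Y)"
    and Def: "set (X @ Y) \<subseteq> Def k"
    and link: "link X Y" and Y: "Y \<noteq> []"
  shows "ordinary_chain k (set X \<union> set (left_block Y)) (dinv (hd X)) (dinv (hd Y))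
    (length (left_block X) - 1) (length (left_block Y) - 1) (min_level (hd X)) (min_level (hd Y))"
proof -
  let ?B = "left_block Y"
  let ?Z = "X @ ?B"
  let ?a = "dinv (hd X)" and ?a' = "dinv (hd Y)"
  from link have m: "length (left_block X) < length X"
    and drop: "min_level (hd Y) < min_level (last X)"
    and stair: "is_stair (length (left_block X) - 1) (min_level (hd X)) (map min_level X)"
    by (auto simp: link_def Let_def)
  have X: "X \<noteq> []" using m by auto
  have B: "?B \<noteq> []" using Y by (simp add: left_block_Nil_iff)
  have pre: "t < length ?Z \<Longrightarrow> ?Z ! t = (X @ Y) ! t" "length ?Z \<le> length (X @ Y)" for t
    by (auto simp: left_block_def nth_append)
  have ZDef: "?Z ! t \<in> Def k" if "t < length ?Z" for t
    using Def pre(1)[OF that] pre(2) that by (metis nth_mem less_le_trans subsetD)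
  have sum: "sum_list (?Z ! t) = sum_list (hd X) + t" if "t < length ?Z" for t
    using grows_nth[OF grow, of t] pre(1)[OF that] pre(2) that X by simp
  have size: "sum_list g = dinv g + k" if "g \<in> Def k" for g
    using that size_eq by (auto simp: Def_def)
  have hdX: "hd X \<in> Def k" and hdY: "hd Y \<in> Def k" using Def X Y by auto
  have dinv: "dinv (?Z ! t) = ?a + t" if "t < length ?Z" for t
    using sum[OF that] size[OF ZDef[OF that]] size[OF hdX] by simp
  have hdB: "hd ?B = hd Y" using Y by (rule hd_left_block)
  have a': "?a' = ?a + length X"
    using dinv[of "length X"] B hdB by (simp add: nth_append hd_conv_nth)
  define f where "f i = ?Z ! (i - ?a)" for i
  have idx: "i - ?a < length ?Z" "?a + (i - ?a) = i" if "i \<in> {?a..?a' + (length ?B - 1)}" for i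
    using that a' B by (auto simp: not_le le_less_trans neq_Nil_conv)
  have fDef: "f i \<in> Def k" "dinv (f i) = i" if "i \<in> {?a..?a' + (length ?B - 1)}" for i
    using ZDef[OF idx(1)[OF that]] dinv[OF idx(1)[OF that]] idx(2)[OF that] by (auto simp: f_def)
  have minD: "min_Delta (f i) = min_level (f i)" if "i \<in> {?a..?a' + (length ?B - 1)}" for i
    using fDef(1)[OF that] min_Delta_eq by (simp add: Def_def)
  have fX: "f i = X ! (i - ?a)" if "?a \<le> i" "i < ?a'" for i
  proof -
    have "i - ?a < length X" using that a' by linarith
    then show ?thesis by (simp add: f_def nth_append)
  qed
  have fB: "f i = ?B ! (i - ?a')" if "?a' \<le> i" for i
  proof -
    have "\<not> i - ?a < length X" "i - ?a - length X = i - ?a'" using that a' by linarith+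
    then show ?thesis by (simp add: f_def nth_append)
  qed
  have "set ?Z = f ` {?a..?a' + (length ?B - 1)}"
  proof
    show "set ?Z \<subseteq> f ` {?a..?a' + (length ?B - 1)}"
    proof
      fix g assume "g \<in> set ?Z"
      then obtain t where t: "t < length ?Z" "g = ?Z ! t" by (metis in_set_conv_nth)
      then have "?a + t \<in> {?a..?a' + (length ?B - 1)}" "g = f (?a + t)" using a' by (auto simp: f_def)
      then show "g \<in> f ` {?a..?a' + (length ?B - 1)}" by blast
    qed
    show "f ` {?a..?a' + (length ?B - 1)} \<subseteq> set ?Z"
      using idx(1) unfolding f_def by (metis image_subsetI nth_mem)
  qed
  moreover have "min_Delta (f (?a' - 1)) > min_Delta (f ?a')"
  proof -
    have "?a' - 1 \<in> {?a..?a' + (length ?B - 1)}" "?a' \<in> {?a..?a' + (length ?B - 1)}"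
      unfolding atLeastAtMost_iff using a' m by linarith+
    moreover have "f (?a' - 1) = last X"
    proof -
      have "?a \<le> ?a' - 1" "?a' - 1 < ?a'" "?a' - 1 - ?a = length X - 1" using a' m by linarith+
      then show ?thesis using fX[of "?a' - 1"] X by (simp add: last_conv_nth)
    qed
    moreover have "f ?a' = hd Y" using fB[of ?a'] B hdB by (simp add: hd_conv_nth)
    ultimately show ?thesis using minD drop by metis
  qed
  moreover have "min_Delta (f i) = min_level (hd Y)" if i: "i \<in> {?a'..?a' + (length ?B - 1)}" for i
  proof -
    have "i - ?a' < length ?B" using i B by (cases ?B) auto
    then have "f i \<in> set ?B" using fB i by simp
    moreover have "i \<in> {?a..?a' + (length ?B - 1)}" using i a' by auto
    ultimately show ?thesis using minD left_block_level by metis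
  qed
  moreover have "min_Delta (f i) = staircase ?a (length (left_block X) - 1) (min_level (hd X)) i"
    if i: "i \<in> {?a..?a' - 1}" for i
  proof -
    have lt: "i < ?a'" "i - ?a < length X" using i a' X by (auto simp: Suc_le_eq) (cases X; auto)+
    then have "map min_level X ! (i - ?a) = staircase ?a (length (left_block X) - 1) (min_level (hd X)) (?a + (i - ?a))"
      using is_stair_staircase[OF stair min_level_pos, of "i - ?a" ?a] by simp
    then show ?thesis using minD[of i] fX[of i] lt i by simp
  qed
  moreover have "?a + (length (left_block X) - 1) + 1 < ?a'"
    using a' m X left_block_Nil_iff[of X] by (cases "left_block X") auto
  ultimately show ?thesis
    unfolding ordinary_chain_def using fDef by (intro conjI exI[of _ f]) (auto simp: Def_def)
qed

section \<open>Tails as sets\<close>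

lemma part_drop_zeros:
  "sorted_wrt (\<ge>) xs \<Longrightarrow> part (drop_zeros xs) i = (if 1 \<le> i \<and> i \<le> length xs then xs ! (i - 1) else 0)"
proof (induction xs arbitrary: i)
  case (Cons x xs)
  show ?case
  proof (cases "0 < x")
    case True
    then have d: "drop_zeros (x # xs) = x # drop_zeros xs" by simp
    consider "i = 0" | "i = 1" | j where "i = Suc j" "1 \<le> j" by (cases i) fastforce+
    then show ?thesis
    proof cases
      case 3
      then show ?thesis using Cons.IH[of j] Cons.prems unfolding d by (simp add: part_Cons_Suc)
    qed (use True in \<open>simp_all add: part_def\<close>)
  next
    case False
    then have z: "\<forall>y\<in>set (x # xs). y = 0" using Cons.prems by auto
    then have "drop_zeros (x # xs) = []" by (auto simp: drop_zeros_def filter_empty_conv)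
    moreover have "(x # xs) ! (i - 1) = 0" if "1 \<le> i" "i \<le> length (x # xs)"
      using z that nth_mem[of "i - 1" "x # xs"] by auto
    ultimately show ?thesis by (auto simp: part_def)
  qed
qed (simp add: part_def)

lemma TI_word_binary: "x \<in> set (TI_word mu) \<Longrightarrow> x \<le> 1"
  by (auto simp: TI_word_def simp del: upt_Suc split: if_splits)

text \<open>The word of \<open>TI mu\<close> is binary, so \<open>TI mu\<close> misses at most
  one cell in each row of a staircase.\<close>

lemma TI_unbounded: "unbounded (TI mu)"
proof -
  define v where "v = TI_word mu"
  let ?N = "length v"
  let ?xs = "rev (map (\<lambda>i. i - v ! i) [0..<?N])"
  have v0: "v ! 0 = 0" "0 < ?N" by (auto simp: v_def TI_word_def)
  have v1: "v ! i \<le> 1" if "i < ?N" for i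
    using that TI_word_binary nth_mem unfolding v_def by blast
  have TI: "TI mu = drop_zeros ?xs" by (simp add: TI_def v_def Let_def)
  have nth: "?xs ! i = ?N - 1 - i - v ! (?N - 1 - i)" if "i < ?N" for i
  proof -
    have "?N - Suc i < ?N" using that by simp
    then show ?thesis using that by (simp add: rev_nth)
  qed
  have "?xs ! j \<le> ?xs ! i" if "i < j" "j < length ?xs" for i j
  proof -
    have "?N - 1 - j < ?N - 1 - i" "v ! (?N - 1 - i) \<le> 1" using that v1[of "?N - 1 - i"] by auto
    then have "i + v ! (?N - 1 - i) \<le> j + v ! (?N - 1 - j)" using that by linarith
    then have "?N - Suc (j + v ! (?N - 1 - j)) \<le> ?N - Suc (i + v ! (?N - 1 - i))" by simp
    then show ?thesis using nth[of i] nth[of j] that by simp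
  qed
  then have sorted: "sorted_wrt (\<ge>) ?xs" by (auto simp: sorted_wrt_iff_nth_less)
  then have part: "is_partition (TI mu)"
    unfolding TI is_partition_def drop_zeros_def by (auto intro: sorted_wrt_filter)
  have p: "part (TI mu) i = ?N - i - v ! (?N - i)" if "1 \<le> i" "i \<le> ?N" for i
    using part_drop_zeros[OF sorted, of i] nth[of "i - 1"] that by (simp add: TI)
  have last: "part (TI mu) ?N = 0" using p[of ?N] v0 by simp
  have steps: "part (TI mu) i = ?N - i \<or> part (TI mu) i = ?N - 1 - i" if "0 < i" "i < ?N" for i
  proof -
    have "?N - i < ?N" using that by simp
    then have "v ! (?N - i) = 0 \<or> v ! (?N - i) = 1" using v1[of "?N - i"] by linarith
    then show ?thesis using p[of i] that by auto
  qed
  show ?thesis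
    unfolding unbounded_def using part last steps v0(2)
    by (intro conjI exI[of _ ?N] exI[of _ "0::nat"]) auto
qed

lemma tail_infinite: "infinite (tail mu)"
proof
  assume "finite (tail mu)"
  then have "finite (sum_list ` tail mu)" by simp
  moreover have "{sum_list (TI mu)..} \<subseteq> sum_list ` tail mu"
  proof
    fix n assume "n \<in> {sum_list (TI mu)..}"
    then have "n = sum_list ((nu ^^ (n - sum_list (TI mu))) (TI mu))"
      using unbounded_funpow[OF TI_unbounded] by simp
    then show "n \<in> sum_list ` tail mu" unfolding tail_def by blast
  qed
  ultimately show False using finite_subset infinite_Ici by blast
qed

text \<open>\<open>TI mu\<close> is the smallest member of its tail, hence determined by
  it.\<close>

lemma tail_size:
  assumes "g \<in> tail mu"
  shows "sum_list (TI mu) \<le> sum_list g" "sum_list g = sum_list (TI mu) \<Longrightarrow> g = TI mu"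
proof -
  obtain r where "g = (nu ^^ r) (TI mu)" using assms by (auto simp: tail_def)
  then show "sum_list (TI mu) \<le> sum_list g" "sum_list g = sum_list (TI mu) \<Longrightarrow> g = TI mu"
    using unbounded_funpow[OF TI_unbounded, of r mu] by auto
qed

lemma TI_in_tail: "TI mu \<in> tail mu"
  unfolding tail_def by (rule CollectI, rule exI[of _ 0]) simp

lemma tail_eq_TI: "tail mu = tail mu' \<Longrightarrow> TI mu = TI mu'"
  using tail_size TI_in_tail by (metis order_antisym)

lemma tail_eq_segment: "nu_initial (TI mu) \<Longrightarrow> tail mu = nu_segment (TI mu)"
  using unbounded_segment[OF TI_unbounded] by (simp add: nu_segment_initial tail_def)


section \<open>Assembling local chains from runs\<close>

lemma ordinary_chain_finite:
  assumes "ordinary_chain k S a a' m m' h h'"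
  shows "finite S" "S \<noteq> {g}"
proof -
  from assms obtain f where am: "a + m + 1 < a'" and S: "S = f ` {a..a' + m'}"
    and d: "\<forall>i\<in>{a..a' + m'}. dinv (f i) = i"
    unfolding ordinary_chain_def by blast
  show "finite S" using S by simp
  have "dinv (f a) = a" "dinv (f (a + 1)) = a + 1" using d am by auto
  moreover have "f a \<in> S" "f (a + 1) \<in> S" using S am by auto
  ultimately show "S \<noteq> {g}" by (metis Suc_eq_plus1 n_not_Suc_n singletonD)
qed

lemma tail_not_singleton: "tail mu \<noteq> {g}"
proof
  assume "tail mu = {g}"
  then have "finite (tail mu)" by simp
  then show False using tail_infinite by simp
qed

lemma ordinary_not_tail: "\<not> ordinary_chain k (tail mu) a a' m m' h h'"
  using ordinary_chain_finite(1) tail_infinite by blast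

lemma parts_of_ordinary:
  assumes "ordinary_chain k S a a' m m' h h'"
  shows "left_part k S = {g \<in> S. a \<le> dinv g \<and> dinv g \<le> a + m}"
    "mid_part k S = {g \<in> S. a + m < dinv g \<and> dinv g < a'}"
    "right_part k S = {g \<in> S. a' \<le> dinv g \<and> dinv g \<le> a' + m'}"
proof -
  have u: "ordinary_chain k S b b' n n' e e' \<longleftrightarrow> b = a \<and> b' = a' \<and> n = m \<and> n' = m' \<and> e = h \<and> e' = h'"
    for b b' n n' e e'
    using ordinary_chain_unique[OF _ assms, of k b b' n n' e e'] assms by auto
  have t: "(S = tail mu) = False" for mu
    using ordinary_not_tail[of k mu] assms by auto
  have s: "(S = {g}) = False" for g
    using ordinary_chain_finite(2)[OF assms] by simp
  show "left_part k S = {g \<in> S. a \<le> dinv g \<and> dinv g \<le> a + m}"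
    "mid_part k S = {g \<in> S. a + m < dinv g \<and> dinv g < a'}"
    "right_part k S = {g \<in> S. a' \<le> dinv g \<and> dinv g \<le> a' + m'}"
    unfolding left_part_def mid_part_def right_part_def u t s by simp_all
qed

lemma parts_of_tail:
  assumes "mu \<in> Par k"
  shows "left_part k (tail mu) = {TI mu}" "mid_part k (tail mu) = tail mu - {TI mu}"
    "right_part k (tail mu) = {}"
proof -
  have "left_part k (tail mu) = {g \<in> tail mu. \<exists>mu'\<in>Par k. tail mu = tail mu' \<and> g = TI mu'}"
    by (simp add: left_part_def ordinary_not_tail)
  moreover have "g \<in> tail mu \<and> (\<exists>mu'\<in>Par k. tail mu = tail mu' \<and> g = TI mu') \<longleftrightarrow> g = TI mu" for g
    using assms tail_eq_TI[of mu] TI_in_tail[of mu] by metis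
  ultimately show "left_part k (tail mu) = {TI mu}" by auto
  have "mid_part k (tail mu) = {g \<in> tail mu. \<exists>mu'\<in>Par k. tail mu = tail mu' \<and> g \<noteq> TI mu'}"
    by (simp add: mid_part_def ordinary_not_tail)
  moreover have "(\<exists>mu'\<in>Par k. tail mu = tail mu' \<and> g \<noteq> TI mu') \<longleftrightarrow> g \<noteq> TI mu" for g
    using assms tail_eq_TI[of mu] by metis
  ultimately show "mid_part k (tail mu) = tail mu - {TI mu}" by auto
  show "right_part k (tail mu) = {}"
    by (simp add: right_part_def ordinary_not_tail tail_not_singleton)
qed

lemma parts_of_singleton:
  assumes "g \<in> Def k"
  shows "left_part k {g} = {}" "mid_part k {g} = {}" "right_part k {g} = {g}"
proof -
  have o: "\<not> ordinary_chain k {g} a a' m m' h h'" for a a' m m' h h'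
    using ordinary_chain_finite(2) by blast
  have t: "{g} \<noteq> tail mu" for mu using tail_not_singleton by metis
  show "left_part k {g} = {}" "mid_part k {g} = {}" "right_part k {g} = {g}"
    using assms by (auto simp: left_part_def mid_part_def right_part_def o t)
qed

text \<open>The local chains of a deficit come from longer ones, one for each \<open>mu \<in>
  Par k\<close>: a sequence of runs \<open>run mu 0, \<dots>, run mu (s mu)\<close> with
  consecutive values of \<open>dinv\<close>, which ends in the tail of \<open>mu\<close>. The
  left block of run \<open>i\<close> consists of the partitions with \<open>dinv\<close> between
  \<open>a mu i\<close> and \<open>a mu i + m mu i\<close>, all with \<open>min_Delta\<close>
  equal to \<open>h mu i\<close>. The runs cut \<open>Def k\<close> into disjoint pieces, and
  the blocks of \<open>mu\<close> match those of \<open>opp mu\<close> in reverse order.\<close>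

locale chain_system =
  fixes k :: nat
    and opp :: "partition \<Rightarrow> partition"
    and s :: "partition \<Rightarrow> nat"
    and run left :: "partition \<Rightarrow> nat \<Rightarrow> partition set"
    and a m h :: "partition \<Rightarrow> nat \<Rightarrow> nat"
  assumes opp_Par: "mu \<in> Par k \<Longrightarrow> opp mu \<in> Par k"
    and opp_opp: "mu \<in> Par k \<Longrightarrow> opp (opp mu) = mu"
    and s_opp: "mu \<in> Par k \<Longrightarrow> s (opp mu) = s mu"
    and cover: "g \<in> Def k \<Longrightarrow> \<exists>mu\<in>Par k. \<exists>i\<le>s mu. g \<in> run mu i"
    and disjoint: "\<lbrakk>mu \<in> Par k; i \<le> s mu; g \<in> run mu i; la \<in> Par k; j \<le> s la; g \<in> run la j\<rbrakk>
      \<Longrightarrow> mu = la \<and> i = j"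
    and segments: "\<lbrakk>mu \<in> Par k; i \<le> s mu\<rbrakk> \<Longrightarrow> \<exists>G\<subseteq>Def k. run mu i = (\<Union>g\<in>G. nu_segment g)"
    and last_run: "mu \<in> Par k \<Longrightarrow> run mu (s mu) = tail mu"
    and last_left: "mu \<in> Par k \<Longrightarrow> left mu (s mu) = {TI mu}"
    and first_left: "mu \<in> Par k \<Longrightarrow> \<exists>g\<in>Def k. left mu 0 = {g} \<and> dinv g = length (opp mu) \<and>
      min_Delta g = min_Delta (TI (opp mu))"
    and left_subset: "\<lbrakk>mu \<in> Par k; i \<le> s mu\<rbrakk> \<Longrightarrow> left mu i \<subseteq> run mu i"
    and left_dinv: "\<lbrakk>mu \<in> Par k; i \<le> s mu; g \<in> run mu i\<rbrakk> \<Longrightarrow> a mu i \<le> dinv g \<and>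
      (g \<in> left mu i \<longleftrightarrow> dinv g \<le> a mu i + m mu i)"
    and run_dinv: "\<lbrakk>mu \<in> Par k; i < s mu; g \<in> run mu i\<rbrakk> \<Longrightarrow> dinv g < a mu (Suc i)"
    and ordinary: "\<lbrakk>mu \<in> Par k; i < s mu\<rbrakk> \<Longrightarrow> ordinary_chain k (run mu i \<union> left mu (Suc i))
      (a mu i) (a mu (Suc i)) (m mu i) (m mu (Suc i)) (h mu i) (h mu (Suc i))"
    and opposite: "\<lbrakk>mu \<in> Par k; i \<le> s mu\<rbrakk> \<Longrightarrow> m (opp mu) (s mu - i) = m mu i \<and>
      h (opp mu) (s mu - i) = h mu i \<and> a mu i + m mu i + k + a (opp mu) (s mu - i) = h mu i choose 2"
begin

text \<open>Local chain \<open>i\<close> of \<open>mu\<close> is run \<open>i - 1\<close>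
  followed by the left block of run \<open>i\<close>. At the two ends one of the pieces is
  missing: chain 0 is a singleton, and chain \<open>s mu + 1\<close> is the tail.\<close>

definition chain :: "partition \<Rightarrow> nat \<Rightarrow> partition set" where
  "chain mu i = (if i = 0 then {} else run mu (i - 1)) \<union> (if i \<le> s mu then left mu i else {})"

lemma chain_0: "chain mu 0 = left mu 0"
  and chain_Suc: "i < s mu \<Longrightarrow> chain mu (Suc i) = run mu i \<union> left mu (Suc i)"
  and chain_last: "mu \<in> Par k \<Longrightarrow> chain mu (Suc (s mu)) = tail mu"
  by (auto simp: chain_def last_run)

text \<open>Everything about intersections follows from this: a member of a left block lies in
  the two chains that meet there, any other partition in one chain only.\<close>

lemma mem_chain:
  assumes "mu \<in> Par k" "i \<le> s mu" "g \<in> run mu i" "la \<in> Par k" "j \<le> Suc (s la)"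
  shows "g \<in> chain la j \<longleftrightarrow> la = mu \<and> (j = Suc i \<or> j = i \<and> g \<in> left mu i)"
proof
  assume "g \<in> chain la j"
  then consider "0 < j" "g \<in> run la (j - 1)" | "j \<le> s la" "g \<in> left la j"
    by (auto simp: chain_def split: if_splits)
  then show "la = mu \<and> (j = Suc i \<or> j = i \<and> g \<in> left mu i)"
  proof cases
    case 1
    then have "j - 1 \<le> s la" using assms(5) by simp
    then show ?thesis using disjoint[OF assms(1-4) _ 1(2)] 1(1) by auto
  next
    case 2
    then have "g \<in> run la j" using left_subset[OF assms(4)] by blast
    then show ?thesis using disjoint[OF assms(1-4) 2(1)] 2(2) by auto
  qed
next
  assume "la = mu \<and> (j = Suc i \<or> j = i \<and> g \<in> left mu i)"
  then show "g \<in> chain la j" using assms by (auto simp: chain_def)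
qed

lemma left_nonempty: "mu \<in> Par k \<Longrightarrow> i \<le> s mu \<Longrightarrow> \<exists>g\<in>run mu i. g \<in> left mu i"
proof (cases "i = s mu")
  case True
  assume "mu \<in> Par k"
  then show ?thesis using True last_left last_run TI_in_tail by auto
next
  case False
  assume mu: "mu \<in> Par k" "i \<le> s mu"
  then have i: "i < s mu" using False by simp
  from ordinary[OF mu(1) i] obtain f
    where S: "run mu i \<union> left mu (Suc i) = f ` {a mu i..a mu (Suc i) + m mu (Suc i)}"
      and d: "\<forall>j\<in>{a mu i..a mu (Suc i) + m mu (Suc i)}. dinv (f j) = j"
      and lt: "a mu i + m mu i + 1 < a mu (Suc i)"
    unfolding ordinary_chain_def by blast
  have "f (a mu i) \<in> run mu i \<union> left mu (Suc i)" "dinv (f (a mu i)) = a mu i" using S d lt by auto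
  moreover have "f (a mu i) \<notin> left mu (Suc i)"
    using left_dinv[OF mu(1), of "Suc i" "f (a mu i)"] left_subset[OF mu(1), of "Suc i"] i lt
      \<open>dinv (f (a mu i)) = a mu i\<close> by auto
  ultimately show ?thesis using left_dinv[OF mu, of "f (a mu i)"] by auto
qed

lemma mid_nonempty: "mu \<in> Par k \<Longrightarrow> i \<le> s mu \<Longrightarrow> \<exists>g\<in>run mu i. g \<notin> left mu i"
proof (cases "i = s mu")
  case True
  assume "mu \<in> Par k"
  moreover have "tail mu \<noteq> {TI mu}" by (rule tail_not_singleton)
  ultimately show ?thesis using True last_left last_run TI_in_tail by blast
next
  case False
  assume mu: "mu \<in> Par k" "i \<le> s mu"
  then have i: "i < s mu" using False by simp
  from ordinary[OF mu(1) i] obtain f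
    where S: "run mu i \<union> left mu (Suc i) = f ` {a mu i..a mu (Suc i) + m mu (Suc i)}"
      and d: "\<forall>j\<in>{a mu i..a mu (Suc i) + m mu (Suc i)}. dinv (f j) = j"
      and lt: "a mu i + m mu i + 1 < a mu (Suc i)"
    unfolding ordinary_chain_def by blast
  let ?j = "a mu i + m mu i + 1"
  have "f ?j \<in> run mu i \<union> left mu (Suc i)" "dinv (f ?j) = ?j" using S d lt by auto
  moreover have "f ?j \<notin> left mu (Suc i)"
    using left_dinv[OF mu(1), of "Suc i" "f ?j"] left_subset[OF mu(1), of "Suc i"] i lt
      \<open>dinv (f ?j) = ?j\<close> by auto
  ultimately show ?thesis using left_dinv[OF mu, of "f ?j"] by auto
qed

lemma chain_meet:
  assumes "mu \<in> Par k" "i \<le> Suc (s mu)" "la \<in> Par k" "j \<le> Suc (s la)"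
  shows "chain mu i \<inter> chain la j \<noteq> {} \<longleftrightarrow> mu = la \<and> (i = j \<or> i = Suc j \<or> j = Suc i)"
proof
  assume "chain mu i \<inter> chain la j \<noteq> {}"
  then obtain g where g: "g \<in> chain mu i" "g \<in> chain la j" by blast
  obtain l where l: "l \<le> s mu" "g \<in> run mu l"
  proof -
    from g(1) consider "0 < i" "g \<in> run mu (i - 1)" | "i \<le> s mu" "g \<in> left mu i"
      by (auto simp: chain_def split: if_splits)
    then show ?thesis
    proof cases
      case 1 then show ?thesis using that[of "i - 1"] assms(2) by simp
    next
      case 2 then show ?thesis using that[of i] left_subset[OF assms(1)] by blast
    qed
  qed
  show "mu = la \<and> (i = j \<or> i = Suc j \<or> j = Suc i)"
    using mem_chain[OF assms(1) l assms(1,2)] mem_chain[OF assms(1) l assms(3,4)] g by auto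
next
  assume *: "mu = la \<and> (i = j \<or> i = Suc j \<or> j = Suc i)"
  have next_meet: "chain mu l \<inter> chain mu (Suc l) \<noteq> {}" if l: "l \<le> s mu" for l
  proof -
    obtain g where "g \<in> run mu l" "g \<in> left mu l" using left_nonempty[OF assms(1) l] by blast
    then show ?thesis using l by (auto simp: chain_def)
  qed
  from * consider "la = mu" "i = j" | "la = mu" "i = Suc j" | "la = mu" "j = Suc i" by blast
  then show "chain mu i \<inter> chain la j \<noteq> {}"
  proof cases
    case 1
    have "chain mu i \<noteq> {}"
      using next_meet[of i] next_meet[of "i - 1"] assms(2) by (cases i) auto
    then show ?thesis using 1 by simp
  next
    case 2
    then show ?thesis using next_meet[of j] assms(2) by (simp add: Int_commute)
  next
    case 3
    then show ?thesis using next_meet[of i] assms(4) by simp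
  qed
qed

text \<open>Neighbouring chains differ because the later one contains middle elements.\<close>

lemma chain_inj:
  assumes "mu \<in> Par k" "i \<le> Suc (s mu)" "la \<in> Par k" "j \<le> Suc (s la)" "chain mu i = chain la j"
  shows "mu = la \<and> i = j"
proof -
  have ne: "chain mu i \<noteq> {}" using chain_meet[OF assms(1,2,1,2)] by simp
  then have eq: "mu = la" using chain_meet[OF assms(1-4)] assms(5) by auto
  have "i \<noteq> Suc j" "j \<noteq> Suc i"
  proof -
    have *: "chain mu (Suc l) \<noteq> chain mu l" if l: "l \<le> s mu" for l
    proof -
      obtain g where "g \<in> run mu l" "g \<notin> left mu l" using mid_nonempty[OF assms(1) l] by blast
      then have "g \<in> chain mu (Suc l)" "g \<notin> chain mu l"
        using mem_chain[OF assms(1) l _ assms(1)] l by auto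
      then show ?thesis by blast
    qed
    show "i \<noteq> Suc j" "j \<noteq> Suc i" using *[of i] *[of j] assms eq by auto
  qed
  then show ?thesis using chain_meet[OF assms(1-4)] assms(5) ne by auto
qed


lemma parts:
  assumes mu: "mu \<in> Par k" and i: "i \<le> s mu"
  shows "left_part k (chain mu (Suc i)) = left mu i"
    "mid_part k (chain mu (Suc i)) = run mu i - left mu i"
    "right_part k (chain mu i) = left mu i"
proof -
  have ord: "left_part k (chain mu (Suc l)) = left mu l \<and>
    mid_part k (chain mu (Suc l)) = run mu l - left mu l \<and>
    right_part k (chain mu (Suc l)) = left mu (Suc l)" if l: "l < s mu" for l
  proof -
    note o = ordinary[OF mu l, folded chain_Suc[OF l]]
    have lt: "a mu l + m mu l + 1 < a mu (Suc l)" using o by (simp add: ordinary_chain_def)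
    have A: "g \<in> run mu l \<Longrightarrow> a mu l \<le> dinv g \<and> dinv g < a mu (Suc l) \<and> (g \<in> left mu l \<longleftrightarrow> dinv g \<le> a mu l + m mu l)" for g
      using left_dinv[OF mu, of l g] run_dinv[OF mu l] l by auto
    have B: "g \<in> left mu (Suc l) \<Longrightarrow> a mu (Suc l) \<le> dinv g \<and> dinv g \<le> a mu (Suc l) + m mu (Suc l)" for g
      using left_dinv[OF mu, of "Suc l" g] left_subset[OF mu, of "Suc l"] l by auto
    have C: "g \<in> left mu l \<Longrightarrow> g \<in> run mu l" for g using left_subset[OF mu, of l] l by auto
    show ?thesis
      unfolding parts_of_ordinary[OF o] unfolding chain_Suc[OF l]
    proof (intro conjI set_eqI)
      fix g
      note facts = A[of g] B[of g] C[of g] lt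
      show "g \<in> {g \<in> run mu l \<union> left mu (Suc l). a mu l \<le> dinv g \<and> dinv g \<le> a mu l + m mu l}
          \<longleftrightarrow> g \<in> left mu l"
        using facts by auto
      show "g \<in> {g \<in> run mu l \<union> left mu (Suc l). a mu l + m mu l < dinv g \<and> dinv g < a mu (Suc l)}
          \<longleftrightarrow> g \<in> run mu l - left mu l"
        using facts by auto
      show "g \<in> {g \<in> run mu l \<union> left mu (Suc l). a mu (Suc l) \<le> dinv g \<and>
            dinv g \<le> a mu (Suc l) + m mu (Suc l)} \<longleftrightarrow> g \<in> left mu (Suc l)"
        using facts by auto
    qed
  qed
  have "left_part k (chain mu (Suc i)) = left mu i \<and> mid_part k (chain mu (Suc i)) = run mu i - left mu i"
  proof (cases "i = s mu")
    case True
    then show ?thesis using parts_of_tail[OF mu] chain_last[OF mu] last_run[OF mu] last_left[OF mu] by simp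
  next
    case False
    then show ?thesis using ord i by simp
  qed
  then show "left_part k (chain mu (Suc i)) = left mu i"
    "mid_part k (chain mu (Suc i)) = run mu i - left mu i" by auto
  show "right_part k (chain mu i) = left mu i"
  proof (cases i)
    case 0
    then show ?thesis using first_left[OF mu] parts_of_singleton chain_0 by auto
  next
    case (Suc l)
    then show ?thesis using ord[of l] i by simp
  qed
qed

lemma parts_first: "mu \<in> Par k \<Longrightarrow> left_part k (chain mu 0) = {} \<and> mid_part k (chain mu 0) = {}"
  using first_left parts_of_singleton chain_0 by metis

definition "positions = {(mu, i). mu \<in> Par k \<and> i \<le> Suc (s mu)}"

definition "all_chains = {chain mu i |mu i. mu \<in> Par k \<and> i \<le> Suc (s mu)}"

definition "star S = (case inv_into positions (\<lambda>(mu, i). chain mu i) S of (mu, i) \<Rightarrow> chain (opp mu) (Suc (s mu) - i))"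

lemma star_chain:
  assumes "mu \<in> Par k" "i \<le> Suc (s mu)"
  shows "star (chain mu i) = chain (opp mu) (Suc (s mu) - i)"
proof -
  have "inj_on (\<lambda>(mu, i). chain mu i) positions"
    using chain_inj by (auto simp: inj_on_def positions_def)
  from inv_into_f_f[OF this, of "(mu, i)"] show ?thesis
    using assms by (simp add: star_def positions_def)
qed

lemma chain_opposite:
  assumes mu: "mu \<in> Par k" and i: "i \<le> Suc (s mu)"
  shows "locally_opposite k (chain mu i) (chain (opp mu) (Suc (s mu) - i))"
proof -
  have tail_first: "opposite_tail_singleton k (tail (opp la)) (chain la 0)" if "la \<in> Par k" for la
    using first_left[OF that] opp_Par[OF that] chain_0 unfolding opposite_tail_singleton_def by metis
  consider "i = 0" | "i = Suc (s mu)" | l where "i = Suc l" "l < s mu"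
    using i by (cases i) (auto simp: less_Suc_eq_le le_less)
  then show ?thesis
  proof cases
    case 1
    then have "chain (opp mu) (Suc (s mu) - i) = tail (opp mu)"
      using chain_last[OF opp_Par[OF mu]] s_opp[OF mu] by simp
    then show ?thesis using tail_first[OF mu] 1 by (simp add: locally_opposite_def)
  next
    case 2
    then have "chain mu i = tail (opp (opp mu))" using chain_last[OF mu] opp_opp[OF mu] by simp
    then show ?thesis using tail_first[OF opp_Par[OF mu]] 2 by (simp add: locally_opposite_def)
  next
    case 3
    let ?l = "s mu - Suc l"
    have l: "?l < s (opp mu)" "Suc ?l = s mu - l" "Suc (s mu) - i = Suc ?l" using 3 s_opp[OF mu] by auto
    note o1 = ordinary[OF mu 3(2), folded chain_Suc[OF 3(2)]]
    note o2 = ordinary[OF opp_Par[OF mu] l(1), folded chain_Suc[OF l(1)]]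
    have "opposite_ordinary k (chain mu i) (chain (opp mu) (Suc ?l))"
      unfolding opposite_ordinary_def 3(1)
      by (intro exI conjI, rule o1, rule o2)
        (use opposite[OF mu, of l] opposite[OF mu, of "Suc l"] 3(2) l(2) in \<open>auto simp: Suc_leI\<close>)
    then show ?thesis using l by (simp add: locally_opposite_def)
  qed
qed

theorem conclusion:
  "(\<forall>S\<in>all_chains. local_chain k S) \<and>
    (\<forall>S\<in>all_chains. star S \<in> all_chains \<and> star (star S) = S) \<and>
    (\<forall>mu\<in>Par k. tail mu \<in> all_chains) \<and>
    (\<forall>S\<in>all_chains. \<forall>T\<in>all_chains. S \<noteq> T \<longrightarrow>
       S \<inter> T = {} \<or> right_part k S = left_part k T \<or> right_part k T = left_part k S) \<and>
    (\<forall>g\<in>Def k.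
       (\<exists>S. {U\<in>all_chains. g \<in> U} = {S} \<and> g \<in> mid_part k S) \<or>
       (\<exists>S T. S \<noteq> T \<and> {U\<in>all_chains. g \<in> U} = {S, T} \<and>
              g \<in> right_part k S \<and> g \<in> left_part k T)) \<and>
    (\<forall>S\<in>all_chains. locally_opposite k S (star S)) \<and>
    (\<forall>S\<in>all_chains. \<forall>T\<in>all_chains. S \<inter> T \<noteq> {} \<longrightarrow> star S \<inter> star T \<noteq> {}) \<and>
    (\<forall>S\<in>all_chains. \<exists>G\<subseteq>Collect is_partition.
       left_part k S \<union> mid_part k S = (\<Union>g\<in>G. nu_segment g))"
proof (intro conjI ballI impI)
  fix S assume "S \<in> all_chains"
  then obtain mu i where mu: "mu \<in> Par k" and i: "i \<le> Suc (s mu)" and S: "S = chain mu i"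
    by (auto simp: all_chains_def)
  have opp: "opp mu \<in> Par k" "Suc (s mu) - i \<le> Suc (s (opp mu))"
    using opp_Par[OF mu] s_opp[OF mu] by auto
  show "local_chain k S"
  proof -
    consider "i = 0" | "i = Suc (s mu)" | l where "i = Suc l" "l < s mu"
      using i by (cases i) (auto simp: less_Suc_eq_le le_less)
    then show ?thesis
    proof cases
      case 1
      then show ?thesis using first_left[OF mu] chain_0 S
        unfolding local_chain_def is_exceptional_def by metis
    next
      case 2
      then show ?thesis using chain_last[OF mu] mu S
        unfolding local_chain_def is_exceptional_def by metis
    next
      case 3
      then show ?thesis using ordinary[OF mu 3(2)] chain_Suc[OF 3(2)] S
        unfolding local_chain_def is_ordinary_def by metis
    qed
  qed
  show "star S \<in> all_chains"
    unfolding S star_chain[OF mu i] all_chains_def using opp by blast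
  show "star (star S) = S"
    unfolding S star_chain[OF mu i] star_chain[OF opp] using i by (simp add: opp_opp[OF mu] s_opp[OF mu])
  show "locally_opposite k S (star S)"
    unfolding S star_chain[OF mu i] by (rule chain_opposite[OF mu i])
  show "\<exists>G\<subseteq>Collect is_partition. left_part k S \<union> mid_part k S = (\<Union>g\<in>G. nu_segment g)"
  proof (cases i)
    case 0
    then show ?thesis using parts_first[OF mu] S by (intro exI[of _ "{}"]) simp
  next
    case (Suc l)
    then have l: "l \<le> s mu" using i by simp
    have "left_part k S \<union> mid_part k S = run mu l"
      unfolding S Suc parts[OF mu l] using left_subset[OF mu l] by blast
    moreover obtain G where "G \<subseteq> Def k" "run mu l = (\<Union>g\<in>G. nu_segment g)"
      using segments[OF mu l] by blast
    moreover have "Def k \<subseteq> Collect is_partition" by (auto simp: Def_def)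
    ultimately show ?thesis by (intro exI[of _ G]) auto
  qed
next
  fix mu assume "mu \<in> Par k"
  then show "tail mu \<in> all_chains" using chain_last unfolding all_chains_def by blast
next
  fix S T assume "S \<in> all_chains" "T \<in> all_chains"
  then obtain mu i la j where mu: "mu \<in> Par k" and i: "i \<le> Suc (s mu)" and S: "S = chain mu i"
    and la: "la \<in> Par k" and j: "j \<le> Suc (s la)" and T: "T = chain la j"
    by (auto simp: all_chains_def)
  note meet = chain_meet[OF mu i la j, folded S T]
  show "S \<inter> T = {} \<or> right_part k S = left_part k T \<or> right_part k T = left_part k S" if ne: "S \<noteq> T"
  proof (cases "S \<inter> T = {}")
    case False
    then consider "mu = la" "j = Suc i" | "mu = la" "i = Suc j" using meet ne S T by blast
    then show ?thesis
    proof cases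
      case 1
      then have "i \<le> s mu" using j by simp
      then show ?thesis using parts[OF mu] 1 S T by simp
    next
      case 2
      then have "j \<le> s mu" using i by simp
      then show ?thesis using parts[OF mu] 2 S T by simp
    qed
  qed simp
  show "star S \<inter> star T \<noteq> {}" if "S \<inter> T \<noteq> {}"
  proof -
    have eq: "mu = la" "i = j \<or> i = Suc j \<or> j = Suc i" using that meet by auto
    have "Suc (s mu) - i \<le> Suc (s (opp mu))" "Suc (s mu) - j \<le> Suc (s (opp mu))"
      using s_opp[OF mu] by auto
    note m = chain_meet[OF opp_Par[OF mu] this(1) opp_Par[OF mu] this(2)]
    have "star S = chain (opp mu) (Suc (s mu) - i)" "star T = chain (opp mu) (Suc (s mu) - j)"
      using star_chain[OF mu i] star_chain[OF la j] S T eq(1) by simp_all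
    then show ?thesis using m eq i j by auto
  qed
next
  fix g assume "g \<in> Def k"
  then obtain mu i where mu: "mu \<in> Par k" and i: "i \<le> s mu" and g: "g \<in> run mu i" using cover by blast
  have mem: "U \<in> all_chains \<and> g \<in> U \<longleftrightarrow> U = chain mu (Suc i) \<or> U = chain mu i \<and> g \<in> left mu i" for U
  proof
    assume "U \<in> all_chains \<and> g \<in> U"
    then show "U = chain mu (Suc i) \<or> U = chain mu i \<and> g \<in> left mu i"
      using mem_chain[OF mu i g] by (auto simp: all_chains_def)
  next
    assume U: "U = chain mu (Suc i) \<or> U = chain mu i \<and> g \<in> left mu i"
    have "chain mu (Suc i) \<in> all_chains" "chain mu i \<in> all_chains"
      using mu i unfolding all_chains_def by (blast intro: le_SucI Suc_le_mono[THEN iffD2])+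
    then show "U \<in> all_chains \<and> g \<in> U"
      using U mem_chain[OF mu i g mu] i by auto
  qed
  show "(\<exists>S. {U\<in>all_chains. g \<in> U} = {S} \<and> g \<in> mid_part k S) \<or>
       (\<exists>S T. S \<noteq> T \<and> {U\<in>all_chains. g \<in> U} = {S, T} \<and> g \<in> right_part k S \<and> g \<in> left_part k T)"
  proof (cases "g \<in> left mu i")
    case True
    have "chain mu i \<noteq> chain mu (Suc i)" using chain_inj[OF mu _ mu, of i "Suc i"] i by auto
    moreover have "{U\<in>all_chains. g \<in> U} = {chain mu i, chain mu (Suc i)}"
      unfolding mem using True by auto
    moreover have "g \<in> right_part k (chain mu i)" "g \<in> left_part k (chain mu (Suc i))"
      using True parts[OF mu i] by simp_all
    ultimately show ?thesis by (intro disjI2 exI conjI)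
  next
    case False
    then have "{U\<in>all_chains. g \<in> U} = {chain mu (Suc i)}" unfolding mem by auto
    moreover have "g \<in> mid_part k (chain mu (Suc i))" using False g parts[OF mu i] by simp
    ultimately show ?thesis by (intro disjI1 exI conjI)
  qed
qed

end


section \<open>Tables of chains and their verification\<close>

text \<open>An entry \<open>(mu, mu', Rs)\<close> describes the runs of \<open>mu\<close> other
  than its tail, each by the generators of its \<open>nu\<close>-segments, and names the
  partition \<open>mu'\<close> opposite to \<open>mu\<close>.\<close>

type_synonym chain_data = "partition \<times> partition \<times> partition list list"

fun partitions_upto :: "nat \<Rightarrow> nat \<Rightarrow> partition list" where
  "partitions_upto n m = (if n = 0 then [[]] else
     concat (map (\<lambda>i. map ((#) i) (partitions_upto (n - i) i)) (rev [1..<Suc (min n m)])))"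

declare partitions_upto.simps [simp del]

definition consecutive :: "partition list \<Rightarrow> partition list \<Rightarrow> bool" where
  "consecutive X Y \<longleftrightarrow> ends X \<and> sum_list (hd Y) = sum_list (hd X) + length X"

text \<open>Fifty steps exceed the length of every finite segment that occurs.\<close>

definition chain_orbits :: "partition list list \<Rightarrow> partition \<Rightarrow> partition list list list" where
  "chain_orbits Rs mu = map (map (orbit 50)) Rs @ [[[TI mu]]]"

definition block_type :: "nat \<Rightarrow> partition list \<Rightarrow> nat \<times> nat \<times> nat" where
  "block_type k X = (sum_list (hd X) - k, length (left_block X) - 1, min_level (hd X))"

text \<open>The first condition concerns segments, the second one runs.\<close>

definition well_linked :: "partition list list list \<Rightarrow> bool" where
  "well_linked S \<longleftrightarrow> successively consecutive (concat S) \<and> successively link (map concat S)"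

type_synonym chain_summary = "partition \<times> partition \<times> bool \<times> (nat \<times> nat \<times> nat) list"

definition summary :: "nat \<Rightarrow> chain_data \<Rightarrow> chain_summary" where
  "summary k = (\<lambda>(mu, mu', Rs). let S = chain_orbits Rs mu in
     (mu, mu', well_linked S, map (block_type k \<circ> concat) S))"

text \<open>The sum of the numbers below \<open>h\<close> is \<open>h choose 2\<close>.\<close>

definition opposite_types :: "nat \<Rightarrow> nat \<times> nat \<times> nat \<Rightarrow> nat \<times> nat \<times> nat \<Rightarrow> bool" where
  "opposite_types k = (\<lambda>(a, m, h) (b, n, e). n = m \<and> e = h \<and> a + m + k + b = sum_list [0..<h])"

text \<open>The starting block of \<open>mu\<close> has to be the singleton that is opposite to
  the tail of \<open>mu'\<close>; the reversal matches the blocks of the two sequences.\<close>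

definition opposite_ok :: "nat \<Rightarrow> chain_summary list \<Rightarrow> chain_summary \<Rightarrow> bool" where
  "opposite_ok k T = (\<lambda>(mu, mu', ok, ts). ok \<and>
     hd ts = (length mu', 0, min_level (TI mu')) \<and>
     (case map_of T mu' of None \<Rightarrow> False
      | Some (mu'', ok', ts') \<Rightarrow> mu'' = mu \<and> list_all2 (opposite_types k) ts (rev ts')))"

lemma opposite_ok_iff:
  "opposite_ok k T (mu, mu', ok, ts) \<longleftrightarrow> ok \<and> hd ts = (length mu', 0, min_level (TI mu')) \<and>
    (\<exists>ok' ts'. map_of T mu' = Some (mu, ok', ts') \<and> list_all2 (opposite_types k) ts (rev ts'))"
  by (auto simp: opposite_ok_def split: option.splits)

definition certificate :: "nat \<Rightarrow> chain_data list \<Rightarrow> bool" where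
  "certificate k D \<longleftrightarrow> map fst D = partitions_upto k k \<and> distinct (map fst D) \<and>
     (let T = map (summary k) D in list_all (opposite_ok k T) T)"

fun lex_le :: "nat list \<Rightarrow> nat list \<Rightarrow> bool" where
  "lex_le [] ys = True"
| "lex_le (x # xs) [] = False"
| "lex_le (x # xs) (y # ys) = (if x = y then lex_le xs ys else x < y)"

text \<open>The outcome of the comparison is an argument of \<open>merge_step\<close> instead of
  a condition: rewriting then selects a branch by its equation and leaves the long lists, which
  are already in normal form, untouched.\<close>

function merge :: "nat list list \<Rightarrow> nat list list \<Rightarrow> nat list list"
  and merge_step :: "bool \<Rightarrow> nat list \<Rightarrow> nat list list \<Rightarrow> nat list \<Rightarrow> nat list list \<Rightarrow> nat list list" where
  "merge [] ys = ys"
| "merge (x # xs) [] = x # xs"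
| "merge (x # xs) (y # ys) = merge_step (lex_le x y) x xs y ys"
| "merge_step True x xs y ys = x # merge xs (y # ys)"
| "merge_step False x xs y ys = y # merge (x # xs) ys"
  by pat_completeness auto
termination
  by (relation "measure (case_sum (\<lambda>(xs, ys). 2 * (length xs + length ys))
    (\<lambda>(b, x, xs, y, ys). 2 * (length xs + length ys) + 3))") auto

fun merge_pairs :: "nat list list list \<Rightarrow> nat list list list" where
  "merge_pairs [] = []"
| "merge_pairs [x] = [x]"
| "merge_pairs (x # y # zs) = merge x y # merge_pairs zs"

lemma length_merge_pairs: "length (merge_pairs xs) \<le> length xs"
  by (induction xs rule: merge_pairs.induct) auto

function merge_all :: "nat list list list \<Rightarrow> nat list list" where
  "merge_all [] = []"
| "merge_all [x] = x"
| "merge_all (x # y # zs) = merge_all (merge_pairs (x # y # zs))"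
  by pat_completeness auto
termination
  by (relation "measure length") (auto simp: less_Suc_eq_le length_merge_pairs)

definition generators :: "chain_data list \<Rightarrow> partition list" where
  "generators D = concat (map (\<lambda>(mu, mu', Rs). concat (Rs @ [[TI mu]])) D)"

text \<open>The generators used by the table are exactly the initial partitions. The search
  yields them in the lexicographic order of the reversed lists, because rows are added on top in
  increasing order, so only the generators are sorted. Strict increase shows that none occurs
  twice.\<close>

definition complete :: "nat \<Rightarrow> chain_data list \<Rightarrow> bool" where
  "complete k D \<longleftrightarrow> (let I = map rev (initials k 0 []) in
     merge_all (map (\<lambda>g. [rev g]) (generators D)) = I \<and> successively (<) I)"

lemma merge_set_length:
  "set (merge xs ys) = set xs \<union> set ys \<and> length (merge xs ys) = length xs + length ys"
  "set (merge_step b x xs y ys) = set (x # xs) \<union> set (y # ys) \<and>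
    length (merge_step b x xs y ys) = length (x # xs) + length (y # ys)"
  by (induction xs ys and b x xs y ys rule: merge_merge_step.induct) auto

lemma merge_pairs_set_length:
  "set (concat (merge_pairs xss)) = set (concat xss) \<and>
    length (concat (merge_pairs xss)) = length (concat xss)"
  by (induction xss rule: merge_pairs.induct) (simp_all add: merge_set_length Un_assoc)

lemma merge_all_set_length:
  "set (merge_all xss) = set (concat xss) \<and> length (merge_all xss) = length (concat xss)"
proof (induction xss rule: merge_all.induct)
  case (3 x y zs)
  then show ?case using merge_pairs_set_length[of "x # y # zs"] by (simp only: merge_all.simps)
qed simp_all

lemma complete_generators:
  assumes "complete k D"
  shows "distinct (generators D)" "set (generators D) = set (initials k 0 [])"
proof -
  let ?G = "generators D" and ?I = "initials k 0 []"
  have concat: "concat (map (\<lambda>g. [rev g]) ?G) = map rev ?G" by (induction ?G) auto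
  have eq: "merge_all (map (\<lambda>g. [rev g]) ?G) = map rev ?I" and lt: "successively (<) (map rev ?I)"
    using assms unfolding complete_def Let_def by blast+
  have set: "set (map rev ?G) = set (map rev ?I)" and len: "length (map rev ?G) = length (map rev ?I)"
    using merge_all_set_length[of "map (\<lambda>g. [rev g]) ?G"] unfolding concat eq by simp_all
  then show "set ?G = set ?I" by (simp add: inj_image_eq_iff)
  have "sorted_wrt (<) (map rev ?I)"
    using lt by (subst successively_conv_sorted_wrt[symmetric]) (auto simp: transp_def)
  then have "distinct (map rev ?I)" by (simp add: strict_sorted_iff)
  then have "card (set (map rev ?G)) = length (map rev ?G)"
    unfolding set len by (rule distinct_card)
  then have "distinct (map rev ?G)" by (rule card_distinct)
  then show "distinct ?G" by (simp add: distinct_map)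
qed

lemma distinct_concat_nth:
  "distinct (concat xss) \<Longrightarrow> i < length xss \<Longrightarrow> j < length xss \<Longrightarrow>
    x \<in> set (xss ! i) \<Longrightarrow> x \<in> set (xss ! j) \<Longrightarrow> i = j"
proof (induction xss arbitrary: i j)
  case (Cons xs xss)
  have "x \<notin> set xs" if "n < length xss" "x \<in> set (xss ! n)" for n
    using Cons.prems(1) that nth_mem[of n xss] by fastforce
  then show ?case using Cons by (cases i; cases j) auto
qed simp

lemma distinct_concat_mem: "distinct (concat xss) \<Longrightarrow> xs \<in> set xss \<Longrightarrow> distinct xs"
  by (induction xss) auto

lemma concat_concat: "concat (concat S) = concat (map concat S)"
  by (induction S) auto

lemma concat_adjacent:
  assumes "Suc i < length B"
  shows "\<exists>A C. concat B = A @ (B ! i @ B ! Suc i) @ C"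
proof -
  have "drop i B = B ! i # B ! Suc i # drop (Suc (Suc i)) B"
    using assms by (simp add: Cons_nth_drop_Suc)
  then have "concat (drop i B) = (B ! i @ B ! Suc i) @ concat (drop (Suc (Suc i)) B)" by simp
  moreover have "concat B = concat (take i B) @ concat (drop i B)"
    by (metis append_take_drop_id concat_append)
  ultimately show ?thesis by metis
qed

lemma set_partitions_upto:
  "set (partitions_upto n m) = {g. is_partition g \<and> sum_list g = n \<and> (\<forall>x\<in>set g. x \<le> m)}"
proof (induction n m rule: partitions_upto.induct)
  case (1 n m)
  show ?case
  proof (cases "n = 0")
    case True
    have "g = []" if "is_partition g" "sum_list g = 0" for g
      using that by (cases g) (auto simp: is_partition_Cons)
    then show ?thesis using True by (auto simp: partitions_upto.simps)
  next
    case False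
    have IH: "set (partitions_upto (n - i) i) = {g. is_partition g \<and> sum_list g = n - i \<and> (\<forall>x\<in>set g. x \<le> i)}"
      if "i \<in> {1..min n m}" for i
      using "1.IH"[OF False, of i] that by (simp del: upt_Suc) auto
    have "set (partitions_upto n m) = (\<Union>i\<in>{1..min n m}. (#) i ` set (partitions_upto (n - i) i))"
      using False by (subst partitions_upto.simps) (auto simp: atLeastLessThanSuc_atLeastAtMost simp del: upt_Suc)
    also have "\<dots> = {g. is_partition g \<and> sum_list g = n \<and> (\<forall>x\<in>set g. x \<le> m)}" (is "?A = ?B")
    proof
      show "?A \<subseteq> ?B" using IH by (fastforce simp: is_partition_Cons)
      show "?B \<subseteq> ?A"
      proof
        fix g assume g: "g \<in> ?B"
        then obtain r t where rt: "g = r # t" using False by (cases g) auto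
        then have "r \<in> {1..min n m}" "t \<in> set (partitions_upto (n - r) r)"
          using g IH[of r] by (auto simp: is_partition_Cons)
        then show "g \<in> ?A" using rt by blast
      qed
    qed
    finally show ?thesis .
  qed
qed

lemma set_partitions_upto_Par: "set (partitions_upto k k) = Par k"
  using member_le_sum_list by (fastforce simp: set_partitions_upto Par_def)

lemma successively_concat:
  "\<forall>X\<in>set Os. X \<noteq> [] \<and> successively P X \<Longrightarrow> successively (\<lambda>X Y. P (last X) (hd Y)) Os \<Longrightarrow>
    successively P (concat Os)"
proof (induction Os)
  case (Cons X Os)
  then have IH: "successively P (concat Os)" by (auto simp: successively_Cons)
  show ?case
  proof (cases Os)
    case (Cons Y Q)
    then have "hd (concat Os) = hd Y" "P (last X) (hd Y)"
      using Cons.prems by auto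
    then show ?thesis using IH Cons.prems by (auto simp: successively_append_iff)
  qed (use Cons.prems in simp)
qed simp

lemma grows_orbit: "is_partition g \<Longrightarrow> successively grows (orbit n g)"
proof (induction n arbitrary: g)
  case (Suc n)
  show ?case
  proof (cases "part g 1 \<le> length g + 2")
    case True
    then have "is_partition (nu g)" using Suc.prems is_partition_nu by (simp add: nu_dom_def)
    then have "successively grows (orbit n (nu g))" by (rule Suc.IH)
    moreover have "grows g (nu g)" using sum_list_nu[OF Suc.prems] by (simp add: grows_def)
    ultimately show ?thesis by (cases n) (auto simp: successively_Cons)
  qed simp
qed simp

lemma sum_upt_choose: "sum_list [0..<h] = h choose 2"
  by (induction h) (auto simp: numeral_2_eq_2)

lemma ends_of_consecutive: "successively consecutive (Os @ [Z]) \<Longrightarrow> X \<in> set Os \<Longrightarrow> ends X"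
  by (induction Os) (auto simp: successively_Cons consecutive_def)

lemma grows_dinv:
  assumes "successively grows X" "set X \<subseteq> Def k" "t < length X"
  shows "dinv (X ! t) = dinv (hd X) + t"
proof -
  have "X \<noteq> []" using assms(3) by auto
  then have "X ! t \<in> Def k" "hd X \<in> Def k" using assms by auto
  then show ?thesis using grows_nth[OF assms(1,3)] size_eq by (fastforce simp: Def_def)
qed

lemma left_block_dinv:
  assumes X: "successively grows X" "set X \<subseteq> Def k" and g: "g \<in> set X"
  shows "dinv (hd X) \<le> dinv g"
    "g \<in> set (left_block X) \<longleftrightarrow> dinv g \<le> dinv (hd X) + (length (left_block X) - 1)"
proof -
  from g obtain t where t: "t < length X" "X ! t = g" unfolding in_set_conv_nth by blast
  have dg: "dinv g = dinv (hd X) + t" using grows_dinv[OF X t(1)] unfolding t(2) .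
  then show "dinv (hd X) \<le> dinv g" by simp
  have "X \<noteq> []" using t(1) by auto
  then have ne: "0 < length (left_block X)" using left_block_Nil_iff by blast
  define p where "p = length (takeWhile (\<lambda>h. h = min_level (hd X)) (map min_level X))"
  have p: "left_block X = take p X" unfolding left_block_def p_def ..
  have "g \<in> set (left_block X) \<longleftrightarrow> t < length (left_block X)"
  proof
    assume "g \<in> set (left_block X)"
    then obtain u where u: "u < length (left_block X)" "left_block X ! u = g"
      unfolding in_set_conv_nth by blast
    then have u': "u < length X" "X ! u = g" by (simp_all add: p)
    then show "t < length (left_block X)"
      using grows_dinv[OF X u'(1)] dg u(1) unfolding u'(2) by linarith
  next
    assume l: "t < length (left_block X)"
    then have "left_block X ! t = g" using t by (simp add: p)
    then show "g \<in> set (left_block X)" using l nth_mem by blast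
  qed
  then show "g \<in> set (left_block X) \<longleftrightarrow> dinv g \<le> dinv (hd X) + (length (left_block X) - 1)"
    using dg ne by linarith
qed

context
  fixes k :: nat and D :: "chain_data list"
  assumes cert: "certificate k D" and comp: "complete k D"
begin

definition opp where "opp mu = fst (the (map_of D mu))"
definition runs where "runs mu = snd (the (map_of D mu))"
definition block where "block mu i = concat (chain_orbits (runs mu) mu ! i)"
definition gens where "gens mu = runs mu @ [[TI mu]]"
definition run where "run mu i = (\<Union>g\<in>set (gens mu ! i). nu_segment g)"

lemma keys: "fst ` set D = Par k" "distinct (map fst D)"
proof -
  have m: "map fst D = partitions_upto k k" and d: "distinct (map fst D)"
    using cert unfolding certificate_def by blast+
  show "fst ` set D = Par k"
    using set_partitions_upto_Par[of k] unfolding m[symmetric] by simp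
  show "distinct (map fst D)" by (rule d)
qed

lemma entry_iff: "(mu, x) \<in> set D \<longleftrightarrow> mu \<in> Par k \<and> x = (opp mu, runs mu)"
proof
  assume e: "(mu, x) \<in> set D"
  then have "map_of D mu = Some x" using keys(2) by simp
  then have "x = (opp mu, runs mu)" by (simp add: opp_def runs_def)
  moreover have "fst (mu, x) \<in> fst ` set D" using e by (rule imageI)
  ultimately show "mu \<in> Par k \<and> x = (opp mu, runs mu)" unfolding keys(1) by simp
next
  assume mu: "mu \<in> Par k \<and> x = (opp mu, runs mu)"
  then obtain e where e: "e \<in> set D" "fst e = mu" using keys(1) by (metis imageE)
  obtain y where y: "e = (mu, y)" using e(2) by (cases e) auto
  have "map_of D mu = Some y" using keys(2) e(1) y by simp
  then have "x = y" using mu by (simp add: opp_def runs_def)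
  then show "(mu, x) \<in> set D" using e(1) y by simp
qed

definition types where "types mu = map (block_type k \<circ> concat) (chain_orbits (runs mu) mu)"

lemma summary_iff: "(mu, y) \<in> set (map (summary k) D) \<longleftrightarrow>
    mu \<in> Par k \<and> y = (opp mu, well_linked (chain_orbits (runs mu) mu), types mu)"
proof
  assume "(mu, y) \<in> set (map (summary k) D)"
  then obtain e where e: "e \<in> set D" "summary k e = (mu, y)" by auto
  obtain la x where x: "e = (la, x)" by (cases e)
  have "la \<in> Par k" "x = (opp la, runs la)" using entry_iff e(1) x by blast+
  then show "mu \<in> Par k \<and> y = (opp mu, well_linked (chain_orbits (runs mu) mu), types mu)"
    using e(2) x by (auto simp: summary_def types_def Let_def)
next
  assume y: "mu \<in> Par k \<and> y = (opp mu, well_linked (chain_orbits (runs mu) mu), types mu)"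
  then have "(mu, opp mu, runs mu) \<in> set D" using entry_iff by blast
  moreover have "summary k (mu, opp mu, runs mu) = (mu, y)"
    using y by (simp add: summary_def types_def Let_def)
  ultimately show "(mu, y) \<in> set (map (summary k) D)" by (metis image_eqI set_map)
qed

lemma map_of_summary:
  "map_of (map (summary k) D) mu = Some y \<longleftrightarrow> (mu, y) \<in> set (map (summary k) D)"
proof (rule map_of_eq_Some_iff)
  have "fst \<circ> summary k = fst"
    by (auto simp: summary_def Let_def)
  then have "map fst (map (summary k) D) = map fst D" by simp
  then show "distinct (map fst (map (summary k) D))" using keys(2) by metis
qed

lemma checked:
  assumes "mu \<in> Par k"
  shows "opp mu \<in> Par k" "opp (opp mu) = mu" "well_linked (chain_orbits (runs mu) mu)"
    "hd (types mu) = (length (opp mu), 0, min_level (TI (opp mu)))"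
    "list_all2 (opposite_types k) (types mu) (rev (types (opp mu)))"
proof -
  let ?T = "map (summary k) D" and ?ok = "\<lambda>mu. well_linked (chain_orbits (runs mu) mu)"
  have "(mu, opp mu, ?ok mu, types mu) \<in> set ?T"
    unfolding summary_iff using assms by blast
  moreover have "list_all (opposite_ok k ?T) ?T"
    using cert unfolding certificate_def Let_def by blast
  ultimately have "opposite_ok k ?T (mu, opp mu, ?ok mu, types mu)"
    unfolding list_all_iff by (rule bspec[rotated])
  then obtain ok' ts' where ok: "?ok mu" "hd (types mu) = (length (opp mu), 0, min_level (TI (opp mu)))"
    and m: "map_of ?T (opp mu) = Some (mu, ok', ts')"
    and l: "list_all2 (opposite_types k) (types mu) (rev ts')"
    unfolding opposite_ok_iff by blast
  from m have e: "opp mu \<in> Par k \<and> (mu, ok', ts') = (opp (opp mu), ?ok (opp mu), types (opp mu))"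
    unfolding map_of_summary summary_iff .
  show "opp mu \<in> Par k" "opp (opp mu) = mu" "?ok mu"
    "hd (types mu) = (length (opp mu), 0, min_level (TI (opp mu)))"
    "list_all2 (opposite_types k) (types mu) (rev (types (opp mu)))"
    using ok l e by auto
qed

lemma generators_alt:
  "g \<in> set (generators D) \<longleftrightarrow> (\<exists>mu\<in>Par k. \<exists>i\<le>length (runs mu). g \<in> set (gens mu ! i))"
proof -
  have "g \<in> set (generators D) \<longleftrightarrow> (\<exists>mu\<in>Par k. g \<in> set (concat (gens mu)))"
  proof
    assume "g \<in> set (generators D)"
    then obtain e where e: "e \<in> set D" "g \<in> set (case e of (mu, mu', Rs) \<Rightarrow> concat (Rs @ [[TI mu]]))"
      unfolding generators_def set_concat set_map by blast
    obtain mu mu' Rs where x: "e = (mu, mu', Rs)" by (cases e)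
    have "mu \<in> Par k" "Rs = runs mu" using entry_iff e(1) x by blast+
    then show "\<exists>mu\<in>Par k. g \<in> set (concat (gens mu))"
      using e(2) x by (auto simp: gens_def)
  next
    assume "\<exists>mu\<in>Par k. g \<in> set (concat (gens mu))"
    then obtain mu where "(mu, opp mu, runs mu) \<in> set D" "g \<in> set (concat (runs mu @ [[TI mu]]))"
      unfolding gens_def using entry_iff by blast
    then show "g \<in> set (generators D)" unfolding generators_def by fastforce
  qed
  moreover have "g \<in> set (concat (gens mu)) \<longleftrightarrow> (\<exists>i\<le>length (runs mu). g \<in> set (gens mu ! i))" for mu
  proof -
    have "g \<in> set (concat (gens mu)) \<longleftrightarrow> (\<exists>R\<in>set (gens mu). g \<in> set R)" by simp
    also have "\<dots> \<longleftrightarrow> (\<exists>i<length (gens mu). g \<in> set (gens mu ! i))" by (metis in_set_conv_nth)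
    finally show ?thesis by (simp only: gens_def length_append list.size add_0_right add_Suc_right less_Suc_eq_le)
  qed
  ultimately show ?thesis by simp
qed

lemma gens_initial:
  assumes "mu \<in> Par k" "i \<le> length (runs mu)" "g \<in> set (gens mu ! i)"
  shows "is_partition g" "nu_initial g" "g \<in> Def k"
proof -
  have "g \<in> set (generators D)" using assms generators_alt by blast
  then have "g \<in> set (initials k 0 [])" using complete_generators(2)[OF comp] by simp
  then show "is_partition g" "nu_initial g" "g \<in> Def k"
    using initials_sound[of g k 0 "[]"] by (auto simp: Def_def)
qed

text \<open>Distinctness of all generators makes the runs disjoint.\<close>

lemma gens_inj:
  assumes mu: "mu \<in> Par k" "i \<le> length (runs mu)" "g \<in> set (gens mu ! i)"
    and la: "la \<in> Par k" "j \<le> length (runs la)" "g \<in> set (gens la ! j)"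
  shows "mu = la \<and> i = j"
proof -
  let ?f = "\<lambda>(mu, mu', Rs). concat (Rs @ [[TI mu]])"
  have "(mu, opp mu, runs mu) \<in> set D" "(la, opp la, runs la) \<in> set D"
    using mu(1) la(1) entry_iff by simp_all
  then obtain p q where p: "p < length D" "D ! p = (mu, opp mu, runs mu)"
    and q: "q < length D" "D ! q = (la, opp la, runs la)"
    unfolding in_set_conv_nth by blast
  have dist: "distinct (concat (map ?f D))"
    using complete_generators(1)[OF comp] by (simp add: generators_def)
  have mem: "g \<in> set (concat (gens mu))" if "mu \<in> Par k" "i \<le> length (runs mu)" "g \<in> set (gens mu ! i)" for mu i
  proof -
    have "gens mu ! i \<in> set (gens mu)" using that(2) by (intro nth_mem) (simp add: gens_def)
    then show ?thesis using that(3) unfolding set_concat by blast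
  qed
  have "g \<in> set (map ?f D ! p)" "g \<in> set (map ?f D ! q)"
    using p q mem[OF mu] mem[OF la] by (simp_all add: gens_def)
  then have "p = q" using distinct_concat_nth[OF dist, of p q g] p q by simp
  then have eq: "mu = la" using p q by simp
  have "?f (D ! p) \<in> set (map ?f D)" using p(1) by simp
  then have "distinct (?f (D ! p))" using dist distinct_concat_mem by blast
  then have "distinct (concat (gens mu))" using p by (simp add: gens_def)
  from distinct_concat_nth[OF this, of i j g] show ?thesis
    using mu la eq by (simp add: gens_def)
qed

text \<open>What the checks on the table say about the runs as sets and as lists of
  partitions.\<close>

lemma orbits_facts:
  assumes mu: "mu \<in> Par k"
  shows "i < length (runs mu) \<Longrightarrow> set (block mu i) = run mu i"
    "block mu (length (runs mu)) = [TI mu]" "run mu (length (runs mu)) = tail mu"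
    "i < length (runs mu) \<Longrightarrow> successively grows (block mu i @ block mu (Suc i))"
    "i < length (runs mu) \<Longrightarrow> link (block mu i) (block mu (Suc i))"
    "i \<le> length (runs mu) \<Longrightarrow> set (block mu i) \<subseteq> run mu i"
    "i \<le> length (runs mu) \<Longrightarrow> run mu i \<subseteq> Def k"
proof -
  let ?s = "length (runs mu)" and ?S = "chain_orbits (runs mu) mu"
  let ?Os = "concat ?S" and ?F = "concat (map (map (orbit 50)) (runs mu))"
  have Os: "?Os = ?F @ [[TI mu]]" by (simp add: chain_orbits_def)
  have cons: "successively consecutive ?Os" and link: "successively link (map concat ?S)"
    using checked(3)[OF mu] by (auto simp: well_linked_def)
  have len: "length ?S = Suc ?s" by (simp add: chain_orbits_def)
  have blk: "block mu i = map concat ?S ! i" if "i \<le> ?s" for i using that len by (simp add: block_def)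
  have T: "is_partition (TI mu)" "nu_initial (TI mu)" "TI mu \<in> Def k"
    using gens_initial[OF mu, of ?s "TI mu"] by (simp_all add: gens_def nth_append)
  have i_gen: "is_partition g" "nu_initial g" "g \<in> Def k" if "i < ?s" "g \<in> set (runs mu ! i)" for i g
    using gens_initial[OF mu, of i g] that by (simp_all add: gens_def nth_append)
  have ends: "ends (orbit 50 g)" if "i < ?s" "g \<in> set (runs mu ! i)" for i g
  proof -
    have "runs mu ! i \<in> set (runs mu)" using that(1) by simp
    then have "orbit 50 g \<in> set ?F" using that(2) by auto
    then show ?thesis using ends_of_consecutive cons unfolding Os by blast
  qed
  have seg: "set (orbit 50 g) = nu_segment g" if "i < ?s" "g \<in> set (runs mu ! i)" for i g
    using orbit_segment[of g 49] ends[OF that] i_gen[OF that] nu_segment_initial[of g] by simp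
  show 1: "set (block mu i) = run mu i" if "i < ?s" for i
    using that seg[OF that] by (simp add: block_def run_def gens_def chain_orbits_def nth_append)
  show 2: "block mu ?s = [TI mu]" by (simp add: block_def chain_orbits_def nth_append)
  show 3: "run mu ?s = tail mu"
    using tail_eq_segment[OF T(2)] by (simp add: run_def gens_def nth_append)
  show 4: "run mu i \<subseteq> Def k" if "i \<le> ?s" for i
    unfolding run_def using gens_initial[OF mu that] nu_segment_Def by blast
  show "set (block mu i) \<subseteq> run mu i" if "i \<le> ?s" for i
    using 1[of i] 2 3 TI_in_tail that by (cases "i = ?s") auto
  have "successively grows (concat ?Os)"
  proof (rule successively_concat)
    have each: "X \<noteq> [] \<and> successively grows X" if X: "X \<in> set ?Os" for X
    proof -
      have "X = [TI mu] \<or> (\<exists>i g. i < ?s \<and> g \<in> set (runs mu ! i) \<and> X = orbit 50 g)"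
      proof (cases "X = [TI mu]")
        case False
        then obtain R g where "R \<in> set (runs mu)" "g \<in> set R" "X = orbit 50 g"
          using X unfolding Os by auto
        moreover from this obtain i where "i < ?s" "R = runs mu ! i" by (metis in_set_conv_nth)
        ultimately show ?thesis by blast
      qed simp
      then consider "X = [TI mu]" | i g where "i < ?s" "g \<in> set (runs mu ! i)" "X = orbit 50 g"
        by blast
      then show ?thesis
      proof cases
        case 2
        then show ?thesis using grows_orbit[OF i_gen(1)[OF 2(1,2)], of 50] by (simp add: numeral_eq_Suc)
      qed simp
    qed
    then show "\<forall>X\<in>set ?Os. X \<noteq> [] \<and> successively grows X" by blast
    show "successively (\<lambda>X Y. grows (last X) (hd Y)) ?Os"
    proof (rule successively_mono[OF cons])
      fix X Y assume X: "X \<in> set ?Os" and c: "consecutive X Y"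
      have "sum_list (X ! (length X - 1)) = sum_list (hd X) + (length X - 1)"
        using each[OF X] by (intro grows_nth) auto
      then show "grows (last X) (hd Y)"
        using c each[OF X] by (simp add: grows_def consecutive_def last_conv_nth Suc_diff_Suc)
    qed
  qed
  moreover have "concat ?Os = concat (map concat ?S)" by (rule concat_concat)
  ultimately have grow: "successively grows (concat (map concat ?S))" by simp
  show "successively grows (block mu i @ block mu (Suc i))" if i: "i < ?s" for i
  proof -
    obtain A C where AC: "concat (map concat ?S) = A @ (map concat ?S ! i @ map concat ?S ! Suc i) @ C"
      using concat_adjacent[of i "map concat ?S"] i len by auto
    have "successively grows (map concat ?S ! i @ map concat ?S ! Suc i)"
      using grow unfolding AC successively_append_iff by blast
    then show ?thesis using blk[of i] blk[of "Suc i"] i by (simp only: less_imp_le_nat Suc_leI)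
  qed
  show "link (block mu i) (block mu (Suc i))" if i: "i < ?s" for i
  proof -
    have "link (map concat ?S ! i) (map concat ?S ! Suc i)"
    proof -
      have "Suc i < length ?S" using i len by simp
      then show ?thesis using link unfolding successively_conv_nth length_map by blast
    qed
    then show ?thesis using blk[of i] blk[of "Suc i"] i by (simp only: less_imp_le_nat Suc_leI)
  qed
qed

definition left where "left mu i = set (left_block (block mu i))"

lemma block_nonempty: "mu \<in> Par k \<Longrightarrow> i \<le> length (runs mu) \<Longrightarrow> block mu i \<noteq> []"
  using orbits_facts(5)[of mu i] orbits_facts(2)[of mu]
  by (cases "i = length (runs mu)") (auto simp: link_def Let_def left_block_def)

lemma types_nth:
  assumes mu: "mu \<in> Par k" and i: "i \<le> length (runs mu)"
  shows "types mu ! i = (dinv (hd (block mu i)), length (left_block (block mu i)) - 1, min_level (hd (block mu i)))"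
proof -
  have "hd (block mu i) \<in> Def k"
    using orbits_facts(6,7)[OF mu i] block_nonempty[OF mu i] hd_in_set by blast
  then have "sum_list (hd (block mu i)) - k = dinv (hd (block mu i))"
    using size_eq by (simp add: Def_def)
  moreover have "i < length (chain_orbits (runs mu) mu)" using i by (simp add: chain_orbits_def)
  ultimately show ?thesis by (simp add: types_def block_type_def block_def)
qed

lemma length_types: "length (types mu) = Suc (length (runs mu))"
  by (simp add: types_def chain_orbits_def)

lemma same_length: "mu \<in> Par k \<Longrightarrow> length (runs (opp mu)) = length (runs mu)"
  using list_all2_lengthD[OF checked(5)] length_types by fastforce

lemma left_last: "mu \<in> Par k \<Longrightarrow> left mu (length (runs mu)) = {TI mu}"
  by (simp add: left_def orbits_facts(2) left_block_def)

interpretation chain_system k opp "\<lambda>mu. length (runs mu)" run left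
  "\<lambda>mu i. dinv (hd (block mu i))" "\<lambda>mu i. length (left_block (block mu i)) - 1"
  "\<lambda>mu i. min_level (hd (block mu i))"
proof
  fix mu i assume mu: "mu \<in> Par k"
  show "opp mu \<in> Par k" "opp (opp mu) = mu" using checked[OF mu] by simp_all
  show "length (runs (opp mu)) = length (runs mu)" by (rule same_length[OF mu])
  show "run mu (length (runs mu)) = tail mu" by (rule orbits_facts(3)[OF mu])
  show "left mu (length (runs mu)) = {TI mu}" by (rule left_last[OF mu])
  show "\<exists>g\<in>Def k. left mu 0 = {g} \<and> dinv g = length (opp mu) \<and> min_Delta g = min_Delta (TI (opp mu))"
  proof -
    let ?g = "hd (block mu 0)"
    have ne: "block mu 0 \<noteq> []" using block_nonempty[OF mu] by simp
    have "?g \<in> Def k" using orbits_facts(6,7)[OF mu, of 0] ne hd_in_set by blast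
    moreover have t: "dinv ?g = length (opp mu)" "length (left_block (block mu 0)) - 1 = 0"
      "min_level ?g = min_level (TI (opp mu))"
    proof -
      have "types mu \<noteq> []" using length_types[of mu] by auto
      then have "hd (types mu) = types mu ! 0" by (rule hd_conv_nth)
      then show "dinv ?g = length (opp mu)" "length (left_block (block mu 0)) - 1 = 0"
        "min_level ?g = min_level (TI (opp mu))"
        using checked(4)[OF mu] types_nth[OF mu, of 0] by simp_all
    qed
    moreover have "left mu 0 = {?g}"
    proof -
      have "length (left_block (block mu 0)) = 1"
        using t(2) ne left_block_Nil_iff[of "block mu 0"] by (cases "left_block (block mu 0)") auto
      then obtain x where "left_block (block mu 0) = [x]" by (metis One_nat_def length_0_conv length_Suc_conv)
      then show ?thesis using hd_left_block[OF ne] by (simp add: left_def)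
    qed
    moreover have "is_partition (TI (opp mu))" using TI_unbounded by (simp add: unbounded_def)
    ultimately show ?thesis using min_Delta_eq by (auto simp: Def_def)
  qed
next
  fix g assume "g \<in> Def k"
  then have g: "is_partition g" "defc g = k" by (auto simp: Def_def)
  obtain h where h: "is_partition h" "nu_initial h" "defc h = k" "g \<in> nu_segment h"
    using in_some_segment[OF g(1)] g(2) by metis
  have "h \<in> set (generators D)"
    using initials_complete[OF h(1,2)] h(3) complete_generators(2)[OF comp] by simp
  then show "\<exists>mu\<in>Par k. \<exists>i\<le>length (runs mu). g \<in> run mu i"
    using h(4) unfolding generators_alt run_def by blast
next
  fix mu i g la j
  assume mu: "mu \<in> Par k" "i \<le> length (runs mu)" "g \<in> run mu i"
    and la: "la \<in> Par k" "j \<le> length (runs la)" "g \<in> run la j"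
  then obtain x y where x: "x \<in> set (gens mu ! i)" "g \<in> nu_segment x"
    and y: "y \<in> set (gens la ! j)" "g \<in> nu_segment y"
    unfolding run_def by blast
  have "x = y"
    using nu_segment_disjoint[OF gens_initial(2)[OF mu(1,2) x(1)] gens_initial(2)[OF la(1,2) y(1)] x(2) y(2)] .
  then show "mu = la \<and> i = j" using gens_inj[OF mu(1,2) x(1) la(1,2)] y(1) by simp
next
  fix mu i assume mu: "mu \<in> Par k" and i: "i \<le> length (runs mu)"
  show "\<exists>G\<subseteq>Def k. run mu i = (\<Union>g\<in>G. nu_segment g)"
    using gens_initial(3)[OF mu i] unfolding run_def by blast
  show "left mu i \<subseteq> run mu i"
    using orbits_facts(6)[OF mu i] by (auto simp: left_def left_block_def dest: in_set_takeD)
  show "length (left_block (block (opp mu) (length (runs mu) - i))) - 1 = length (left_block (block mu i)) - 1 \<and>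
    min_level (hd (block (opp mu) (length (runs mu) - i))) = min_level (hd (block mu i)) \<and>
    dinv (hd (block mu i)) + (length (left_block (block mu i)) - 1) + k +
      dinv (hd (block (opp mu) (length (runs mu) - i))) = min_level (hd (block mu i)) choose 2"
  proof -
    have "opposite_types k (types mu ! i) (rev (types (opp mu)) ! i)"
      using list_all2_nthD[OF checked(5)[OF mu], of i] i length_types by simp
    moreover have "rev (types (opp mu)) ! i = types (opp mu) ! (length (runs mu) - i)"
      using i length_types[of "opp mu"] same_length[OF mu] by (simp add: rev_nth)
    moreover have "length (runs mu) - i \<le> length (runs (opp mu))" using same_length[OF mu] by simp
    ultimately show ?thesis
      using types_nth[OF mu i] types_nth[OF checked(1)[OF mu]]
      by (simp add: opposite_types_def sum_upt_choose)
  qed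
next
  fix mu i g assume mu: "mu \<in> Par k" and i: "i \<le> length (runs mu)" and g: "g \<in> run mu i"
  show "dinv (hd (block mu i)) \<le> dinv g \<and>
    (g \<in> left mu i \<longleftrightarrow> dinv g \<le> dinv (hd (block mu i)) + (length (left_block (block mu i)) - 1))"
  proof (cases "i = length (runs mu)")
    case True
    have gt: "g \<in> tail mu" using g orbits_facts(3)[OF mu] True by simp
    have "g \<in> Def k" using orbits_facts(7)[OF mu i] g by blast
    moreover have "TI mu \<in> Def k"
      using orbits_facts(7)[OF mu, of "length (runs mu)"] orbits_facts(3)[OF mu] TI_in_tail by auto
    ultimately have "sum_list g = dinv g + k" "sum_list (TI mu) = dinv (TI mu) + k"
      using size_eq by (auto simp: Def_def)
    then show ?thesis
      using tail_size[OF gt] left_last[OF mu] orbits_facts(2)[OF mu] True by (auto simp: left_block_def)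
  next
    case False
    then have i': "i < length (runs mu)" using i by simp
    have "successively grows (block mu i)"
      using orbits_facts(4)[OF mu i'] unfolding successively_append_iff by blast
    moreover have "set (block mu i) \<subseteq> Def k" using orbits_facts(6,7)[OF mu i] by blast
    ultimately show ?thesis
      using left_block_dinv[of "block mu i" k g] g orbits_facts(1)[OF mu i'] by (auto simp: left_def)
  qed
next
  fix mu i assume mu: "mu \<in> Par k" and i: "i < length (runs mu)"
  have Y: "block mu (Suc i) \<noteq> []" using block_nonempty[OF mu, of "Suc i"] i by simp
  have Def: "set (block mu i @ block mu (Suc i)) \<subseteq> Def k"
    using orbits_facts(6,7)[OF mu, of i] orbits_facts(6,7)[OF mu, of "Suc i"] i by auto
  show "ordinary_chain k (run mu i \<union> left mu (Suc i)) (dinv (hd (block mu i))) (dinv (hd (block mu (Suc i))))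
     (length (left_block (block mu i)) - 1) (length (left_block (block mu (Suc i))) - 1)
     (min_level (hd (block mu i))) (min_level (hd (block mu (Suc i))))"
    using ordinary_chain_of_lists[OF orbits_facts(4)[OF mu i] Def orbits_facts(5)[OF mu i] Y]
      orbits_facts(1)[OF mu i] by (simp add: left_def)
  fix g assume "g \<in> run mu i"
  then have "g \<in> set (block mu i)" using orbits_facts(1)[OF mu i] by simp
  then obtain t where t: "t < length (block mu i)" "block mu i ! t = g"
    unfolding in_set_conv_nth by blast
  let ?Z = "block mu i @ block mu (Suc i)"
  note d = grows_dinv[OF orbits_facts(4)[OF mu i] Def]
  have "dinv (?Z ! t) = dinv (hd ?Z) + t" "dinv (?Z ! length (block mu i)) = dinv (hd ?Z) + length (block mu i)"
    using d[of t] d[of "length (block mu i)"] t Y by auto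
  moreover have "?Z ! t = g" "?Z ! length (block mu i) = hd (block mu (Suc i))"
    using t Y by (simp_all add: nth_append hd_conv_nth)
  ultimately show "dinv g < dinv (hd (block mu (Suc i)))" using t(1) by simp
qed

lemma chains_exist:
  "\<exists>(L :: partition set set) (star :: partition set \<Rightarrow> partition set).
    (\<forall>S\<in>L. local_chain k S) \<and>
    (\<forall>S\<in>L. star S \<in> L \<and> star (star S) = S) \<and>
    (\<forall>mu\<in>Par k. tail mu \<in> L) \<and>
    (\<forall>S\<in>L. \<forall>T\<in>L. S \<noteq> T \<longrightarrow>
       S \<inter> T = {} \<or> right_part k S = left_part k T \<or> right_part k T = left_part k S) \<and>
    (\<forall>g\<in>Def k.
       (\<exists>S. {U\<in>L. g \<in> U} = {S} \<and> g \<in> mid_part k S) \<or>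
       (\<exists>S T. S \<noteq> T \<and> {U\<in>L. g \<in> U} = {S, T} \<and>
              g \<in> right_part k S \<and> g \<in> left_part k T)) \<and>
    (\<forall>S\<in>L. locally_opposite k S (star S)) \<and>
    (\<forall>S\<in>L. \<forall>T\<in>L. S \<inter> T \<noteq> {} \<longrightarrow> star S \<inter> star T \<noteq> {}) \<and>
    (\<forall>S\<in>L. \<exists>G\<subseteq>Collect is_partition.
       left_part k S \<union> mid_part k S = (\<Union>g\<in>G. nu_segment g))"
  by (intro exI) (rule conclusion)

end

section \<open>The tables for deficits up to 11\<close>

text \<open>Most runs are single segments. A segment continues the run of a predecessor if
  \<open>min_Delta\<close> is constant on it, or if there would be more blocks of its type than of the opposite
  type; the successor of a run is then chosen so that the passage between their blocks has an
  opposite passage elsewhere.\<close>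

definition chains0 :: "chain_data list" where
  "chains0 = [
    ([], [], [])]"

definition chains1 :: "chain_data list" where
  "chains1 = [
    ([1], [1], [])]"

definition chains2 :: "chain_data list" where
  "chains2 = [
    ([2], [2], [[[1,1,1]]]),
    ([1,1], [1,1], [])]"

definition chains3 :: "chain_data list" where
  "chains3 = [
    ([3], [3], [[[1,1,1,1]], [[2,2,2]]]),
    ([2,1], [1,1,1], [[[3,1,1,1]]]),
    ([1,1,1], [2,1], [[[2,1,1,1]]])]"

definition chains4 :: "chain_data list" where
  "chains4 = [
    ([4], [4], [[[1,1,1,1,1]], [[2,2,2,1], [3,3,3,1]]]),
    ([3,1], [2,2], [[[2,2,1,1]]]),
    ([2,2], [3,1], [[[2,1,1,1,1]]]),
    ([2,1,1], [1,1,1,1], [[[3,2,1,1,1]], [[4,3,1,1,1]]]),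
    ([1,1,1,1], [2,1,1], [[[3,1,1,1,1]], [[4,2,1,1,1]]])]"

definition chains5 :: "chain_data list" where
  "chains5 = [
    ([5], [5], [[[1,1,1,1,1,1]], [[2,2,2,2]], [[3,3,3,2], [4,4,4,2,1]]]),
    ([4,1], [2,2,1], [[[4,1,1,1,1]], [[3,3,2,2]]]),
    ([3,2], [3,2], [[[2,2,1,1,1]], [[3,3,1,1,1]], [[4,4,1,1,1]]]),
    ([3,1,1], [3,1,1], [[[3,1,1,1,1,1]], [[4,2,2,1,1]]]),
    ([2,2,1], [4,1], [[[2,1,1,1,1,1]], [[3,2,2,2]]]),
    ([2,1,1,1], [2,1,1,1], [[[3,2,1,1,1,1]], [[4,3,1,1,1,1]], [[5,3,2,1,1,1]], [[5,4,3,1,1,1]]]),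
    ([1,1,1,1,1], [1,1,1,1,1], [[[4,2,1,1,1,1]], [[4,3,2,1,1,1]], [[5,4,2,1,1,1]]])]"

definition chains6 :: "chain_data list" where
  "chains6 = [
    ([6], [6], [[[1,1,1,1,1,1,1]], [[2,2,2,2,1]], [[3,3,3,2,1], [4,4,4,3,1], [5,5,5,3,2,1]]]),
    ([5,1], [4,1,1], [[[3,1,1,1,1,1,1]], [[3,3,3,1,1], [4,4,3,3,1]]]),
    ([4,2], [3,3], [[[2,2,2,1,1]], [[4,2,2,2,1], [4,4,4,1,1]]]),
    ([4,1,1], [5,1], [[[2,1,1,1,1,1,1]], [[3,3,2,1,1]]]),
    ([3,3], [4,2], [[[2,2,1,1,1,1]], [[3,2,2,2,1]]]),
    ([3,2,1], [3,1,1,1], [[[3,2,1,1,1,1,1]], [[5,3,1,1,1,1]], [[5,3,3,1,1,1]], [[5,5,3,1,1,1]]]),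
    ([3,1,1,1], [3,2,1], [[[4,1,1,1,1,1]], [[4,2,2,1,1,1]], [[4,4,2,1,1,1]], [[5,4,2,2,1,1]]]),
    ([2,2,2], [2,2,1,1], [[[3,3,1,1,1,1]]]),
    ([2,2,1,1], [2,2,2], [[[3,2,2,1,1]]]),
    ([2,1,1,1,1], [2,1,1,1,1], [[[4,2,1,1,1,1,1]], [[4,3,2,1,1,1,1]], [[5,4,2,1,1,1,1]],
       [[5,4,3,2,1,1,1]], [[6,5,3,2,1,1,1]], [[6,5,4,3,1,1,1]]]),
    ([1,1,1,1,1,1], [1,1,1,1,1,1], [[[4,3,1,1,1,1,1]], [[5,3,2,1,1,1,1]], [[5,4,3,1,1,1,1]],
       [[6,4,3,2,1,1,1]], [[6,5,4,2,1,1,1]]])]"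

definition chains7 :: "chain_data list" where
  "chains7 = [
    ([7], [7], [[[1,1,1,1,1,1,1,1]], [[2,2,2,2,2]], [[5,4,1,1,1,1]], [[5,5,2,1,1,1]],
       [[4,4,4,3,2], [5,5,5,4,2,1], [6,6,6,4,3,2,1]]]),
    ([6,1], [6,1], [[[2,1,1,1,1,1,1,1]], [[3,2,2,2,2]], [[4,4,3,1,1,1]], [[4,4,4,2,2],
       [5,5,4,4,2,1]]]),
    ([5,2], [5,2], [[[2,2,1,1,1,1,1]], [[3,3,2,2,1], [5,5,5,3,1,1]]]),
    ([5,1,1], [5,1,1], [[[3,1,1,1,1,1,1,1]], [[4,2,2,2,2]], [[4,4,3,2,2]]]),
    ([4,3], [4,3], [[[2,2,2,1,1,1]], [[3,3,2,1,1,1]], [[3,3,3,3,1]], [[5,5,4,1,1,1]]]),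
    ([4,2,1], [3,2,2], [[[3,2,2,1,1,1]], [[3,3,3,3]], [[5,5,2,2,1,1]]]),
    ([4,1,1,1], [4,1,1,1], [[[3,2,1,1,1,1,1,1]], [[4,3,3,1,1,1]], [[5,3,3,2,1,1]]]),
    ([3,3,1], [2,2,2,1], [[[5,2,1,1,1,1]], [[4,3,2,2,2]], [[5,4,4,1,1,1]]]),
    ([3,2,2], [4,2,1], [[[4,1,1,1,1,1,1]], [[5,2,2,1,1,1]], [[4,3,3,3,1]]]),
    ([3,2,1,1], [3,1,1,1,1], [[[4,2,1,1,1,1,1,1]], [[4,4,2,1,1,1,1]], [[5,4,2,2,1,1,1]],
       [[5,5,3,2,1,1,1]], [[6,5,3,3,1,1,1]], [[6,6,4,3,1,1,1]]]),
    ([3,1,1,1,1], [3,2,1,1], [[[3,3,1,1,1,1,1]], [[5,3,1,1,1,1,1]], [[5,3,3,1,1,1,1]],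
       [[6,4,3,1,1,1,1]], [[6,4,4,2,1,1,1]], [[6,5,4,2,2,1,1]]]),
    ([2,2,2,1], [3,3,1], [[[5,1,1,1,1,1]], [[4,4,1,1,1,1]], [[4,4,2,2,2]]]),
    ([2,2,1,1,1], [2,2,1,1,1], [[[4,2,2,1,1,1,1]], [[5,3,2,2,1,1]]]),
    ([2,1,1,1,1,1], [1,1,1,1,1,1,1], [[[4,3,2,1,1,1,1,1]], [[5,4,2,1,1,1,1,1]],
       [[5,4,3,2,1,1,1,1]], [[6,5,3,2,1,1,1,1]], [[6,5,4,3,1,1,1,1]], [[7,5,4,3,2,1,1,1]],
       [[7,6,5,3,2,1,1,1]], [[7,6,5,4,3,1,1,1]]]),
    ([1,1,1,1,1,1,1], [2,1,1,1,1,1], [[[4,3,1,1,1,1,1,1]], [[5,3,2,1,1,1,1,1]],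
       [[5,4,3,1,1,1,1,1]], [[6,4,3,2,1,1,1,1]], [[6,5,4,2,1,1,1,1]], [[6,5,4,3,2,1,1,1]],
       [[7,6,4,3,2,1,1,1]], [[7,6,5,4,2,1,1,1]]])]"

definition chains8 :: "chain_data list" where
  "chains8 = [
    ([8], [8], [[[1,1,1,1,1,1,1,1,1]], [[2,2,2,2,2,1]], [[3,3,3,3,2]], [[4,4,4,3,2,1],
       [5,5,5,4,3,1], [6,6,6,5,3,2,1], [7,7,7,5,4,3,2,1]]]),
    ([7,1], [3,3,2], [[[3,2,2,2,1,1]], [[4,3,2,2,2,1]], [[4,4,4,3,1,1], [5,5,5,3,3,1],
       [6,6,5,5,3,2,1]]]),
    ([6,2], [2,2,2,2], [[[3,3,3,1,1,1]], [[5,5,1,1,1,1]], [[4,4,3,3,2], [6,6,6,4,3,1,1]]]),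
    ([6,1,1], [6,1,1], [[[3,1,1,1,1,1,1,1,1]], [[5,2,2,2,1,1]], [[4,4,4,2,1,1], [5,5,4,3,3,1]]]),
    ([5,3], [4,4], [[[2,2,2,2,1,1]], [[3,3,3,2,2]], [[5,5,2,2,2,1], [5,5,5,2,2,1]]]),
    ([5,2,1], [3,3,1,1], [[[5,2,1,1,1,1,1]], [[5,4,1,1,1,1,1]], [[5,3,3,3,1,1], [5,5,4,4,1,1]]]),
    ([5,1,1,1], [2,2,2,1,1], [[[4,4,1,1,1,1,1]], [[4,4,3,2,1,1]]]),
    ([4,4], [5,3], [[[2,2,2,1,1,1,1]], [[3,2,2,2,2,1]], [[4,3,3,3,2]]]),
    ([4,3,1], [4,3,1], [[[5,1,1,1,1,1,1]], [[4,2,2,2,2,1]], [[5,4,2,2,2,1], [5,5,5,2,1,1]]]),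
    ([4,2,2], [4,2,2], [[[3,2,2,1,1,1,1]], [[5,2,2,1,1,1,1]], [[4,4,3,1,1,1,1]],
       [[6,4,2,2,1,1,1]], [[6,4,3,3,1,1,1]], [[6,6,4,2,1,1,1]], [[6,6,5,3,1,1,1]]]),
    ([4,2,1,1], [4,2,1,1], [[[3,3,1,1,1,1,1,1]], [[4,3,3,1,1,1,1]], [[6,4,2,1,1,1,1]],
       [[5,4,4,2,1,1,1]], [[6,4,4,3,1,1,1]], [[6,6,4,2,2,1,1]]]),
    ([4,1,1,1,1], [4,1,1,1,1], [[[4,2,1,1,1,1,1,1,1]], [[5,3,2,2,1,1,1]], [[5,5,3,1,1,1,1]],
       [[5,5,4,2,1,1,1]], [[6,5,3,3,2,1,1]]]),
    ([3,3,2], [7,1], [[[2,1,1,1,1,1,1,1,1]], [[4,2,2,2,1,1]], [[5,3,2,2,2,1]]]),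
    ([3,3,1,1], [5,2,1], [[[4,1,1,1,1,1,1,1]], [[4,3,2,2,1,1]], [[6,5,5,3,1,1,1]]]),
    ([3,2,2,1], [3,2,2,1], [[[3,3,2,1,1,1,1]], [[4,3,3,2,2]]]),
    ([3,2,1,1,1], [3,2,1,1,1], [[[4,2,2,1,1,1,1,1]], [[4,4,2,1,1,1,1,1]], [[5,4,2,2,1,1,1,1]],
       [[5,5,3,2,1,1,1,1]], [[6,5,3,3,1,1,1,1]], [[7,5,4,3,1,1,1,1]], [[7,5,5,3,2,1,1,1]],
       [[7,6,5,3,3,1,1,1]], [[7,7,5,4,3,1,1,1]]]),
    ([3,1,1,1,1,1], [3,1,1,1,1,1], [[[4,3,1,1,1,1,1,1,1]], [[5,3,3,1,1,1,1,1]],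
       [[6,4,3,1,1,1,1,1]], [[6,4,4,2,1,1,1,1]], [[6,5,4,2,2,1,1,1]], [[6,6,4,3,2,1,1,1]],
       [[7,6,4,4,2,1,1,1]], [[7,6,5,4,2,2,1,1]]]),
    ([2,2,2,2], [6,2], [[[2,2,1,1,1,1,1,1]], [[3,3,2,2,2]], [[4,4,4,1,1,1]]]),
    ([2,2,2,1,1], [5,1,1,1], [[[3,2,1,1,1,1,1,1,1]], [[4,4,2,2,1,1]]]),
    ([2,2,1,1,1,1], [2,2,1,1,1,1], [[[5,3,1,1,1,1,1,1]], [[5,3,3,2,1,1,1]], [[6,5,3,1,1,1,1]],
       [[6,5,3,2,2,1,1]]]),
    ([2,1,1,1,1,1,1], [1,1,1,1,1,1,1,1], [[[5,3,2,1,1,1,1,1,1]], [[5,4,3,1,1,1,1,1,1]],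
       [[6,4,3,2,1,1,1,1,1]], [[6,5,4,2,1,1,1,1,1]], [[6,5,4,3,2,1,1,1,1]],
       [[7,6,4,3,2,1,1,1,1]], [[7,6,5,4,2,1,1,1,1]], [[7,6,5,4,3,2,1,1,1]],
       [[8,7,5,4,3,2,1,1,1]], [[8,7,6,5,3,2,1,1,1]], [[8,7,6,5,4,3,1,1,1]]]),
    ([1,1,1,1,1,1,1,1], [2,1,1,1,1,1,1], [[[4,3,2,1,1,1,1,1,1]], [[5,4,2,1,1,1,1,1,1]],
       [[5,4,3,2,1,1,1,1,1]], [[6,5,3,2,1,1,1,1,1]], [[6,5,4,3,1,1,1,1,1]],
       [[7,5,4,3,2,1,1,1,1]], [[7,6,5,3,2,1,1,1,1]], [[7,6,5,4,3,1,1,1,1]],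
       [[8,6,5,4,3,2,1,1,1]], [[8,7,6,4,3,2,1,1,1]], [[8,7,6,5,4,2,1,1,1]]])]"

definition chains9 :: "chain_data list" where
  "chains9 = [
    ([9], [9], [[[1,1,1,1,1,1,1,1,1,1]], [[2,2,2,2,2,2]], [[3,3,3,3,2,1], [5,4,4,4,1,1]],
       [[5,5,5,4,3,2], [6,6,6,5,4,2,1], [7,7,7,6,4,3,2,1], [8,8,8,6,5,4,3,2,1]]]),
    ([8,1], [5,3,1], [[[5,1,1,1,1,1,1,1]], [[3,3,3,3,1,1], [4,4,4,4,2]], [[5,5,5,4,2,2],
       [6,6,6,4,4,2,1], [7,7,6,6,4,3,2,1]]]),
    ([7,2], [7,2], [[[2,2,1,1,1,1,1,1,1]], [[3,3,3,2,1,1]], [[4,4,4,2,2,1], [5,5,4,4,3,1],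
       [7,7,7,5,4,3,1,1]]]),
    ([7,1,1], [2,2,2,2,1], [[[6,3,1,1,1,1,1]], [[6,3,3,1,1,1,1]], [[6,4,4,1,1,1,1]],
       [[5,5,4,3,1,1,1]], [[5,5,5,3,2,2], [6,6,5,4,4,2,1]]]),
    ([6,3], [4,4,1], [[[6,1,1,1,1,1,1]], [[5,2,2,2,2,1]], [[5,3,3,3,2,1], [5,5,5,4,1,1],
       [6,6,6,4,2,2,1]]]),
    ([6,2,1], [3,3,1,1,1], [[[4,4,1,1,1,1,1,1]], [[4,4,3,3,1,1], [6,6,5,5,3,1,1]]]),
    ([6,1,1,1], [3,3,3], [[[3,3,2,2,1,1]], [[5,5,4,3,2,2]]]),
    ([5,4], [4,3,2], [[[3,2,2,2,1,1,1]], [[5,2,2,2,1,1,1]], [[5,5,2,1,1,1,1]],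
       [[6,5,2,2,1,1,1]], [[6,6,3,2,1,1,1]], [[6,5,4,4,1,1,1]], [[6,6,5,4,1,1,1]]]),
    ([5,3,1], [8,1], [[[2,1,1,1,1,1,1,1,1,1]], [[3,2,2,2,2,2]], [[5,3,3,2,2,1],
       [6,6,6,4,2,1,1]]]),
    ([5,2,2], [3,2,2,1,1], [[[5,2,2,1,1,1,1,1]], [[4,4,3,1,1,1,1,1]], [[5,4,3,3,1,1,1]],
       [[5,5,4,2,2,2]], [[6,6,5,2,2,1,1]]]),
    ([5,2,1,1], [5,2,1,1], [[[3,3,1,1,1,1,1,1,1]], [[4,4,2,2,1,1,1]], [[4,4,4,4,1]],
       [[6,6,3,3,2,1,1]]]),
    ([5,1,1,1,1], [5,1,1,1,1], [[[4,2,1,1,1,1,1,1,1,1]], [[4,4,3,2,1,1,1]], [[5,4,3,2,2,2]],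
       [[6,4,4,3,2,1,1]]]),
    ([4,4,1], [6,3], [[[2,2,2,1,1,1,1,1]], [[3,3,2,2,2,1]], [[4,3,3,3,2,1], [5,4,4,4,2,1]]]),
    ([4,3,2], [5,4], [[[2,2,2,2,1,1,1]], [[4,2,2,2,1,1,1]], [[6,4,1,1,1,1,1]],
       [[5,4,4,1,1,1,1]], [[5,5,3,3,1,1,1]], [[6,5,5,2,1,1,1]], [[6,6,4,4,1,1,1]]]),
    ([4,3,1,1], [2,2,2,1,1,1], [[[5,4,1,1,1,1,1,1]], [[6,3,3,2,1,1,1]], [[5,5,3,2,2,2]],
       [[6,5,5,2,2,1,1]]]),
    ([4,2,2,1], [2,2,1,1,1,1,1], [[[4,4,2,1,1,1,1,1,1]], [[6,4,2,2,1,1,1,1]],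
       [[5,5,4,2,1,1,1,1]], [[6,5,3,3,2,1,1,1]], [[7,6,4,3,1,1,1,1]], [[7,6,4,3,3,1,1,1]],
       [[7,7,5,4,2,1,1,1]], [[7,7,6,4,3,1,1,1]]]),
    ([4,2,1,1,1], [4,1,1,1,1,1], [[[4,3,1,1,1,1,1,1,1,1]], [[5,3,3,2,1,1,1,1]],
       [[6,5,3,1,1,1,1,1]], [[6,5,3,2,2,1,1,1]], [[6,6,4,3,1,1,1,1]], [[7,5,4,4,2,1,1,1]],
       [[7,6,4,4,3,1,1,1]], [[7,7,5,4,2,2,1,1]]]),
    ([4,1,1,1,1,1], [4,2,1,1,1], [[[4,2,2,1,1,1,1,1,1]], [[5,3,2,2,1,1,1,1]],
       [[5,5,3,1,1,1,1,1]], [[6,4,3,3,1,1,1,1]], [[7,5,4,2,1,1,1,1]], [[6,5,5,3,2,1,1,1]],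
       [[7,5,5,4,2,1,1,1]], [[7,6,5,3,3,2,1,1]]]),
    ([3,3,3], [6,1,1,1], [[[3,2,1,1,1,1,1,1,1,1]], [[4,3,2,2,2,2]]]),
    ([3,3,2,1], [3,3,2,1], [[[6,2,1,1,1,1,1]], [[4,4,2,2,2,1], [5,5,5,1,1,1], [5,5,3,3,3,1]]]),
    ([3,3,1,1,1], [6,2,1], [[[4,1,1,1,1,1,1,1,1]], [[4,3,3,2,1,1]]]),
    ([3,2,2,2], [3,2,2,2], [[[3,3,3,1,1,1,1]], [[4,3,3,3,1,1], [4,4,4,4,2,1]]]),
    ([3,2,2,1,1], [5,2,2], [[[3,2,2,1,1,1,1,1]], [[4,3,2,2,1,1,1]], [[5,3,2,2,2,2]],
       [[6,4,3,2,2,1,1]], [[7,6,6,4,3,1,1,1]]]),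
    ([3,2,1,1,1,1], [3,2,1,1,1,1], [[[5,3,1,1,1,1,1,1,1]], [[5,3,3,1,1,1,1,1,1]],
       [[6,4,3,1,1,1,1,1,1]], [[6,4,4,2,1,1,1,1,1]], [[6,5,4,2,2,1,1,1,1]],
       [[6,6,4,3,2,1,1,1,1]], [[7,6,4,4,2,1,1,1,1]], [[7,6,5,4,2,2,1,1,1]],
       [[7,7,5,4,3,2,1,1,1]], [[8,7,5,5,3,2,1,1,1]], [[8,7,6,5,3,3,1,1,1]],
       [[8,8,6,5,4,3,1,1,1]]]),
    ([3,1,1,1,1,1,1], [3,1,1,1,1,1,1], [[[4,3,2,1,1,1,1,1,1,1]], [[5,4,2,2,1,1,1,1,1]],
       [[5,5,3,2,1,1,1,1,1]], [[6,5,3,3,1,1,1,1,1]], [[7,5,4,3,1,1,1,1,1]],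
       [[7,5,5,3,2,1,1,1,1]], [[7,6,5,3,3,1,1,1,1]], [[8,6,5,4,3,1,1,1,1]],
       [[8,6,6,4,3,2,1,1,1]], [[8,7,6,4,4,2,1,1,1]], [[8,7,6,5,4,2,2,1,1]]]),
    ([2,2,2,2,1], [7,1,1], [[[3,1,1,1,1,1,1,1,1,1]], [[4,2,2,2,2,2]], [[5,5,2,2,1,1,1]],
       [[6,5,4,1,1,1,1]], [[6,6,3,3,1,1,1]]]),
    ([2,2,2,1,1,1], [4,3,1,1], [[[5,2,1,1,1,1,1,1]], [[6,3,2,1,1,1,1]], [[5,4,2,2,2,2]],
       [[6,4,4,2,2,1,1]]]),
    ([2,2,1,1,1,1,1], [4,2,2,1], [[[3,3,2,1,1,1,1,1]], [[4,3,3,1,1,1,1,1]], [[6,4,2,1,1,1,1,1]],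
       [[5,4,4,2,1,1,1,1]], [[6,4,4,3,1,1,1,1]], [[7,5,4,2,2,1,1,1]], [[6,6,5,3,2,1,1,1]],
       [[7,6,5,3,2,2,1,1]]]),
    ([2,1,1,1,1,1,1,1], [2,1,1,1,1,1,1,1], [[[5,3,2,1,1,1,1,1,1,1]], [[5,4,3,1,1,1,1,1,1,1]],
       [[6,4,3,2,1,1,1,1,1,1]], [[6,5,4,2,1,1,1,1,1,1]], [[6,5,4,3,2,1,1,1,1,1]],
       [[7,6,4,3,2,1,1,1,1,1]], [[7,6,5,4,2,1,1,1,1,1]], [[7,6,5,4,3,2,1,1,1,1]],
       [[8,7,5,4,3,2,1,1,1,1]], [[8,7,6,5,3,2,1,1,1,1]], [[8,7,6,5,4,3,1,1,1,1]],
       [[9,7,6,5,4,3,2,1,1,1]], [[9,8,7,5,4,3,2,1,1,1]], [[9,8,7,6,5,3,2,1,1,1]],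
       [[9,8,7,6,5,4,3,1,1,1]]]),
    ([1,1,1,1,1,1,1,1,1], [1,1,1,1,1,1,1,1,1], [[[5,4,2,1,1,1,1,1,1,1]],
       [[5,4,3,2,1,1,1,1,1,1]], [[6,5,3,2,1,1,1,1,1,1]], [[6,5,4,3,1,1,1,1,1,1]],
       [[7,5,4,3,2,1,1,1,1,1]], [[7,6,5,3,2,1,1,1,1,1]], [[7,6,5,4,3,1,1,1,1,1]],
       [[8,6,5,4,3,2,1,1,1,1]], [[8,7,6,4,3,2,1,1,1,1]], [[8,7,6,5,4,2,1,1,1,1]],
       [[8,7,6,5,4,3,2,1,1,1]], [[9,8,6,5,4,3,2,1,1,1]], [[9,8,7,6,4,3,2,1,1,1]],
       [[9,8,7,6,5,4,2,1,1,1]]])]"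

definition chains10 :: "chain_data list" where
  "chains10 = [
    ([10], [10], [[[1,1,1,1,1,1,1,1,1,1,1]], [[2,2,2,2,2,2,1]], [[3,3,3,3,3,1]],
       [[4,4,4,4,3,1]], [[5,5,5,4,3,2,1], [6,6,6,5,4,3,1], [7,7,7,6,5,3,2,1],
       [8,8,8,7,5,4,3,2,1], [9,9,9,7,6,5,4,3,2,1]]]),
    ([9,1], [2,2,2,2,1,1], [[[6,4,1,1,1,1,1,1]], [[6,4,2,2,2,1,1]], [[6,5,3,2,2,2,1]],
       [[5,5,5,4,3,1,1], [6,6,6,5,3,3,1], [7,7,7,5,5,3,2,1], [8,8,7,7,5,4,3,2,1]]]),
    ([8,2], [7,3], [[[2,2,2,1,1,1,1,1,1]], [[3,3,3,2,2,1], [4,4,4,4,1,1]], [[5,5,5,3,3,2],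
       [6,6,5,5,4,2,1], [8,8,8,6,5,4,3,1,1]]]),
    ([8,1,1], [3,3,2,1,1], [[[6,3,1,1,1,1,1,1]], [[5,3,3,3,1,1,1]], [[5,4,3,3,3,1]],
       [[5,5,5,4,2,1,1], [6,6,6,4,3,3,1], [7,7,6,5,5,3,2,1]]]),
    ([7,3], [8,2], [[[2,2,1,1,1,1,1,1,1,1]], [[3,3,2,2,2,2]], [[4,4,3,3,2,1], [6,6,6,5,3,1,1],
       [7,7,7,5,4,2,2,1]]]),
    ([7,2,1], [7,2,1], [[[4,1,1,1,1,1,1,1,1,1]], [[5,2,2,2,2,2]], [[6,3,3,3,1,1,1]],
       [[5,5,5,2,1,1,1]], [[5,5,4,4,2,2], [7,7,6,6,4,3,1,1]]]),
    ([7,1,1,1], [4,4,2], [[[3,3,2,2,1,1,1]], [[6,2,2,2,1,1,1]], [[6,5,2,1,1,1,1]],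
       [[5,4,4,2,2,2]], [[5,5,5,3,2,1,1], [6,6,5,4,3,3,1]]]),
    ([6,4], [2,2,2,2,2], [[[5,5,1,1,1,1,1]], [[4,4,4,2,1,1,1]], [[4,4,4,3,3,1]],
       [[6,6,5,2,2,2,1], [6,6,6,3,3,2,1]]]),
    ([6,3,1], [4,4,1,1], [[[6,2,1,1,1,1,1,1]], [[4,4,3,2,2,1], [7,7,7,5,4,2,1,1]]]),
    ([6,2,2], [6,1,1,1,1], [[[4,2,1,1,1,1,1,1,1,1,1]], [[5,4,2,2,2,1,1]], [[6,4,3,2,2,2,1]],
       [[6,6,3,3,3,1,1], [6,6,5,5,2,2,1]]]),
    ([6,2,1,1], [6,2,1,1], [[[3,3,1,1,1,1,1,1,1,1]], [[6,3,2,2,1,1,1]], [[5,3,3,3,3,1]],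
       [[6,4,4,4,2,1,1], [6,6,5,4,4,1,1]]]),
    ([6,1,1,1,1], [6,2,2], [[[3,2,2,1,1,1,1,1,1]], [[4,3,2,2,2,1,1]], [[5,4,2,2,2,2,1]],
       [[5,5,4,3,2,1,1]]]),
    ([5,5], [5,5], [[[2,2,2,2,2,1,1]], [[4,2,2,2,2,2,1]], [[4,4,4,3,3]], [[6,6,4,2,2,2,1]]]),
    ([5,4,1], [5,4,1], [[[6,1,1,1,1,1,1,1]], [[4,3,2,2,1,1,1,1]], [[5,3,3,2,2,2]],
       [[5,5,3,3,2,2]], [[7,7,6,5,3,1,1,1]]]),
    ([5,3,2], [5,3,2], [[[3,2,2,2,1,1,1,1]], [[3,3,3,3,3]], [[5,4,4,3,1,1,1]], [[5,4,4,4,3,1],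
       [6,6,6,3,3,1,1]]]),
    ([5,3,1,1], [5,3,1,1], [[[5,2,1,1,1,1,1,1,1]], [[5,3,2,2,2,1,1]], [[5,4,3,2,2,2,1]],
       [[6,5,3,3,3,1,1], [6,6,5,5,2,1,1]]]),
    ([5,2,2,1], [3,3,1,1,1,1], [[[5,4,1,1,1,1,1,1,1]], [[5,4,3,2,2,1,1]], [[7,6,6,4,2,1,1,1]],
       [[7,7,6,4,2,2,1,1]]]),
    ([5,2,1,1,1], [5,2,1,1,1], [[[4,2,2,1,1,1,1,1,1,1]], [[4,4,3,2,1,1,1,1]],
       [[6,4,4,1,1,1,1,1]], [[6,4,4,2,2,1,1,1]], [[6,5,5,3,1,1,1,1]], [[7,5,4,3,3,1,1,1]],
       [[7,7,5,3,2,1,1,1]], [[7,7,5,3,3,2,1,1]]]),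
    ([5,1,1,1,1,1], [5,1,1,1,1,1], [[[4,3,1,1,1,1,1,1,1,1,1]], [[6,3,3,2,1,1,1,1]],
       [[6,5,4,1,1,1,1,1]], [[6,4,4,3,2,1,1,1]], [[6,5,4,4,2,1,1,1]], [[6,6,5,4,2,1,1,1]],
       [[7,6,4,4,3,2,1,1]]]),
    ([4,4,2], [7,1,1,1], [[[3,2,1,1,1,1,1,1,1,1,1]], [[4,4,4,1,1,1,1]], [[5,5,2,2,2,2]],
       [[5,5,5,3,1,1,1]], [[6,5,5,4,1,1,1]]]),
    ([4,4,1,1], [6,3,1], [[[5,1,1,1,1,1,1,1,1]], [[4,3,3,2,2,1], [6,6,6,3,2,1,1]]]),
    ([4,3,3], [4,3,3], [[[3,2,2,2,2,1,1]], [[4,3,2,2,2,2,1]], [[6,5,2,2,2,1,1]],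
       [[6,5,4,2,2,2,1]]]),
    ([4,3,2,1], [4,3,2,1], [[[3,3,3,1,1,1,1,1]], [[6,3,2,1,1,1,1,1]], [[5,5,2,2,1,1,1,1]],
       [[5,5,3,3,1,1,1,1]], [[7,5,3,3,1,1,1,1]], [[7,6,4,2,2,1,1,1]], [[7,5,5,3,3,1,1,1]],
       [[7,7,5,3,3,1,1,1]], [[7,7,5,5,3,1,1,1]]]),
    ([4,3,1,1,1], [4,3,1,1,1], [[[4,4,1,1,1,1,1,1,1]], [[6,3,3,1,1,1,1,1]], [[6,5,2,2,1,1,1,1]],
       [[5,5,4,3,1,1,1,1]], [[6,6,4,2,2,1,1,1]], [[6,6,4,4,2,1,1,1]], [[7,5,5,4,3,1,1,1]],
       [[7,6,6,4,2,2,1,1]]]),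
    ([4,2,2,2], [4,2,2,2], [[[4,2,2,2,1,1,1,1]], [[4,3,3,3,3]], [[5,4,4,3,3,1]]]),
    ([4,2,2,1,1], [4,2,1,1,1,1], [[[5,3,1,1,1,1,1,1,1,1]], [[5,3,3,2,1,1,1,1,1]],
       [[6,5,3,1,1,1,1,1,1]], [[6,5,3,2,2,1,1,1,1]], [[6,6,4,3,1,1,1,1,1]],
       [[7,5,4,4,2,1,1,1,1]], [[7,6,4,4,3,1,1,1,1]], [[8,6,5,4,2,2,1,1,1]],
       [[7,7,6,4,3,2,1,1,1]], [[8,7,6,4,3,3,1,1,1]], [[8,8,6,5,4,2,1,1,1]],
       [[8,8,7,5,4,3,1,1,1]]]),
    ([4,2,1,1,1,1], [4,2,2,1,1], [[[5,2,2,1,1,1,1,1,1]], [[5,3,2,2,1,1,1,1,1]],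
       [[5,5,3,1,1,1,1,1,1]], [[6,4,3,3,1,1,1,1,1]], [[7,5,4,2,1,1,1,1,1]],
       [[6,5,5,3,2,1,1,1,1]], [[7,5,5,4,2,1,1,1,1]], [[7,6,5,3,3,2,1,1,1]],
       [[8,7,5,4,3,1,1,1,1]], [[8,7,5,4,4,2,1,1,1]], [[8,7,6,4,4,3,1,1,1]],
       [[8,8,6,5,4,2,2,1,1]]]),
    ([4,1,1,1,1,1,1], [2,2,1,1,1,1,1,1], [[[5,3,3,1,1,1,1,1,1,1]], [[5,4,4,2,1,1,1,1,1]],
       [[6,4,4,3,1,1,1,1,1]], [[7,5,4,2,2,1,1,1,1]], [[6,6,5,3,2,1,1,1,1]],
       [[7,6,5,3,2,2,1,1,1]], [[7,7,5,4,3,1,1,1,1]], [[8,6,5,5,3,2,1,1,1]],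
       [[8,7,5,5,4,2,1,1,1]], [[8,7,6,5,3,3,2,1,1]]]),
    ([3,3,3,1], [3,3,3,1], [[[6,2,2,1,1,1,1]], [[6,5,1,1,1,1,1]], [[5,5,4,1,1,1,1]],
       [[6,6,4,1,1,1,1]], [[6,6,5,2,1,1,1]]]),
    ([3,3,2,2], [3,3,2,2], [[[3,3,3,2,1,1,1]], [[4,4,2,2,2,2]], [[6,6,3,1,1,1,1]],
       [[5,5,5,2,2,2]]]),
    ([3,3,2,1,1], [8,1,1], [[[3,1,1,1,1,1,1,1,1,1,1]], [[4,3,3,2,1,1,1]], [[4,4,3,3,3]],
       [[6,6,3,2,2,1,1]]]),
    ([3,3,1,1,1,1], [5,2,2,1], [[[3,3,2,1,1,1,1,1,1]], [[4,4,2,2,1,1,1,1]], [[5,4,4,1,1,1,1,1]],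
       [[6,4,3,3,2,1,1]]]),
    ([3,2,2,2,1], [3,2,2,2,1], [[[5,2,2,2,1,1,1,1]], [[5,5,2,1,1,1,1,1]], [[5,5,3,2,2,1,1]],
       [[7,6,5,5,3,1,1,1]]]),
    ([3,2,2,1,1,1], [3,2,2,1,1,1], [[[4,3,3,1,1,1,1,1,1]], [[6,4,2,1,1,1,1,1,1]],
       [[6,4,3,2,2,1,1,1]], [[6,6,4,2,1,1,1,1]], [[7,5,5,3,1,1,1,1]], [[7,6,4,3,2,2,1,1]],
       [[8,7,7,5,4,3,1,1,1]]]),
    ([3,2,1,1,1,1,1], [3,1,1,1,1,1,1,1], [[[5,3,2,1,1,1,1,1,1,1,1]], [[6,4,3,1,1,1,1,1,1,1]],
       [[6,4,4,2,1,1,1,1,1,1]], [[6,5,4,2,2,1,1,1,1,1]], [[6,6,4,3,2,1,1,1,1,1]],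
       [[7,6,4,4,2,1,1,1,1,1]], [[7,6,5,4,2,2,1,1,1,1]], [[7,7,5,4,3,2,1,1,1,1]],
       [[8,7,5,5,3,2,1,1,1,1]], [[8,7,6,5,3,3,1,1,1,1]], [[9,7,6,5,4,3,1,1,1,1]],
       [[9,7,7,5,4,3,2,1,1,1]], [[9,8,7,5,5,3,2,1,1,1]], [[9,8,7,6,5,3,3,1,1,1]],
       [[9,9,7,6,5,4,3,1,1,1]]]),
    ([3,1,1,1,1,1,1,1], [3,2,1,1,1,1,1], [[[4,4,2,1,1,1,1,1,1,1]], [[5,4,2,2,1,1,1,1,1,1]],
       [[5,5,3,2,1,1,1,1,1,1]], [[6,5,3,3,1,1,1,1,1,1]], [[7,5,4,3,1,1,1,1,1,1]],
       [[7,5,5,3,2,1,1,1,1,1]], [[7,6,5,3,3,1,1,1,1,1]], [[8,6,5,4,3,1,1,1,1,1]],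
       [[8,6,6,4,3,2,1,1,1,1]], [[8,7,6,4,4,2,1,1,1,1]], [[8,7,6,5,4,2,2,1,1,1]],
       [[8,8,6,5,4,3,2,1,1,1]], [[9,8,6,6,4,3,2,1,1,1]], [[9,8,7,6,4,4,2,1,1,1]],
       [[9,8,7,6,5,4,2,2,1,1]]]),
    ([2,2,2,2,2], [6,4], [[[2,2,2,2,1,1,1,1]], [[3,2,2,2,2,2,1]], [[4,3,3,3,3,1]],
       [[6,4,4,4,1,1,1]]]),
    ([2,2,2,2,1,1], [9,1], [[[2,1,1,1,1,1,1,1,1,1,1]], [[4,2,2,2,2,1,1]], [[5,3,2,2,2,2,1]],
       [[5,5,4,2,2,1,1]]]),
    ([2,2,2,1,1,1,1], [2,2,2,1,1,1,1], [[[4,4,3,1,1,1,1,1,1]], [[5,4,3,3,1,1,1,1]],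
       [[7,5,3,2,1,1,1,1]], [[7,5,3,3,2,1,1,1]], [[7,6,5,3,1,1,1,1]], [[7,6,4,4,2,2,1,1]]]),
    ([2,2,1,1,1,1,1,1], [4,1,1,1,1,1,1], [[[4,3,2,1,1,1,1,1,1,1,1]], [[6,4,2,2,1,1,1,1,1]],
       [[5,5,4,2,1,1,1,1,1]], [[6,5,3,3,2,1,1,1,1]], [[7,6,4,3,1,1,1,1,1]],
       [[7,6,4,3,3,1,1,1,1]], [[8,6,5,4,2,1,1,1,1]], [[7,6,6,4,3,2,1,1,1]],
       [[8,6,6,5,3,2,1,1,1]], [[8,7,6,5,3,2,2,1,1]]]),
    ([2,1,1,1,1,1,1,1,1], [2,1,1,1,1,1,1,1,1], [[[5,4,2,1,1,1,1,1,1,1,1]],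
       [[5,4,3,2,1,1,1,1,1,1,1]], [[6,5,3,2,1,1,1,1,1,1,1]], [[6,5,4,3,1,1,1,1,1,1,1]],
       [[7,5,4,3,2,1,1,1,1,1,1]], [[7,6,5,3,2,1,1,1,1,1,1]], [[7,6,5,4,3,1,1,1,1,1,1]],
       [[8,6,5,4,3,2,1,1,1,1,1]], [[8,7,6,4,3,2,1,1,1,1,1]], [[8,7,6,5,4,2,1,1,1,1,1]],
       [[8,7,6,5,4,3,2,1,1,1,1]], [[9,8,6,5,4,3,2,1,1,1,1]], [[9,8,7,6,4,3,2,1,1,1,1]],
       [[9,8,7,6,5,4,2,1,1,1,1]], [[9,8,7,6,5,4,3,2,1,1,1]], [[10,9,7,6,5,4,3,2,1,1,1]],
       [[10,9,8,7,5,4,3,2,1,1,1]], [[10,9,8,7,6,5,3,2,1,1,1]], [[10,9,8,7,6,5,4,3,1,1,1]]]),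
    ([1,1,1,1,1,1,1,1,1,1], [1,1,1,1,1,1,1,1,1,1], [[[5,4,3,1,1,1,1,1,1,1,1]],
       [[6,4,3,2,1,1,1,1,1,1,1]], [[6,5,4,2,1,1,1,1,1,1,1]], [[6,5,4,3,2,1,1,1,1,1,1]],
       [[7,6,4,3,2,1,1,1,1,1,1]], [[7,6,5,4,2,1,1,1,1,1,1]], [[7,6,5,4,3,2,1,1,1,1,1]],
       [[8,7,5,4,3,2,1,1,1,1,1]], [[8,7,6,5,3,2,1,1,1,1,1]], [[8,7,6,5,4,3,1,1,1,1,1]],
       [[9,7,6,5,4,3,2,1,1,1,1]], [[9,8,7,5,4,3,2,1,1,1,1]], [[9,8,7,6,5,3,2,1,1,1,1]],
       [[9,8,7,6,5,4,3,1,1,1,1]], [[10,8,7,6,5,4,3,2,1,1,1]], [[10,9,8,6,5,4,3,2,1,1,1]],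
       [[10,9,8,7,6,4,3,2,1,1,1]], [[10,9,8,7,6,5,4,2,1,1,1]]])]"

definition chains11 :: "chain_data list" where
  "chains11 = [
    ([11], [11], [[[1,1,1,1,1,1,1,1,1,1,1,1]], [[2,2,2,2,2,2,2]], [[4,4,4,1,1,1,1,1]],
       [[4,4,4,3,2,2], [5,5,5,5,3,1]], [[7,7,5,4,4,1,1,1]], [[6,6,6,5,4,3,2], [7,7,7,6,5,4,2,1],
       [8,8,8,7,6,4,3,2,1], [9,9,9,8,6,5,4,3,2,1], [10,10,10,8,7,6,5,4,3,2,1]]]),
    ([10,1], [7,1,1,1,1], [[[4,2,1,1,1,1,1,1,1,1,1,1]], [[5,3,2,2,2,2,2]], [[6,4,3,3,3,1,1],
       [5,5,5,5,3,2]], [[6,6,6,5,4,2,2], [7,7,7,6,4,4,2,1], [8,8,8,6,6,4,3,2,1],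
       [9,9,8,8,6,5,4,3,2,1]]]),
    ([9,2], [9,2], [[[2,2,1,1,1,1,1,1,1,1,1]], [[5,2,2,2,2,1,1]], [[5,3,3,2,2,2,1]],
       [[6,4,4,2,2,2,1]], [[5,5,5,4,2,2,1], [6,6,6,4,4,3,1], [7,7,6,6,5,3,2,1],
       [9,9,9,7,6,5,4,3,1,1]]]),
    ([9,1,1], [3,3,2,2,1], [[[5,5,1,1,1,1,1,1]], [[6,5,2,1,1,1,1,1]], [[5,4,4,3,1,1,1,1]],
       [[6,6,3,3,1,1,1,1]], [[7,5,5,2,2,1,1,1]], [[7,7,4,3,2,1,1,1]], [[7,7,4,4,3,1,1,1]],
       [[6,6,6,5,3,2,2], [7,7,7,5,4,4,2,1], [8,8,7,6,6,4,3,2,1]]]),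
    ([8,3], [4,2,2,2,1], [[[4,3,2,2,1,1,1,1,1]], [[4,4,4,2,2,2]], [[5,5,4,4,1,1,1]],
       [[5,5,4,4,3,2], [7,7,7,6,4,3,1,1], [8,8,8,6,5,4,2,2,1]]]),
    ([8,2,1], [3,3,3,2], [[[3,3,3,3,1,1,1]], [[6,6,1,1,1,1,1]], [[5,5,5,1,1,1,1]],
       [[6,6,5,1,1,1,1]], [[5,5,5,3,3,1,1], [6,6,5,5,3,3,1], [8,8,7,7,5,4,3,1,1]]]),
    ([8,1,1,1], [3,3,2,1,1,1], [[[6,4,1,1,1,1,1,1,1]], [[6,3,3,3,2,1,1], [5,5,5,5,2,1]],
       [[6,6,6,4,3,2,2], [7,7,6,5,4,4,2,1]]]),
    ([7,4], [6,3,1,1], [[[5,2,1,1,1,1,1,1,1,1]], [[6,3,2,2,2,1,1]], [[5,4,3,3,3,2]],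
       [[6,6,3,3,3,2,1], [6,6,6,5,2,2,1], [7,7,7,5,3,3,2,1]]]),
    ([7,3,1], [5,3,3], [[[3,2,2,2,2,1,1,1]], [[3,3,3,3,2,2]], [[5,5,3,2,2,2,1]],
       [[6,4,4,4,3,1,1], [6,6,6,4,4,1,1], [7,7,6,6,4,2,2,1]]]),
    ([7,2,2], [6,5], [[[2,2,2,2,2,1,1,1]], [[4,2,2,2,2,1,1,1]], [[4,4,3,2,2,2]],
       [[5,4,4,4,1,1,1]], [[5,5,4,3,3,2], [8,8,8,6,5,4,2,1,1]]]),
    ([7,2,1,1], [6,3,2], [[[3,2,2,2,1,1,1,1,1]], [[4,3,2,2,2,1,1,1]], [[4,4,3,3,3,1]],
       [[5,5,4,4,2,1,1], [7,7,6,5,5,3,1,1]]]),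
    ([7,1,1,1,1], [10,1], [[[2,1,1,1,1,1,1,1,1,1,1,1]], [[3,2,2,2,2,2,2]], [[6,3,3,2,2,1,1]],
       [[6,6,5,4,3,2,2]]]),
    ([6,5], [7,2,2], [[[3,2,2,1,1,1,1,1,1,1]], [[4,3,3,2,2,2]], [[6,6,2,2,1,1,1]],
       [[5,4,4,4,2,2], [6,5,5,5,3,1,1]], [[7,7,6,5,4,1,1,1]]]),
    ([6,4,1], [6,4,1], [[[6,1,1,1,1,1,1,1,1]], [[5,2,2,2,2,2,1]], [[5,3,3,3,3,2]],
       [[6,6,3,3,2,2,1], [7,7,7,5,3,3,1,1]]]),
    ([6,3,2], [7,2,1,1], [[[3,3,1,1,1,1,1,1,1,1,1]], [[4,4,3,3,1,1,1]], [[4,4,4,4,3],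
       [6,6,6,3,1,1,1], [6,6,4,4,4,1,1]], [[7,7,6,5,2,2,1,1]]]),
    ([6,3,1,1], [7,4], [[[2,2,2,2,1,1,1,1,1]], [[3,3,2,2,2,2,1]], [[4,3,3,3,3,2]],
       [[6,4,4,3,3,1,1], [7,7,6,6,4,2,1,1]]]),
    ([6,2,2,1], [4,4,3], [[[3,3,2,2,2,1,1]], [[5,3,3,2,2,1,1]], [[6,6,5,4,2,2,2]],
       [[7,7,6,3,3,2,1,1]]]),
    ([6,2,1,1,1], [6,1,1,1,1,1], [[[4,3,1,1,1,1,1,1,1,1,1,1]], [[5,4,3,2,2,1,1,1]],
       [[6,4,3,2,2,2,2]], [[6,5,4,3,3,1,1,1]], [[6,6,5,3,2,2,2]], [[7,7,4,4,3,2,1,1]]]),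
    ([6,1,1,1,1,1], [6,2,1,1,1], [[[4,2,2,1,1,1,1,1,1,1,1]], [[5,4,2,2,2,1,1,1]],
       [[5,4,3,2,2,2,2]], [[7,4,4,3,2,1,1,1]], [[6,6,4,3,2,2,2]], [[7,5,5,4,3,2,1,1]]]),
    ([5,5,1], [3,2,2,2,2], [[[6,2,2,2,1,1,1,1]], [[7,4,2,1,1,1,1,1]], [[6,6,2,2,2,1,1]],
       [[6,5,5,2,2,2,1], [6,6,6,3,2,2,1]]]),
    ([5,4,2], [5,4,1,1], [[[6,2,1,1,1,1,1,1,1]], [[4,4,2,2,2,2,1]], [[4,4,4,4,2,2],
       [6,5,5,5,2,1,1]], [[7,7,6,4,4,1,1,1]]]),
    ([5,4,1,1], [5,4,2], [[[3,3,2,2,1,1,1,1]], [[4,3,3,2,1,1,1,1]], [[5,3,3,3,2,2]],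
       [[6,5,3,3,2,2,1], [7,7,7,5,3,2,1,1]]]),
    ([5,3,3], [7,3,1], [[[5,1,1,1,1,1,1,1,1,1]], [[6,2,2,2,2,1,1]], [[6,4,2,2,2,2,1]],
       [[5,4,4,4,3,2], [6,5,5,5,3,2,1]]]),
    ([5,3,2,1], [5,3,2,1], [[[3,3,3,1,1,1,1,1,1]], [[6,3,2,2,1,1,1,1]], [[5,4,3,3,2,2]],
       [[7,7,5,5,2,2,1,1]]]),
    ([5,3,1,1,1], [4,4,2,1], [[[7,2,1,1,1,1,1,1]], [[7,3,2,1,1,1,1,1]], [[7,4,3,1,1,1,1,1]],
       [[5,5,4,2,2,1,1,1]], [[7,6,4,2,1,1,1,1]], [[6,6,4,3,3,1,1,1]], [[7,6,6,3,2,1,1,1]],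
       [[7,6,6,3,3,2,1,1]]]),
    ([5,2,2,2], [5,2,2,2], [[[4,2,2,2,1,1,1,1,1]], [[4,4,2,2,1,1,1,1,1]], [[5,4,4,1,1,1,1,1,1]],
       [[6,4,3,3,2,1,1,1]], [[6,5,4,2,2,2,2]], [[7,5,5,3,2,2,1,1]], [[8,7,6,6,4,3,1,1,1]],
       [[8,8,7,6,4,3,1,1,1]]]),
    ([5,2,2,1,1], [3,3,1,1,1,1,1], [[[4,4,3,1,1,1,1,1,1,1]], [[5,5,3,2,2,1,1,1]],
       [[6,5,3,2,2,2,2]], [[7,5,4,3,2,2,1,1]], [[8,7,7,5,4,2,1,1,1]], [[8,8,7,5,4,2,2,1,1]]]),
    ([5,2,1,1,1,1], [5,2,1,1,1,1], [[[5,3,1,1,1,1,1,1,1,1,1]], [[6,3,3,2,1,1,1,1,1]],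
       [[6,5,4,1,1,1,1,1,1]], [[6,4,4,3,2,1,1,1,1]], [[7,5,5,3,1,1,1,1,1]],
       [[7,6,4,3,2,2,1,1,1]], [[7,6,4,4,3,2,1,1,1]], [[8,6,6,4,3,1,1,1,1]],
       [[8,7,5,4,3,3,1,1,1]], [[8,8,6,5,3,2,1,1,1]], [[8,8,6,5,3,3,2,1,1]]]),
    ([5,1,1,1,1,1,1], [5,1,1,1,1,1,1], [[[4,3,2,1,1,1,1,1,1,1,1,1]], [[5,4,3,3,1,1,1,1,1]],
       [[7,5,3,2,1,1,1,1,1]], [[7,5,3,3,2,1,1,1,1]], [[7,6,5,3,1,1,1,1,1]],
       [[7,6,4,4,2,2,1,1,1]], [[7,6,6,4,3,1,1,1,1]], [[8,6,5,4,4,2,1,1,1]],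
       [[8,6,6,5,4,2,1,1,1]], [[8,7,6,4,4,3,2,1,1]]]),
    ([4,4,3], [6,2,2,1], [[[3,3,2,1,1,1,1,1,1,1]], [[5,3,2,2,2,1,1,1]], [[5,4,2,2,2,2,2]],
       [[6,6,3,2,2,2,1]]]),
    ([4,4,2,1], [5,3,1,1,1], [[[4,4,1,1,1,1,1,1,1,1]], [[5,3,3,3,1,1,1,1]], [[7,5,3,1,1,1,1,1]],
       [[7,5,3,2,2,1,1,1]], [[6,6,5,3,1,1,1,1]], [[7,5,4,4,3,1,1,1]], [[7,6,5,5,2,1,1,1]],
       [[7,6,6,5,3,1,1,1]]]),
    ([4,4,1,1,1], [2,2,2,2,2,1], [[[6,5,1,1,1,1,1,1]], [[5,5,4,1,1,1,1,1]], [[7,4,4,2,1,1,1,1]],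
       [[6,5,4,4,1,1,1,1]], [[6,5,5,4,2,1,1,1]], [[7,7,4,4,2,1,1,1]], [[7,6,5,5,2,2,1,1]]]),
    ([4,3,3,1], [4,3,3,1], [[[6,2,2,1,1,1,1,1]], [[3,3,3,3,3,2]], [[4,4,4,4,3,2],
       [5,5,5,5,3,2,1]]]),
    ([4,3,2,2], [4,3,2,2], [[[3,3,3,2,1,1,1,1]], [[4,3,3,3,2,2]], [[5,5,3,3,3,2],
       [6,6,6,4,1,1,1], [6,6,4,4,4,2,1]]]),
    ([4,3,2,1,1], [4,3,2,1,1], [[[5,2,2,2,1,1,1,1,1]], [[6,3,3,1,1,1,1,1,1]],
       [[6,5,2,2,1,1,1,1,1]], [[5,5,4,3,1,1,1,1,1]], [[6,6,4,2,2,1,1,1,1]],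
       [[6,6,4,4,2,1,1,1,1]], [[7,5,5,4,3,1,1,1,1]], [[7,7,5,4,2,2,1,1,1]],
       [[7,7,5,5,3,2,1,1,1]], [[8,7,5,5,3,3,1,1,1]], [[8,8,6,5,3,3,1,1,1]],
       [[8,8,6,6,4,3,1,1,1]]]),
    ([4,3,1,1,1,1], [4,3,1,1,1,1], [[[5,4,1,1,1,1,1,1,1,1]], [[5,5,2,2,1,1,1,1,1]],
       [[5,5,3,3,1,1,1,1,1]], [[7,5,3,3,1,1,1,1,1]], [[7,6,4,2,2,1,1,1,1]],
       [[7,5,5,3,3,1,1,1,1]], [[8,6,5,3,3,1,1,1,1]], [[8,7,5,4,2,2,1,1,1]],
       [[8,6,6,4,4,2,1,1,1]], [[8,7,5,5,4,3,1,1,1]], [[8,7,7,5,4,2,2,1,1]]]),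
    ([4,2,2,2,1], [8,3], [[[2,2,2,1,1,1,1,1,1,1]], [[3,3,3,2,2,2]], [[4,4,4,3,1,1,1]],
       [[5,4,4,3,2,2]]]),
    ([4,2,2,1,1,1], [4,2,2,1,1,1], [[[4,3,3,1,1,1,1,1,1,1]], [[5,3,3,2,1,1,1,1,1,1]],
       [[6,5,3,1,1,1,1,1,1,1]], [[6,5,3,2,2,1,1,1,1,1]], [[6,6,4,3,1,1,1,1,1,1]],
       [[7,5,4,4,2,1,1,1,1,1]], [[7,6,4,4,3,1,1,1,1,1]], [[8,6,5,4,2,2,1,1,1,1]],
       [[7,7,6,4,3,2,1,1,1,1]], [[8,7,6,4,3,3,1,1,1,1]], [[9,7,6,5,4,2,1,1,1,1]],
       [[8,7,7,5,4,3,2,1,1,1]], [[9,7,7,6,4,3,2,1,1,1]], [[9,8,7,6,4,3,3,1,1,1]],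
       [[9,9,7,6,5,4,2,1,1,1]], [[9,9,8,6,5,4,3,1,1,1]]]),
    ([4,2,1,1,1,1,1], [4,2,1,1,1,1,1], [[[4,4,2,1,1,1,1,1,1,1,1]], [[6,4,2,2,1,1,1,1,1,1]],
       [[5,5,4,2,1,1,1,1,1,1]], [[6,5,3,3,2,1,1,1,1,1]], [[7,6,4,3,1,1,1,1,1,1]],
       [[7,6,4,3,3,1,1,1,1,1]], [[8,6,5,4,2,1,1,1,1,1]], [[7,6,6,4,3,2,1,1,1,1]],
       [[8,7,5,4,4,2,1,1,1,1]], [[8,7,6,4,4,3,1,1,1,1]], [[9,7,6,5,4,2,2,1,1,1]],
       [[8,8,7,5,4,3,2,1,1,1]], [[9,8,7,5,4,4,2,1,1,1]], [[9,8,7,6,4,4,3,1,1,1]],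
       [[9,9,7,6,5,4,2,2,1,1]]]),
    ([4,1,1,1,1,1,1,1], [4,1,1,1,1,1,1,1], [[[5,3,2,1,1,1,1,1,1,1,1,1]],
       [[5,4,4,2,1,1,1,1,1,1]], [[6,4,4,3,1,1,1,1,1,1]], [[7,5,4,2,2,1,1,1,1,1]],
       [[6,6,5,3,2,1,1,1,1,1]], [[7,6,5,3,2,2,1,1,1,1]], [[7,7,5,4,3,1,1,1,1,1]],
       [[8,6,5,5,3,2,1,1,1,1]], [[8,7,5,5,4,2,1,1,1,1]], [[8,7,6,5,3,3,2,1,1,1]],
       [[9,8,6,5,4,3,1,1,1,1]], [[9,8,6,5,5,3,2,1,1,1]], [[9,8,7,5,5,4,2,1,1,1]],
       [[9,8,7,6,5,3,3,2,1,1]]]),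
    ([3,3,3,2], [8,2,1], [[[4,1,1,1,1,1,1,1,1,1,1]], [[4,3,3,3,1,1,1]], [[6,6,2,1,1,1,1]],
       [[6,5,5,1,1,1,1]], [[5,5,5,4,1,1,1]]]),
    ([3,3,3,1,1], [3,3,3,1,1], [[[7,3,1,1,1,1,1,1]], [[5,5,2,2,2,1,1]], [[5,5,5,2,2,1,1],
       [6,6,5,3,3,3,1]]]),
    ([3,3,2,2,1], [9,1,1], [[[3,1,1,1,1,1,1,1,1,1,1,1]], [[4,2,2,2,2,2,2]], [[6,3,3,3,1,1,1,1]],
       [[6,6,3,2,1,1,1,1]], [[6,5,5,2,2,1,1,1]], [[7,6,5,2,2,1,1,1]], [[6,6,5,4,3,1,1,1]],
       [[7,6,5,4,4,1,1,1]]]),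
    ([3,3,2,1,1,1], [8,1,1,1], [[[3,2,1,1,1,1,1,1,1,1,1,1]], [[4,3,2,2,2,2,2]],
       [[5,5,3,3,2,1,1]]]),
    ([3,3,1,1,1,1,1], [5,2,2,1,1], [[[5,2,2,1,1,1,1,1,1,1]], [[4,4,3,2,1,1,1,1,1]],
       [[6,4,4,1,1,1,1,1,1]], [[5,5,4,3,2,1,1,1]], [[6,5,4,3,2,2,2]], [[7,6,4,3,3,2,1,1]]]),
    ([3,2,2,2,2], [5,5,1], [[[7,1,1,1,1,1,1,1]], [[4,4,2,2,2,1,1]], [[5,4,4,2,2,1,1]],
       [[7,7,6,4,2,1,1,1]]]),
    ([3,2,2,2,1,1], [2,2,2,2,1,1,1], [[[5,5,2,1,1,1,1,1,1]], [[6,5,2,2,2,1,1,1]],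
       [[6,5,5,2,1,1,1,1]], [[7,6,3,3,2,1,1,1]], [[7,6,5,4,1,1,1,1]], [[7,7,5,3,2,2,1,1]]]),
    ([3,2,2,1,1,1,1], [3,2,2,1,1,1,1], [[[5,3,2,2,1,1,1,1,1,1]], [[5,5,3,1,1,1,1,1,1,1]],
       [[6,4,4,2,2,1,1,1,1]], [[6,5,5,3,1,1,1,1,1]], [[7,5,4,3,3,1,1,1,1]],
       [[8,6,5,3,2,1,1,1,1]], [[8,6,5,3,3,2,1,1,1]], [[8,7,6,4,3,1,1,1,1]],
       [[8,7,6,4,3,2,2,1,1]], [[9,8,8,6,5,4,3,1,1,1]]]),
    ([3,2,1,1,1,1,1,1], [3,1,1,1,1,1,1,1,1], [[[5,4,2,1,1,1,1,1,1,1,1,1]],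
       [[5,5,3,2,1,1,1,1,1,1,1]], [[6,5,3,3,1,1,1,1,1,1,1]], [[7,5,4,3,1,1,1,1,1,1,1]],
       [[7,5,5,3,2,1,1,1,1,1,1]], [[7,6,5,3,3,1,1,1,1,1,1]], [[8,6,5,4,3,1,1,1,1,1,1]],
       [[8,6,6,4,3,2,1,1,1,1,1]], [[8,7,6,4,4,2,1,1,1,1,1]], [[8,7,6,5,4,2,2,1,1,1,1]],
       [[8,8,6,5,4,3,2,1,1,1,1]], [[9,8,6,6,4,3,2,1,1,1,1]], [[9,8,7,6,4,4,2,1,1,1,1]],
       [[9,8,7,6,5,4,2,2,1,1,1]], [[9,9,7,6,5,4,3,2,1,1,1]], [[10,9,7,7,5,4,3,2,1,1,1]],
       [[10,9,8,7,5,5,3,2,1,1,1]], [[10,9,8,7,6,5,3,3,1,1,1]], [[10,10,8,7,6,5,4,3,1,1,1]]]),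
    ([3,1,1,1,1,1,1,1,1], [3,2,1,1,1,1,1,1], [[[5,3,3,1,1,1,1,1,1,1,1]],
       [[6,4,3,1,1,1,1,1,1,1,1]], [[6,4,4,2,1,1,1,1,1,1,1]], [[6,5,4,2,2,1,1,1,1,1,1]],
       [[6,6,4,3,2,1,1,1,1,1,1]], [[7,6,4,4,2,1,1,1,1,1,1]], [[7,6,5,4,2,2,1,1,1,1,1]],
       [[7,7,5,4,3,2,1,1,1,1,1]], [[8,7,5,5,3,2,1,1,1,1,1]], [[8,7,6,5,3,3,1,1,1,1,1]],
       [[9,7,6,5,4,3,1,1,1,1,1]], [[9,7,7,5,4,3,2,1,1,1,1]], [[9,8,7,5,5,3,2,1,1,1,1]],
       [[9,8,7,6,5,3,3,1,1,1,1]], [[10,8,7,6,5,4,3,1,1,1,1]], [[10,8,8,6,5,4,3,2,1,1,1]],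
       [[10,9,8,6,6,4,3,2,1,1,1]], [[10,9,8,7,6,4,4,2,1,1,1]], [[10,9,8,7,6,5,4,2,2,1,1]]]),
    ([2,2,2,2,2,1], [4,4,1,1,1], [[[6,3,1,1,1,1,1,1,1]], [[4,4,4,2,1,1,1,1]],
       [[7,4,3,2,1,1,1,1]], [[7,4,4,3,1,1,1,1]], [[7,5,4,4,1,1,1,1]], [[6,6,5,3,3,1,1,1]],
       [[7,6,6,3,3,1,1,1]]]),
    ([2,2,2,2,1,1,1], [3,2,2,2,1,1], [[[6,3,2,1,1,1,1,1,1]], [[6,4,2,2,2,1,1,1]],
       [[7,5,4,1,1,1,1,1]], [[6,6,3,3,2,1,1,1]], [[7,6,4,4,1,1,1,1]], [[7,5,5,4,2,2,1,1]]]),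
    ([2,2,2,1,1,1,1,1], [2,2,2,1,1,1,1,1], [[[6,4,2,1,1,1,1,1,1,1]], [[6,4,3,2,2,1,1,1,1]],
       [[6,6,4,2,1,1,1,1,1]], [[6,5,4,4,2,1,1,1,1]], [[6,6,5,4,2,1,1,1,1]],
       [[7,7,5,4,2,1,1,1,1]], [[7,6,5,5,3,2,1,1,1]], [[7,7,6,5,3,2,1,1,1]],
       [[8,7,6,4,4,2,2,1,1]]]),
    ([2,2,1,1,1,1,1,1,1], [2,2,1,1,1,1,1,1,1], [[[5,4,2,2,1,1,1,1,1,1,1]],
       [[6,4,3,3,1,1,1,1,1,1]], [[7,5,4,2,1,1,1,1,1,1]], [[6,5,5,3,2,1,1,1,1,1]],
       [[7,5,5,4,2,1,1,1,1,1]], [[7,6,5,3,3,2,1,1,1,1]], [[8,7,5,4,3,1,1,1,1,1]],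
       [[8,6,6,5,3,2,1,1,1,1]], [[8,7,6,5,3,2,2,1,1,1]], [[8,8,6,5,4,3,1,1,1,1]],
       [[9,7,6,6,4,3,2,1,1,1]], [[9,8,6,6,5,3,2,1,1,1]], [[9,8,7,6,5,3,2,2,1,1]]]),
    ([2,1,1,1,1,1,1,1,1,1], [1,1,1,1,1,1,1,1,1,1,1], [[[5,4,3,2,1,1,1,1,1,1,1,1]],
       [[6,5,3,2,1,1,1,1,1,1,1,1]], [[6,5,4,3,1,1,1,1,1,1,1,1]], [[7,5,4,3,2,1,1,1,1,1,1,1]],
       [[7,6,5,3,2,1,1,1,1,1,1,1]], [[7,6,5,4,3,1,1,1,1,1,1,1]], [[8,6,5,4,3,2,1,1,1,1,1,1]],
       [[8,7,6,4,3,2,1,1,1,1,1,1]], [[8,7,6,5,4,2,1,1,1,1,1,1]], [[8,7,6,5,4,3,2,1,1,1,1,1]],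
       [[9,8,6,5,4,3,2,1,1,1,1,1]], [[9,8,7,6,4,3,2,1,1,1,1,1]], [[9,8,7,6,5,4,2,1,1,1,1,1]],
       [[9,8,7,6,5,4,3,2,1,1,1,1]], [[10,9,7,6,5,4,3,2,1,1,1,1]], [[10,9,8,7,5,4,3,2,1,1,1,1]],
       [[10,9,8,7,6,5,3,2,1,1,1,1]], [[10,9,8,7,6,5,4,3,1,1,1,1]], [[11,9,8,7,6,5,4,3,2,1,1,1]],
       [[11,10,9,7,6,5,4,3,2,1,1,1]], [[11,10,9,8,7,5,4,3,2,1,1,1]],
       [[11,10,9,8,7,6,5,3,2,1,1,1]], [[11,10,9,8,7,6,5,4,3,1,1,1]]]),
    ([1,1,1,1,1,1,1,1,1,1,1], [2,1,1,1,1,1,1,1,1,1], [[[5,4,3,1,1,1,1,1,1,1,1,1]],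
       [[6,4,3,2,1,1,1,1,1,1,1,1]], [[6,5,4,2,1,1,1,1,1,1,1,1]], [[6,5,4,3,2,1,1,1,1,1,1,1]],
       [[7,6,4,3,2,1,1,1,1,1,1,1]], [[7,6,5,4,2,1,1,1,1,1,1,1]], [[7,6,5,4,3,2,1,1,1,1,1,1]],
       [[8,7,5,4,3,2,1,1,1,1,1,1]], [[8,7,6,5,3,2,1,1,1,1,1,1]], [[8,7,6,5,4,3,1,1,1,1,1,1]],
       [[9,7,6,5,4,3,2,1,1,1,1,1]], [[9,8,7,5,4,3,2,1,1,1,1,1]], [[9,8,7,6,5,3,2,1,1,1,1,1]],
       [[9,8,7,6,5,4,3,1,1,1,1,1]], [[10,8,7,6,5,4,3,2,1,1,1,1]], [[10,9,8,6,5,4,3,2,1,1,1,1]],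
       [[10,9,8,7,6,4,3,2,1,1,1,1]], [[10,9,8,7,6,5,4,2,1,1,1,1]], [[10,9,8,7,6,5,4,3,2,1,1,1]],
       [[11,10,8,7,6,5,4,3,2,1,1,1]], [[11,10,9,8,6,5,4,3,2,1,1,1]],
       [[11,10,9,8,7,6,4,3,2,1,1,1]], [[11,10,9,8,7,6,5,4,2,1,1,1]]])]"

section \<open>Verification of the tables\<close>

lemma certificate0: "certificate 0 chains0"
  by code_simp

lemma complete0: "complete 0 chains0"
  by code_simp

lemma certificate1: "certificate 1 chains1"
  by code_simp

lemma complete1: "complete 1 chains1"
  by code_simp

lemma certificate2: "certificate 2 chains2"
  by code_simp

lemma complete2: "complete 2 chains2"
  by code_simp

lemma certificate3: "certificate 3 chains3"
  by code_simp

lemma complete3: "complete 3 chains3"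
  by code_simp

lemma certificate4: "certificate 4 chains4"
  by code_simp

lemma complete4: "complete 4 chains4"
  by code_simp

lemma certificate5: "certificate 5 chains5"
  by code_simp

lemma complete5: "complete 5 chains5"
  by code_simp

lemma certificate6: "certificate 6 chains6"
  by code_simp

lemma complete6: "complete 6 chains6"
  by code_simp

lemma certificate7: "certificate 7 chains7"
  by code_simp

lemma complete7: "complete 7 chains7"
  by code_simp

lemma certificate8: "certificate 8 chains8"
  by code_simp

lemma complete8: "complete 8 chains8"
  by code_simp

lemma certificate9: "certificate 9 chains9"
  by code_simp

lemma complete9: "complete 9 chains9"
  by code_simp

lemma certificate10: "certificate 10 chains10"
  by code_simp

lemma complete10: "complete 10 chains10"
  by code_simp

lemma certificate11: "certificate 11 chains11"
  by code_simp

lemma complete11: "complete 11 chains11"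
  by code_simp

section \<open>Existence of the local chains\<close>

theorem mainTheorem2:
  fixes k :: nat
  assumes "k \<le> 11"
  shows "\<exists>(L :: partition set set) (star :: partition set \<Rightarrow> partition set).
    (\<forall>S\<in>L. local_chain k S) \<and>
    (\<forall>S\<in>L. star S \<in> L \<and> star (star S) = S) \<and>
    (\<forall>mu\<in>Par k. tail mu \<in> L) \<and>
    (\<forall>S\<in>L. \<forall>T\<in>L. S \<noteq> T \<longrightarrow>
       S \<inter> T = {} \<or> right_part k S = left_part k T \<or> right_part k T = left_part k S) \<and>
    (\<forall>g\<in>Def k.
       (\<exists>S. {U\<in>L. g \<in> U} = {S} \<and> g \<in> mid_part k S) \<or>
       (\<exists>S T. S \<noteq> T \<and> {U\<in>L. g \<in> U} = {S, T} \<and>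
              g \<in> right_part k S \<and> g \<in> left_part k T)) \<and>
    (\<forall>S\<in>L. locally_opposite k S (star S)) \<and>
    (\<forall>S\<in>L. \<forall>T\<in>L. S \<inter> T \<noteq> {} \<longrightarrow> star S \<inter> star T \<noteq> {}) \<and>
    (\<forall>S\<in>L. \<exists>G\<subseteq>Collect is_partition.
       left_part k S \<union> mid_part k S = (\<Union>g\<in>G. nu_segment g))"
proof -
  have cases: "k = 0 \<or> k = 1 \<or> k = 2 \<or> k = 3 \<or> k = 4 \<or> k = 5 \<or> k = 6 \<or> k = 7
    \<or> k = 8 \<or> k = 9 \<or> k = 10 \<or> k = 11"
    using assms by presburger
  consider "k = 0" | "k = 1" | "k = 2" | "k = 3" | "k = 4" | "k = 5" | "k = 6" | "k = 7"
    | "k = 8" | "k = 9" | "k = 10" | "k = 11"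
    using cases by blast
  then have "\<exists>D. certificate k D \<and> complete k D"
  proof cases
    case 1
    then show ?thesis using certificate0 complete0 by blast
  next
    case 2
    then show ?thesis using certificate1 complete1 by blast
  next
    case 3
    then show ?thesis using certificate2 complete2 by blast
  next
    case 4
    then show ?thesis using certificate3 complete3 by blast
  next
    case 5
    then show ?thesis using certificate4 complete4 by blast
  next
    case 6
    then show ?thesis using certificate5 complete5 by blast
  next
    case 7
    then show ?thesis using certificate6 complete6 by blast
  next
    case 8
    then show ?thesis using certificate7 complete7 by blast
  next
    case 9
    then show ?thesis using certificate8 complete8 by blast
  next
    case 10
    then show ?thesis using certificate9 complete9 by blast
  next
    case 11
    then show ?thesis using certificate10 complete10 by blast
  next
    case 12
    then show ?thesis using certificate11 complete11 by blast
  qed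
  then obtain D where "certificate k D" "complete k D" by blast
  then show ?thesis by (rule chains_exist)
qed

end
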